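(* Let $M$ be a closed manifold (compact without boundary) with a closed $G_2$-structure $\varphi$. Then there are no nonzero Rochesterian vector fields on $M$, and hence there are no nonzero Rochesterian $1$-forms on $M$.
   Context: A $G_2$-structure on a $7$-dimensional smooth manifold $M$ is a smooth differential $3$-form $\varphi$ such that for every $p\in M$ the pair $(T_pM,\varphi_p)$ is isomorphic, as an oriented vector space, to $(\mathbb{R}^7,\varphi_0)$, where $$\varphi_0=dx^{123}+dx^{145}+dx^{167}+dx^{246}-dx^{257}-dx^{347}-dx^{356},\quad dx^{ijk}=dx^i\wedge dx^j\wedge dx^k.$$ The $G_2$-structure is closed if $d\varphi=0$. For a vector field $X$, $X\lrcorner\varphi$ denotes the $2$-form obtained by contracting $\varphi$ with $X$. A Rochesterian vector field on $M$ is a smooth vector field $X$ for which there is a smooth $1$-form $\alpha$ with $X\lrcorner\varphi=d\alpha$. A Rochesterian $1$-form on $M$ is a smooth $1$-form $\alpha$ for which there is a smooth vector field $X$ with $d\alpha=X\lrcorner\varphi$.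
   Formalization: Read literally, the claim on 1-forms fails: every closed 1-form (e.g. dx^1 on the flat 7-torus) is Rochesterian with X = 0. What is proved is that every Rochesterian 1-form α on M satisfies dα = 0; the claim on vector fields is as stated. *)

theory Defs
  imports "HOL-Analysis.Analysis"
begin

section \<open>Smooth maps between open subsets of Euclidean spaces\<close>

primrec Ck_on :: "nat \<Rightarrow> ('a::euclidean_space \<Rightarrow> 'b::real_normed_vector) \<Rightarrow> 'a set \<Rightarrow> bool" where
  "Ck_on 0 f S \<longleftrightarrow> continuous_on S f"
| "Ck_on (Suc k) f S \<longleftrightarrow>
     (\<forall>x\<in>S. f differentiable (at x)) \<and> (\<forall>v. Ck_on k (\<lambda>x. frechet_derivative f (at x) v) S)"

definition smooth_on :: "('a::euclidean_space \<Rightarrow> 'b::real_normed_vector) \<Rightarrow> 'a set \<Rightarrow> bool" where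
  "smooth_on f S \<longleftrightarrow> open S \<and> (\<forall>k. Ck_on k f S)"

section \<open>Smooth manifolds\<close>

type_synonym ('a, 'n) chart = "'a set \<times> ('a \<Rightarrow> real ^ 'n)"

definition chart_inv :: "('a, 'n) chart \<Rightarrow> real ^ 'n \<Rightarrow> 'a" where
  "chart_inv c = inv_into (fst c) (snd c)"

definition is_chart :: "'a topology \<Rightarrow> ('a, 'n::finite) chart \<Rightarrow> bool" where
  "is_chart T c \<longleftrightarrow> openin T (fst c) \<and> open (snd c ` fst c) \<and>
     homeomorphic_map (subtopology T (fst c)) (top_of_set (snd c ` fst c)) (snd c)"

definition transition :: "('a, 'n) chart \<Rightarrow> ('a, 'n) chart \<Rightarrow> real ^ 'n \<Rightarrow> real ^ 'n" where
  "transition c d = snd d \<circ> chart_inv c"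

text \<open>The atlas need not be maximal; the notions below are unchanged when compatible charts
  are added.\<close>

record ('a, 'n) manifold =
  Top :: "'a topology"
  Atlas :: "('a, 'n) chart set"

abbreviation points :: "('a, 'n) manifold \<Rightarrow> 'a set" where
  "points M \<equiv> topspace (Top M)"

definition smooth_manifold :: "('a, 'n::finite) manifold \<Rightarrow> bool" where
  "smooth_manifold M \<longleftrightarrow>
     Hausdorff_space (Top M) \<and> second_countable (Top M) \<and>
     (\<forall>c\<in>Atlas M. is_chart (Top M) c) \<and> (\<Union>c\<in>Atlas M. fst c) = points M \<and>
     (\<forall>c\<in>Atlas M. \<forall>d\<in>Atlas M. smooth_on (transition c d) (snd c ` (fst c \<inter> fst d)))"

definition closed_manifold :: "('a, 'n::finite) manifold \<Rightarrow> bool" where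
  "closed_manifold M \<longleftrightarrow> smooth_manifold M \<and> compact_space (Top M)"

definition charts_at :: "('a, 'n) manifold \<Rightarrow> 'a \<Rightarrow> ('a, 'n) chart set" where
  "charts_at M p = {c \<in> Atlas M. p \<in> fst c}"

section \<open>Tangent vectors and orientations\<close>

text \<open>A tangent vector at \<open>p\<close> assigns to every chart around \<open>p\<close> its coordinate vector in that
  chart, subject to the usual transformation law, and is normalised to 0 on all other charts.
  The vector space operations are pointwise.\<close>

type_synonym ('a, 'n) tangent = "('a, 'n) chart \<Rightarrow> real ^ 'n"

definition tangent_space :: "('a, 'n::finite) manifold \<Rightarrow> 'a \<Rightarrow> ('a, 'n) tangent set" where
  "tangent_space M p =
     {v. (\<forall>c\<in>charts_at M p. \<forall>d\<in>charts_at M p.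
            v d = frechet_derivative (transition c d) (at (snd c p)) (v c)) \<and>
         (\<forall>c. c \<notin> charts_at M p \<longrightarrow> v c = 0)}"

text \<open>The tangent vector at \<open>p\<close> whose coordinate vector in the chart \<open>c\<close> is \<open>w\<close>.\<close>

definition coord_vec ::
    "('a, 'n::finite) manifold \<Rightarrow> ('a, 'n) chart \<Rightarrow> 'a \<Rightarrow> real ^ 'n \<Rightarrow> ('a, 'n) tangent" where
  "coord_vec M c p w =
     (\<lambda>d. if d \<in> charts_at M p
          then frechet_derivative (transition c d) (at (snd c p)) w else 0)"

text \<open>Linear isomorphisms from Euclidean space onto the tangent space at \<open>p\<close>.\<close>

definition frames ::
    "('a, 'n::finite) manifold \<Rightarrow> 'a \<Rightarrow> (real ^ 'n \<Rightarrow> ('a, 'n) tangent) set" where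
  "frames M p = {L. bij_betw L UNIV (tangent_space M p) \<and> (\<forall>c. linear (\<lambda>w. L w c))}"

text \<open>An orientation selects at each point one of the two classes of frames modulo positive
  determinant, locally consistently with the coordinate frames. The frames in \<open>ori p\<close> are thus
  the orientation preserving isomorphisms from standardly oriented Euclidean space.\<close>

definition orientation ::
    "('a, 'n::finite) manifold \<Rightarrow> ('a \<Rightarrow> (real ^ 'n \<Rightarrow> ('a, 'n) tangent) set) \<Rightarrow> bool" where
  "orientation M ori \<longleftrightarrow>
     (\<forall>p\<in>points M. ori p \<noteq> {} \<and> ori p \<subseteq> frames M p \<and>
        (\<forall>L\<in>ori p. \<forall>L'\<in>frames M p. L' \<in> ori p \<longleftrightarrow> 0 < det (matrix (inv L \<circ> L')))) \<and>
     (\<forall>c\<in>Atlas M. \<forall>p\<in>fst c. \<exists>W. openin (Top M) W \<and> p \<in> W \<and> W \<subseteq> fst c \<and>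
        (\<forall>q\<in>W. coord_vec M c q \<in> ori q \<longleftrightarrow> coord_vec M c p \<in> ori p))"

section \<open>Vector fields and differential forms\<close>

type_synonym ('a, 'n) vfield = "'a \<Rightarrow> ('a, 'n) tangent"

definition vector_field :: "('a, 'n::finite) manifold \<Rightarrow> ('a, 'n) vfield \<Rightarrow> bool" where
  "vector_field M X \<longleftrightarrow>
     (\<forall>p\<in>points M. X p \<in> tangent_space M p) \<and>
     (\<forall>c\<in>Atlas M. smooth_on (\<lambda>x. X (chart_inv c x) c) (snd c ` fst c))"

text \<open>A \<open>k\<close>-form takes the list of its \<open>k\<close> arguments. Its values on lists of another length or on
  lists with entries outside the tangent space are irrelevant.\<close>

type_synonym ('a, 'n) form = "'a \<Rightarrow> ('a, 'n) tangent list \<Rightarrow> real"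

definition arg_lists ::
    "('a, 'n::finite) manifold \<Rightarrow> nat \<Rightarrow> 'a \<Rightarrow> ('a, 'n) tangent list set" where
  "arg_lists M k p = {vs. length vs = k \<and> set vs \<subseteq> tangent_space M p}"

definition alternating_multilinear ::
    "('a, 'n::finite) manifold \<Rightarrow> nat \<Rightarrow> 'a \<Rightarrow> (('a, 'n) tangent list \<Rightarrow> real) \<Rightarrow> bool" where
  "alternating_multilinear M k p f \<longleftrightarrow>
     (\<forall>vs\<in>arg_lists M k p. \<forall>i<k. \<forall>u\<in>tangent_space M p. \<forall>v\<in>tangent_space M p. \<forall>a b.
        f (vs[i := \<lambda>c. a *\<^sub>R u c + b *\<^sub>R v c]) = a * f (vs[i := u]) + b * f (vs[i := v])) \<and>
     (\<forall>vs\<in>arg_lists M k p. \<forall>i<k. \<forall>j<k. i \<noteq> j \<and> vs ! i = vs ! j \<longrightarrow> f vs = 0)"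

definition local_form ::
    "('a, 'n::finite) manifold \<Rightarrow> ('a, 'n) form \<Rightarrow> ('a, 'n) chart \<Rightarrow>
     (real ^ 'n) list \<Rightarrow> real ^ 'n \<Rightarrow> real" where
  "local_form M \<omega> c ws x =
     \<omega> (chart_inv c x) (map (coord_vec M c (chart_inv c x)) ws)"

definition diff_form :: "('a, 'n::finite) manifold \<Rightarrow> nat \<Rightarrow> ('a, 'n) form \<Rightarrow> bool" where
  "diff_form M k \<omega> \<longleftrightarrow>
     (\<forall>p\<in>points M. alternating_multilinear M k p (\<omega> p)) \<and>
     (\<forall>c\<in>Atlas M. \<forall>ws. length ws = k \<longrightarrow> smooth_on (local_form M \<omega> c ws) (snd c ` fst c))"

definition form_eq ::
    "('a, 'n::finite) manifold \<Rightarrow> nat \<Rightarrow> ('a, 'n) form \<Rightarrow> ('a, 'n) form \<Rightarrow> bool" where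
  "form_eq M k \<omega> \<eta> \<longleftrightarrow> (\<forall>p\<in>points M. \<forall>vs\<in>arg_lists M k p. \<omega> p vs = \<eta> p vs)"

definition zero_form :: "('a, 'n) form" where
  "zero_form = (\<lambda>p vs. 0)"

text \<open>The exterior derivative in coordinates: for constant vector fields,
  \<open>d\<omega>(v\<^sub>0,\<dots>,v\<^sub>k)\<close> is the alternating sum over \<open>i\<close> of the derivative in direction \<open>v\<^sub>i\<close> of
  \<open>\<omega>\<close> applied to the remaining vectors. The result does not depend on the chart, so any chart
  around the point can be used to define it.\<close>

definition ext_deriv_in ::
    "('a, 'n::finite) manifold \<Rightarrow> ('a, 'n) chart \<Rightarrow> ('a, 'n) form \<Rightarrow> ('a, 'n) form" where
  "ext_deriv_in M c \<omega> p vs =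
     (let ws = map (\<lambda>v. v c) vs in
      \<Sum>i<length ws. (- 1) ^ i *
        frechet_derivative (local_form M \<omega> c (take i ws @ drop (Suc i) ws)) (at (snd c p)) (ws ! i))"

definition ext_deriv :: "('a, 'n::finite) manifold \<Rightarrow> ('a, 'n) form \<Rightarrow> ('a, 'n) form" where
  "ext_deriv M \<omega> p = ext_deriv_in M (SOME c. c \<in> charts_at M p) \<omega> p"

definition contraction :: "('a, 'n) vfield \<Rightarrow> ('a, 'n) form \<Rightarrow> ('a, 'n) form" where
  "contraction X \<omega> p vs = \<omega> p (X p # vs)"

section \<open>G2-structures and Rochesterian fields\<close>

text \<open>\<open>dx3 i j k\<close> is the 3-form \<open>dx\<^sup>i \<and> dx\<^sup>j \<and> dx\<^sup>k\<close> on \<open>\<real>\<^sup>7\<close>, normalised to take the value 1 on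
  the corresponding basis vectors. The indices 1 to 7 are the seven distinct elements of the
  index type (7 being another name of its element 0), and \<open>axis i 1\<close> is the \<open>i\<close>-th basis
  vector.\<close>

definition dx3 :: "7 \<Rightarrow> 7 \<Rightarrow> 7 \<Rightarrow> real ^ 7 \<Rightarrow> real ^ 7 \<Rightarrow> real ^ 7 \<Rightarrow> real" where
  "dx3 i j k u v w =
     det (vector [vector [u $ i, v $ i, w $ i],
                  vector [u $ j, v $ j, w $ j],
                  vector [u $ k, v $ k, w $ k]] :: real ^ 3 ^ 3)"

definition phi0 :: "real ^ 7 \<Rightarrow> real ^ 7 \<Rightarrow> real ^ 7 \<Rightarrow> real" where
  "phi0 u v w =
     dx3 1 2 3 u v w + dx3 1 4 5 u v w + dx3 1 6 7 u v w + dx3 2 4 6 u v w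
     - dx3 2 5 7 u v w - dx3 3 4 7 u v w - dx3 3 5 6 u v w"

text \<open>The orientation is not extra data: the stabiliser of \<open>phi0\<close> preserves the orientation of
  \<open>\<real>\<^sup>7\<close>, so \<open>\<phi>\<close> determines \<open>ori\<close>.\<close>

definition G2_structure :: "('a, 7) manifold \<Rightarrow> ('a, 7) form \<Rightarrow> bool" where
  "G2_structure M \<phi> \<longleftrightarrow> diff_form M 3 \<phi> \<and>
     (\<exists>ori. orientation M ori \<and>
        (\<forall>p\<in>points M. \<exists>L\<in>ori p. \<forall>u v w. \<phi> p [L u, L v, L w] = phi0 u v w))"

definition closed_G2_structure :: "('a, 7) manifold \<Rightarrow> ('a, 7) form \<Rightarrow> bool" where
  "closed_G2_structure M \<phi> \<longleftrightarrow> G2_structure M \<phi> \<and> form_eq M 4 (ext_deriv M \<phi>) zero_form"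

definition Rochesterian_vfield ::
    "('a, 7) manifold \<Rightarrow> ('a, 7) form \<Rightarrow> ('a, 7) vfield \<Rightarrow> bool" where
  "Rochesterian_vfield M \<phi> X \<longleftrightarrow> vector_field M X \<and>
     (\<exists>\<alpha>. diff_form M 1 \<alpha> \<and> form_eq M 2 (contraction X \<phi>) (ext_deriv M \<alpha>))"

definition Rochesterian_form ::
    "('a, 7) manifold \<Rightarrow> ('a, 7) form \<Rightarrow> ('a, 7) form \<Rightarrow> bool" where
  "Rochesterian_form M \<phi> \<alpha> \<longleftrightarrow> diff_form M 1 \<alpha> \<and>
     (\<exists>X. vector_field M X \<and> form_eq M 2 (ext_deriv M \<alpha>) (contraction X \<phi>))"

definition nonzero_vfield :: "('a, 'n::finite) manifold \<Rightarrow> ('a, 'n) vfield \<Rightarrow> bool" where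
  "nonzero_vfield M X \<longleftrightarrow> (\<exists>p\<in>points M. X p \<noteq> (\<lambda>c. 0))"

text \<open>Every closed 1-form \<open>\<alpha>\<close>, for instance \<open>df\<close> for a smooth function \<open>f\<close>, is Rochesterian, with
  \<open>X = 0\<close>. As with Hamiltonian functions, which matter only up to constants, a Rochesterian
  1-form is therefore considered modulo closed 1-forms: it counts as nonzero if \<open>d\<alpha> \<noteq> 0\<close>.\<close>

definition nonzero_mod_closed :: "('a, 'n::finite) manifold \<Rightarrow> ('a, 'n) form \<Rightarrow> bool" where
  "nonzero_mod_closed M \<alpha> \<longleftrightarrow> \<not> form_eq M 2 (ext_deriv M \<alpha>) zero_form"

end

theory Submission
  imports Defs
begin

text \<open>Write \<open>\<beta> = X \<lrcorner> \<phi> = d\<alpha>\<close>. Pointwise \<open>\<beta> \<and> \<beta> \<and> \<phi> = 6 |X|\<^sup>2 vol\<close> for the metric and orientation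
  induced by \<open>\<phi>\<close>, while \<open>\<beta> \<and> \<beta> \<and> \<phi> = d(\<alpha> \<and> \<beta> \<and> \<phi>)\<close> because \<open>d\<beta> = 0\<close> and \<open>d\<phi> = 0\<close>. By Stokes'
  theorem the integral of \<open>|X|\<^sup>2\<close> vanishes, so \<open>X = 0\<close>, and then \<open>d\<alpha> = 0\<close>.

  Stokes' theorem is only needed for this 7-form. With a partition of unity \<open>\<rho>\<^sub>i\<close> subordinate to
  charts, \<open>\<integral> d(\<rho>\<^sub>i \<alpha> \<and> \<beta> \<and> \<phi>) = 0\<close> holds in each chart, since partial derivatives of compactly
  supported functions have integral zero; the terms \<open>d\<rho>\<^sub>i \<and> \<alpha> \<and> \<beta> \<and> \<phi>\<close> cancel in the sum, after a change
  of variables between charts, because \<open>\<Sum>\<^sub>i d\<rho>\<^sub>i = 0\<close>. The partition need only be \<open>C\<^sup>1\<close>.\<close>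

section \<open>Alternating sums over seven indices\<close>

text \<open>The obstacle is orientation. \<open>Atlas M\<close> is an arbitrary atlas: its charts
  may reverse orientation, and a chart with disconnected domain may preserve it on one component and
  reverse it on another. Coefficients of 7-forms change by the Jacobian determinant, whereas
  integrals change by its absolute value. The two are reconciled by a sign attached to each chart
  and point, which is only locally constant. The supports in the partition of unity are therefore
  chosen so small that the sign is constant on each and can be pulled out of an integral. Wedge
  products are replaced by alternating sums of products of components. The pointwise identity
  thereby becomes a polynomial identity in the coordinates of X, to which each of the seven
  monomials of \<open>phi0\<close> contributes the squares of its own three coordinates.\<close>

lemma exhaust_7: fixes x :: 7
  shows "x = 1 \<or> x = 2 \<or> x = 3 \<or> x = 4 \<or> x = 5 \<or> x = 6 \<or> x = 7"
proof (induct x)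
  case (of_int z)
  then have "z = 0 \<or> z = 1 \<or> z = 2 \<or> z = 3 \<or> z = 4 \<or> z = 5 \<or> z = 6"
    by (simp, presburger)
  then show ?case by auto
qed

lemma UNIV_7: "UNIV = {1, 2, 3, 4, 5, 6, 7 :: 7}"
  using exhaust_7 by auto

section \<open>Antisymmetrisation over permutations of the argument slots\<close>

abbreviation swap :: "'a \<Rightarrow> 'a \<Rightarrow> 'a \<Rightarrow> 'a" where
  "swap \<equiv> Transposition.transpose"

text \<open>If \<open>h \<sigma>\<close> is a product of forms whose degrees add up to the
  dimension, evaluated on the vectors \<open>axis (\<sigma> i) 1\<close>, this is their wedge
  product on the standard basis times the product of the factorials of the degrees.\<close>

definition alt_sum :: "(('n::finite \<Rightarrow> 'n) \<Rightarrow> real) \<Rightarrow> real" where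
  "alt_sum h = (\<Sum>\<sigma> | \<sigma> permutes UNIV. of_int (sign \<sigma>) * h \<sigma>)"

lemma alt_sum_add: "alt_sum (\<lambda>\<sigma>. g \<sigma> + h \<sigma>) = alt_sum g + alt_sum h"
  by (simp add: alt_sum_def distrib_left sum.distrib)

lemma alt_sum_diff: "alt_sum (\<lambda>\<sigma>. g \<sigma> - h \<sigma>) = alt_sum g - alt_sum h"
  by (simp add: alt_sum_def right_diff_distrib sum_subtractf)

lemma alt_sum_cmult: "alt_sum (\<lambda>\<sigma>. a * h \<sigma>) = a * alt_sum h"
  by (simp add: alt_sum_def sum_distrib_left mult.left_commute)

lemma alt_sum_sum: "alt_sum (\<lambda>\<sigma>. \<Sum>i\<in>I. h i \<sigma>) = (\<Sum>i\<in>I. alt_sum (h i))"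
  by (simp add: alt_sum_def sum_distrib_left) (rule sum.swap)

text \<open>Substituting \<open>\<sigma> \<circ> \<pi>\<close> for \<open>\<sigma>\<close>
  multiplies the sign by \<open>sign \<pi>\<close>, which is its own inverse. As
  \<open>\<sigma> i\<close> is the index placed in slot \<open>i\<close>, right composition permutes
  slots; symmetries between slots thus become cancellations.\<close>

lemma alt_sum_comp:
  assumes "\<pi> permutes UNIV"
  shows "alt_sum (\<lambda>\<sigma>. h (\<sigma> \<circ> \<pi>)) = of_int (sign \<pi>) * alt_sum h"
proof -
  have "alt_sum h = (\<Sum>\<sigma> | \<sigma> permutes UNIV. of_int (sign (\<sigma> \<circ> \<pi>)) * h (\<sigma> \<circ> \<pi>))"
    unfolding alt_sum_def by (rule sum_permutations_compose_right[OF assms])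
  also have "\<dots> = of_int (sign \<pi>) * alt_sum (\<lambda>\<sigma>. h (\<sigma> \<circ> \<pi>))"
    unfolding alt_sum_def sum_distrib_left
  proof (rule sum.cong)
    fix \<sigma> :: "'a \<Rightarrow> 'a" assume "\<sigma> \<in> {\<sigma>. \<sigma> permutes UNIV}"
    then have "permutation \<sigma>" "permutation \<pi>"
      using assms finite permutation_permutes by blast+
    then show "of_int (sign (\<sigma> \<circ> \<pi>)) * h (\<sigma> \<circ> \<pi>) =
        of_int (sign \<pi>) * (of_int (sign \<sigma>) * h (\<sigma> \<circ> \<pi>))"
      by (simp add: sign_compose)
  qed simp
  finally show ?thesis
    by (simp flip: of_int_mult add: mult.assoc[symmetric])
qed

lemma alt_sum_transpose:
  "i \<noteq> j \<Longrightarrow> alt_sum (\<lambda>\<sigma>. h (\<sigma> \<circ> swap i j)) = - alt_sum h"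
  by (subst alt_sum_comp) (auto simp: permutes_swap_id sign_swap_id)

section \<open>Multilinear maps and determinants\<close>

definition multilin :: "(('n::finite \<Rightarrow> real ^ 'n) \<Rightarrow> real) \<Rightarrow> bool" where
  "multilin T \<longleftrightarrow> (\<forall>v i. linear (\<lambda>u. T (v(i := u))))"

text \<open>Induction on the set \<open>K\<close> of expanded slots. The other slots hold an
  arbitrary \<open>v\<close>, so that the basis vector which linearity puts into the new slot
  \<open>z\<close> can be absorbed into \<open>v\<close> before the induction hypothesis is
  applied.\<close>

lemma multilin_expand:
  fixes T :: "('n::finite \<Rightarrow> real ^ 'n) \<Rightarrow> real" and A :: "real ^ 'n ^ 'n"
  assumes "multilin T" "finite K"
  shows "T (\<lambda>i. if i \<in> K then (\<Sum>j\<in>UNIV. A $ j $ s i *\<^sub>R axis j 1) else v i) =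
    (\<Sum>f\<in>K \<rightarrow>\<^sub>E UNIV. (\<Prod>i\<in>K. A $ f i $ s i) * T (\<lambda>i. if i \<in> K then axis (f i) 1 else v i))"
  using assms(2)
proof (induction K arbitrary: v)
  case (insert z K)
  have lin: "linear (\<lambda>u. T (w(z := u)))" for w
    using assms by (simp add: multilin_def)
  let ?e = "\<lambda>i. \<Sum>j\<in>UNIV. A $ j $ s i *\<^sub>R axis j (1::real)"
  have "T (\<lambda>i. if i \<in> insert z K then ?e i else v i) =
        T ((\<lambda>i. if i \<in> K then ?e i else v i)(z := ?e z))"
    by (rule arg_cong[where f = T]) auto
  also have "\<dots> = (\<Sum>j\<in>UNIV. A $ j $ s z * T ((\<lambda>i. if i \<in> K then ?e i else v i)(z := axis j 1)))"
    by (simp only: linear_sum[OF lin] linear_scale[OF lin] real_scaleR_def)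
  also have "\<dots> = (\<Sum>j\<in>UNIV. A $ j $ s z * T (\<lambda>i. if i \<in> K then ?e i else (v(z := axis j 1)) i))"
    using insert by (intro sum.cong refl arg_cong2[where f = "(*)"] arg_cong[where f = T]) auto
  also have "\<dots> = (\<Sum>j\<in>UNIV. \<Sum>f\<in>K \<rightarrow>\<^sub>E UNIV. A $ j $ s z * ((\<Prod>i\<in>K. A $ f i $ s i) *
      T (\<lambda>i. if i \<in> K then axis (f i) 1 else (v(z := axis j 1)) i)))"
    unfolding insert.IH sum_distrib_left ..
  also have "\<dots> = (\<Sum>(j, f)\<in>UNIV \<times> (K \<rightarrow>\<^sub>E UNIV). A $ j $ s z * ((\<Prod>i\<in>K. A $ f i $ s i) *
      T (\<lambda>i. if i \<in> K then axis (f i) 1 else (v(z := axis j 1)) i)))"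
    by (rule sum.cartesian_product)
  also have "\<dots> = (\<Sum>f\<in>insert z K \<rightarrow>\<^sub>E UNIV. (\<Prod>i\<in>insert z K. A $ f i $ s i) *
      T (\<lambda>i. if i \<in> insert z K then axis (f i) 1 else v i))"
  proof -
    have 1: "(\<Prod>i\<in>insert z K. A $ (f(z := j)) i $ s i) = A $ j $ s z * (\<Prod>i\<in>K. A $ f i $ s i)"
      for j f using insert by (auto intro!: prod.cong)
    have 2: "(\<lambda>i. if i \<in> insert z K then axis ((f(z := j)) i) 1 else v i) =
        (\<lambda>i. if i \<in> K then axis (f i) 1 else (v(z := axis j (1::real))) i)" for j f
      using insert by (auto simp: fun_eq_iff)
    show ?thesis
      unfolding PiE_insert_eq
    proof (subst sum.reindex)
      show "inj_on (\<lambda>(y, g). g(z := y)) (UNIV \<times> (K \<rightarrow>\<^sub>E (UNIV :: 'n set)))"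
        using inj_combinator[OF insert.hyps(2), of "\<lambda>_. UNIV"] by simp
    qed (auto simp only: o_def split_beta fst_conv snd_conv 1 2 mult.assoc intro!: sum.cong)
  qed
  finally show ?case .
qed simp

text \<open>Pullback of a top-degree form. After expansion in the basis, the sum over
  \<open>\<sigma>\<close> collects for each choice \<open>f\<close> the determinant whose
  \<open>i\<close>-th row is row \<open>f i\<close> of the matrix of \<open>A\<close>. Two equal
  rows make it vanish unless \<open>f\<close> is a permutation, and then it is \<open>sign f\<close>
  times the determinant of \<open>A\<close>.\<close>

lemma alt_sum_linear_image:
  fixes T :: "('n::finite \<Rightarrow> real ^ 'n) \<Rightarrow> real"
  assumes T: "multilin T" and A: "linear A"
  shows "alt_sum (\<lambda>\<sigma>. T (\<lambda>i. A (axis (\<sigma> i) 1))) =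
    det (matrix A) * alt_sum (\<lambda>\<sigma>. T (\<lambda>i. axis (\<sigma> i) 1))"
proof -
  let ?M = "matrix A"
  let ?T = "\<lambda>f. T (\<lambda>i. axis (f i) 1)"
  have A_axis: "A (axis i 1) = (\<Sum>j\<in>UNIV. ?M $ j $ i *\<^sub>R axis j 1)" for i
    by (simp add: matrix_def vec_eq_iff axis_def if_distrib[of "\<lambda>x. _ * x"] sum.delta cong: if_cong)
  have "alt_sum (\<lambda>\<sigma>. T (\<lambda>i. A (axis (\<sigma> i) 1))) =
     alt_sum (\<lambda>\<sigma>. \<Sum>f\<in>UNIV. (\<Prod>i\<in>UNIV. ?M $ f i $ \<sigma> i) * ?T f)"
    using multilin_expand[OF T, where K = UNIV and A = ?M] by (simp add: A_axis)
  also have "\<dots> = (\<Sum>f\<in>UNIV. det (\<chi> i. ?M $ f i) * ?T f)"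
    by (simp add: alt_sum_def det_def sum_distrib_left sum_distrib_right mult.assoc) (rule sum.swap)
  also have "\<dots> = (\<Sum>f | f permutes UNIV. det (\<chi> i. ?M $ f i) * ?T f)"
  proof (rule sum.mono_neutral_right)
    show "\<forall>f\<in>UNIV - {f. f permutes UNIV}. det (\<chi> i. ?M $ f i) * ?T f = 0"
    proof
      fix f :: "'n \<Rightarrow> 'n" assume "f \<in> UNIV - {f. f permutes UNIV}"
      then have "\<not> inj f"
        using finite_UNIV_inj_surj[of f] bij_imp_permutes[of f UNIV] by (auto simp: bij_def)
      then obtain i j where "f i = f j" "i \<noteq> j" by (auto simp: inj_def)
      then have "det (\<chi> i. ?M $ f i) = 0"
        by (intro det_identical_rows[of i j]) (auto simp: row_def)
      then show "det (\<chi> i. ?M $ f i) * ?T f = 0" by simp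
    qed
  qed auto
  also have "\<dots> = det ?M * alt_sum ?T"
    by (simp add: alt_sum_def sum_distrib_left det_permute_rows mult.commute mult.left_commute mult.assoc)
  finally show ?thesis .
qed

text \<open>Fixing the last three slots leaves the permutations of \<open>{1, 2, 3, 4}\<close>: 24
  signed terms instead of 5040, few enough to be written out.\<close>

lemma alt_sum_fixed_567:
  fixes B :: "7 \<Rightarrow> 7 \<Rightarrow> 7 \<Rightarrow> 7 \<Rightarrow> real"
  shows "alt_sum (\<lambda>\<sigma>. B (\<sigma> 1) (\<sigma> 2) (\<sigma> 3) (\<sigma> 4) * of_bool (\<sigma> 5 = 5 \<and> \<sigma> 6 = 6 \<and> \<sigma> 7 = 7)) =
      B 1 2 3 4 - B 1 2 4 3 - B 1 3 2 4 + B 1 3 4 2 + B 1 4 2 3 - B 1 4 3 2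
    - B 2 1 3 4 + B 2 1 4 3 + B 2 3 1 4 - B 2 3 4 1 - B 2 4 1 3 + B 2 4 3 1
    + B 3 1 2 4 - B 3 1 4 2 - B 3 2 1 4 + B 3 2 4 1 + B 3 4 1 2 - B 3 4 2 1
    - B 4 1 2 3 + B 4 1 3 2 + B 4 2 1 3 - B 4 2 3 1 - B 4 3 1 2 + B 4 3 2 1" (is "_ = ?rhs")
proof -
  have fix567: "\<sigma> permutes UNIV \<and> \<sigma> 5 = 5 \<and> \<sigma> 6 = 6 \<and> \<sigma> 7 = 7 \<longleftrightarrow> \<sigma> permutes {1, 2, 3, 4}"
    for \<sigma> :: "7 \<Rightarrow> 7"
  proof
    assume \<sigma>: "\<sigma> permutes UNIV \<and> \<sigma> 5 = 5 \<and> \<sigma> 6 = 6 \<and> \<sigma> 7 = 7"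
    have "\<sigma> x = x" if "x \<notin> {1, 2, 3, 4}" for x
      using exhaust_7[of x] that \<sigma> by auto
    then show "\<sigma> permutes {1, 2, 3, 4}"
      using \<sigma> by (auto simp: permutes_def)
  qed (auto simp: permutes_def)
  have "alt_sum (\<lambda>\<sigma>. B (\<sigma> 1) (\<sigma> 2) (\<sigma> 3) (\<sigma> 4) * of_bool (\<sigma> 5 = 5 \<and> \<sigma> 6 = 6 \<and> \<sigma> 7 = 7)) =
      (\<Sum>\<sigma> | \<sigma> permutes {1, 2, 3, 4}. of_int (sign \<sigma>) * B (\<sigma> 1) (\<sigma> 2) (\<sigma> 3) (\<sigma> 4))"
    unfolding alt_sum_def fix567[symmetric]
    by (rule sum.mono_neutral_cong_right) auto
  also have "\<dots> = ?rhs"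
  proof -
    have f1: "finite {2::7, 3, 4}" "1 \<notin> {2::7, 3, 4}" and f2: "finite {3::7, 4}" "2 \<notin> {3::7, 4}"
      and f3: "finite {4::7}" "3 \<notin> {4::7}"
      by auto
    show ?thesis
      unfolding sum_over_permutations_insert[OF f1] sum_over_permutations_insert[OF f2]
        sum_over_permutations_insert[OF f3] permutes_sing
      by (simp add: sign_swap_id permutation_swap_id sign_compose sign_id swap_id_eq permutation_compose)
  qed
  finally show ?thesis .
qed

text \<open>Left composition renames index values rather than slots. It carries the values 5, 6, 7
  to those of any monomial, at the price of a sign.\<close>

lemma alt_sum_prescribed_567:
  fixes B :: "7 \<Rightarrow> 7 \<Rightarrow> 7 \<Rightarrow> 7 \<Rightarrow> real"
  assumes \<pi>: "\<pi> permutes UNIV"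
  shows "alt_sum (\<lambda>\<sigma>. B (\<sigma> 1) (\<sigma> 2) (\<sigma> 3) (\<sigma> 4) * of_bool (\<sigma> 5 = \<pi> 5 \<and> \<sigma> 6 = \<pi> 6 \<and> \<sigma> 7 = \<pi> 7)) =
    of_int (sign \<pi>) * alt_sum (\<lambda>\<sigma>. B (\<pi> (\<sigma> 1)) (\<pi> (\<sigma> 2)) (\<pi> (\<sigma> 3)) (\<pi> (\<sigma> 4)) *
      of_bool (\<sigma> 5 = 5 \<and> \<sigma> 6 = 6 \<and> \<sigma> 7 = 7))"
proof -
  have perm: "permutation \<sigma>" if "\<sigma> permutes UNIV" for \<sigma> :: "7 \<Rightarrow> 7"
    using that finite permutation_permutes by blast
  show ?thesis
    unfolding alt_sum_def sum_distrib_left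
    by (subst setum_permutations_compose_left[OF \<pi>])
      (use perm \<pi> in \<open>auto simp: sign_compose inj_eq[OF permutes_inj[OF \<pi>]] intro!: sum.cong\<close>)
qed

section \<open>Evaluation of \<open>phi0\<close> on the standard basis\<close>

lemma axis_nth_of_bool: "axis a (1::real) $ i = of_bool (a = i)"
  by (simp add: axis_def)

lemma dx3_axis_axis:
  "dx3 i j k (axis a 1) (axis b 1) (axis c 1) =
      of_bool (a = i \<and> b = j \<and> c = k) + of_bool (b = i \<and> c = j \<and> a = k) + of_bool (c = i \<and> a = j \<and> b = k)
    - of_bool (a = i \<and> c = j \<and> b = k) - of_bool (b = i \<and> a = j \<and> c = k) - of_bool (c = i \<and> b = j \<and> a = k)"
  unfolding dx3_def det_3 vector_3 axis_nth_of_bool of_bool_conj by algebra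

text \<open>The determinant has six terms, one for each arrangement of \<open>i\<close>,
  \<open>j\<close>, \<open>k\<close> in slots 5, 6, 7. Undoing the arrangement by swapping slots, on
  which \<open>B\<close> does not depend, cancels its sign; hence the factor 3!.\<close>

lemma alt_sum_dx3:
  fixes B :: "7 \<Rightarrow> 7 \<Rightarrow> 7 \<Rightarrow> 7 \<Rightarrow> real"
  shows "alt_sum (\<lambda>\<sigma>. B (\<sigma> 1) (\<sigma> 2) (\<sigma> 3) (\<sigma> 4) * dx3 i j k (axis (\<sigma> 5) 1) (axis (\<sigma> 6) 1) (axis (\<sigma> 7) 1)) =
    6 * alt_sum (\<lambda>\<sigma>. B (\<sigma> 1) (\<sigma> 2) (\<sigma> 3) (\<sigma> 4) * of_bool (\<sigma> 5 = i \<and> \<sigma> 6 = j \<and> \<sigma> 7 = k))"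
proof -
  let ?h = "\<lambda>a b c \<sigma>. B (\<sigma> 1) (\<sigma> 2) (\<sigma> 3) (\<sigma> 4) * of_bool (\<sigma> a = i \<and> \<sigma> b = j \<and> \<sigma> c = k)"
  have 1: "alt_sum (?h 5 7 6) = - alt_sum (?h 5 6 7)"
    using alt_sum_transpose[of 6 7 "?h 5 6 7"] by (simp add: swap_id_eq)
  have 2: "alt_sum (?h 6 5 7) = - alt_sum (?h 5 6 7)"
    using alt_sum_transpose[of 5 6 "?h 5 6 7"] by (simp add: swap_id_eq)
  have 3: "alt_sum (?h 7 6 5) = - alt_sum (?h 5 6 7)"
    using alt_sum_transpose[of 5 7 "?h 5 6 7"] by (simp add: swap_id_eq)
  have 4: "alt_sum (?h 6 7 5) = - alt_sum (?h 5 7 6)"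
    using alt_sum_transpose[of 5 6 "?h 5 7 6"] by (simp add: swap_id_eq)
  have 5: "alt_sum (?h 7 5 6) = - alt_sum (?h 6 5 7)"
    using alt_sum_transpose[of 6 7 "?h 6 5 7"] by (simp add: swap_id_eq)
  show ?thesis
    unfolding dx3_axis_axis distrib_left right_diff_distrib alt_sum_add alt_sum_diff
    using 1 2 3 4 5 by simp
qed

text \<open>The components of the contraction of \<open>phi0\<close> with \<open>x\<close>, that is,
  the multiplication table of the seven-dimensional cross product paired with \<open>x\<close>. As
  rewrite rules they turn the 24-term sums into polynomials in the coordinates of
  \<open>x\<close>.\<close>

lemma phi0_axis_axis:
  shows "phi0 x (axis 1 1) (axis 1 1) = 0"
    and "phi0 x (axis 1 1) (axis 2 1) = x $ 3"
    and "phi0 x (axis 1 1) (axis 3 1) = - x $ 2"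
    and "phi0 x (axis 1 1) (axis 4 1) = x $ 5"
    and "phi0 x (axis 1 1) (axis 5 1) = - x $ 4"
    and "phi0 x (axis 1 1) (axis 6 1) = x $ 7"
    and "phi0 x (axis 1 1) (axis 7 1) = - x $ 6"
    and "phi0 x (axis 2 1) (axis 1 1) = - x $ 3"
    and "phi0 x (axis 2 1) (axis 2 1) = 0"
    and "phi0 x (axis 2 1) (axis 3 1) = x $ 1"
    and "phi0 x (axis 2 1) (axis 4 1) = x $ 6"
    and "phi0 x (axis 2 1) (axis 5 1) = - x $ 7"
    and "phi0 x (axis 2 1) (axis 6 1) = - x $ 4"
    and "phi0 x (axis 2 1) (axis 7 1) = x $ 5"
    and "phi0 x (axis 3 1) (axis 1 1) = x $ 2"
    and "phi0 x (axis 3 1) (axis 2 1) = - x $ 1"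
    and "phi0 x (axis 3 1) (axis 3 1) = 0"
    and "phi0 x (axis 3 1) (axis 4 1) = - x $ 7"
    and "phi0 x (axis 3 1) (axis 5 1) = - x $ 6"
    and "phi0 x (axis 3 1) (axis 6 1) = x $ 5"
    and "phi0 x (axis 3 1) (axis 7 1) = x $ 4"
    and "phi0 x (axis 4 1) (axis 1 1) = - x $ 5"
    and "phi0 x (axis 4 1) (axis 2 1) = - x $ 6"
    and "phi0 x (axis 4 1) (axis 3 1) = x $ 7"
    and "phi0 x (axis 4 1) (axis 4 1) = 0"
    and "phi0 x (axis 4 1) (axis 5 1) = x $ 1"
    and "phi0 x (axis 4 1) (axis 6 1) = x $ 2"
    and "phi0 x (axis 4 1) (axis 7 1) = - x $ 3"
    and "phi0 x (axis 5 1) (axis 1 1) = x $ 4"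
    and "phi0 x (axis 5 1) (axis 2 1) = x $ 7"
    and "phi0 x (axis 5 1) (axis 3 1) = x $ 6"
    and "phi0 x (axis 5 1) (axis 4 1) = - x $ 1"
    and "phi0 x (axis 5 1) (axis 5 1) = 0"
    and "phi0 x (axis 5 1) (axis 6 1) = - x $ 3"
    and "phi0 x (axis 5 1) (axis 7 1) = - x $ 2"
    and "phi0 x (axis 6 1) (axis 1 1) = - x $ 7"
    and "phi0 x (axis 6 1) (axis 2 1) = x $ 4"
    and "phi0 x (axis 6 1) (axis 3 1) = - x $ 5"
    and "phi0 x (axis 6 1) (axis 4 1) = - x $ 2"
    and "phi0 x (axis 6 1) (axis 5 1) = x $ 3"
    and "phi0 x (axis 6 1) (axis 6 1) = 0"
    and "phi0 x (axis 6 1) (axis 7 1) = x $ 1"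
    and "phi0 x (axis 7 1) (axis 1 1) = x $ 6"
    and "phi0 x (axis 7 1) (axis 2 1) = - x $ 5"
    and "phi0 x (axis 7 1) (axis 3 1) = - x $ 4"
    and "phi0 x (axis 7 1) (axis 4 1) = x $ 3"
    and "phi0 x (axis 7 1) (axis 5 1) = x $ 2"
    and "phi0 x (axis 7 1) (axis 6 1) = - x $ 1"
    and "phi0 x (axis 7 1) (axis 7 1) = 0"
  unfolding phi0_def dx3_def det_3 vector_3 axis_nth_of_bool by simp_all

text \<open>Only the components of \<beta>, the contraction of \<open>phi0\<close> with
  \<open>x\<close>, on the four indices outside the triple survive. For 123 they give 8 (\<beta>45
  \<beta>67 - \<beta>46 \<beta>57 + \<beta>47 \<beta>56) = 8 (x1^2 + x2^2 + x3^2), and the factor 6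
  of \<open>alt_sum_dx3\<close> makes 48. The other triples behave alike, each with the sign its
  monomial has in \<open>phi0\<close>. The triples are the lines of a Fano plane: every index lies
  on three of them, so the squared norm of \<open>x\<close> acquires the factor 3 * 48 =
  144.\<close>

lemma alt_sum_phi0_sq_dx3:
  fixes x :: "real ^ 7"
  defines "B \<equiv> \<lambda>a b c d. phi0 x (axis a 1) (axis b 1) * phi0 x (axis c 1) (axis d 1)"
    and "S \<equiv> \<lambda>i j k. alt_sum (\<lambda>\<sigma>. phi0 x (axis (\<sigma> 1) 1) (axis (\<sigma> 2) 1) * phi0 x (axis (\<sigma> 3) 1) (axis (\<sigma> 4) 1) *
      dx3 i j k (axis (\<sigma> 5) 1) (axis (\<sigma> 6) 1) (axis (\<sigma> 7) 1))"
  shows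
    "S 1 2 3 = 48 * ((x $ 1)\<^sup>2 + (x $ 2)\<^sup>2 + (x $ 3)\<^sup>2)"
    and "S 1 4 5 = 48 * ((x $ 1)\<^sup>2 + (x $ 4)\<^sup>2 + (x $ 5)\<^sup>2)"
    and "S 1 6 7 = 48 * ((x $ 1)\<^sup>2 + (x $ 6)\<^sup>2 + (x $ 7)\<^sup>2)"
    and "S 2 4 6 = 48 * ((x $ 2)\<^sup>2 + (x $ 4)\<^sup>2 + (x $ 6)\<^sup>2)"
    and "S 2 5 7 = - 48 * ((x $ 2)\<^sup>2 + (x $ 5)\<^sup>2 + (x $ 7)\<^sup>2)"
    and "S 3 4 7 = - 48 * ((x $ 3)\<^sup>2 + (x $ 4)\<^sup>2 + (x $ 7)\<^sup>2)"
    and "S 3 5 6 = - 48 * ((x $ 3)\<^sup>2 + (x $ 5)\<^sup>2 + (x $ 6)\<^sup>2)"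
proof -
  have S: "S (\<pi> 5) (\<pi> 6) (\<pi> 7) = 6 * (of_int (sign \<pi>) * alt_sum (\<lambda>\<sigma>. B (\<pi> (\<sigma> 1)) (\<pi> (\<sigma> 2)) (\<pi> (\<sigma> 3)) (\<pi> (\<sigma> 4)) *
      of_bool (\<sigma> 5 = 5 \<and> \<sigma> 6 = 6 \<and> \<sigma> 7 = 7)))" if "\<pi> permutes UNIV" for \<pi>
    using alt_sum_dx3[of B "\<pi> 5" "\<pi> 6" "\<pi> 7"] alt_sum_prescribed_567[OF that, of B]
    by (simp add: S_def B_def)
  note perm = sign_compose sign_swap_id permutation_swap_id permutation_compose swap_id_eq
  \<comment> \<open>Each \<open>?p\<close> is a product of transpositions sending 5, 6, 7 to the
    three indices of the monomial in question, as \<open>S\<close> requires.\<close>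
  let ?p = "swap 7 3 \<circ> swap 6 2 \<circ> swap 5 1"
  have "?p permutes UNIV" by (intro permutes_compose permutes_swap_id) auto
  from S[OF this] show "S 1 2 3 = 48 * ((x $ 1)\<^sup>2 + (x $ 2)\<^sup>2 + (x $ 3)\<^sup>2)"
    by (simp add: alt_sum_fixed_567[of "\<lambda>a b c d. B (?p a) (?p b) (?p c) (?p d)", simplified o_apply]
        perm)
      (simp add: B_def phi0_axis_axis power2_eq_square)
  let ?p = "swap 7 5 \<circ> swap 6 4 \<circ> swap 5 1"
  have "?p permutes UNIV" by (intro permutes_compose permutes_swap_id) auto
  from S[OF this] show "S 1 4 5 = 48 * ((x $ 1)\<^sup>2 + (x $ 4)\<^sup>2 + (x $ 5)\<^sup>2)"
    by (simp add: alt_sum_fixed_567[of "\<lambda>a b c d. B (?p a) (?p b) (?p c) (?p d)", simplified o_apply]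
        perm)
      (simp add: B_def phi0_axis_axis power2_eq_square)
  let ?p = "swap 5 1"
  have "?p permutes UNIV" by (intro permutes_compose permutes_swap_id) auto
  from S[OF this] show "S 1 6 7 = 48 * ((x $ 1)\<^sup>2 + (x $ 6)\<^sup>2 + (x $ 7)\<^sup>2)"
    by (simp add: alt_sum_fixed_567[of "\<lambda>a b c d. B (?p a) (?p b) (?p c) (?p d)", simplified o_apply]
        perm)
      (simp add: B_def phi0_axis_axis power2_eq_square)
  let ?p = "swap 7 6 \<circ> swap 6 4 \<circ> swap 5 2"
  have "?p permutes UNIV" by (intro permutes_compose permutes_swap_id) auto
  from S[OF this] show "S 2 4 6 = 48 * ((x $ 2)\<^sup>2 + (x $ 4)\<^sup>2 + (x $ 6)\<^sup>2)"
    by (simp add: alt_sum_fixed_567[of "\<lambda>a b c d. B (?p a) (?p b) (?p c) (?p d)", simplified o_apply]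
        perm)
      (simp add: B_def phi0_axis_axis power2_eq_square)
  let ?p = "swap 6 5 \<circ> swap 5 2"
  have "?p permutes UNIV" by (intro permutes_compose permutes_swap_id) auto
  from S[OF this] show "S 2 5 7 = - 48 * ((x $ 2)\<^sup>2 + (x $ 5)\<^sup>2 + (x $ 7)\<^sup>2)"
    by (simp add: alt_sum_fixed_567[of "\<lambda>a b c d. B (?p a) (?p b) (?p c) (?p d)", simplified o_apply]
        perm)
      (simp add: B_def phi0_axis_axis power2_eq_square)
  let ?p = "swap 6 4 \<circ> swap 5 3"
  have "?p permutes UNIV" by (intro permutes_compose permutes_swap_id) auto
  from S[OF this] show "S 3 4 7 = - 48 * ((x $ 3)\<^sup>2 + (x $ 4)\<^sup>2 + (x $ 7)\<^sup>2)"
    by (simp add: alt_sum_fixed_567[of "\<lambda>a b c d. B (?p a) (?p b) (?p c) (?p d)", simplified o_apply]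
        perm)
      (simp add: B_def phi0_axis_axis power2_eq_square)
  let ?p = "swap 7 6 \<circ> swap 6 5 \<circ> swap 5 3"
  have "?p permutes UNIV" by (intro permutes_compose permutes_swap_id) auto
  from S[OF this] show "S 3 5 6 = - 48 * ((x $ 3)\<^sup>2 + (x $ 5)\<^sup>2 + (x $ 6)\<^sup>2)"
    by (simp add: alt_sum_fixed_567[of "\<lambda>a b c d. B (?p a) (?p b) (?p c) (?p d)", simplified o_apply]
        perm)
      (simp add: B_def phi0_axis_axis power2_eq_square)
qed

text \<open>\<open>144 = 2! \<sqdot> 2! \<sqdot> 3! \<sqdot> 6\<close>: this is the identity \<open>\<beta> \<and> \<beta> \<and> \<phi> = 6 |X|\<^sup>2 vol\<close> for \<open>\<beta> = X \<lrcorner> \<phi>\<close>.\<close>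

lemma alt_sum_phi0_sq_phi0:
  "alt_sum (\<lambda>\<sigma>. phi0 x (axis (\<sigma> 1) 1) (axis (\<sigma> 2) 1) * phi0 x (axis (\<sigma> 3) 1) (axis (\<sigma> 4) 1) *
     phi0 (axis (\<sigma> 5) 1) (axis (\<sigma> 6) 1) (axis (\<sigma> 7) 1)) = 144 * (x \<bullet> x)"
proof -
  have "x \<bullet> x = (\<Sum>i\<in>{1, 2, 3, 4, 5, 6, 7}. (x $ i)\<^sup>2)"
    unfolding UNIV_7[symmetric] by (simp add: inner_vec_def power2_eq_square)
  also have "\<dots> = (x $ 1)\<^sup>2 + (x $ 2)\<^sup>2 + (x $ 3)\<^sup>2 + (x $ 4)\<^sup>2 + (x $ 5)\<^sup>2 + (x $ 6)\<^sup>2 + (x $ 7)\<^sup>2"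
    by simp
  finally show ?thesis
    unfolding phi0_def[of "axis _ _"] distrib_left right_diff_distrib alt_sum_add alt_sum_diff
      alt_sum_phi0_sq_dx3
    by simp
qed

section \<open>Functions of class C1 and integration of derivatives\<close>

abbreviation C1_on :: "('a::euclidean_space \<Rightarrow> 'b::real_normed_vector) \<Rightarrow> 'a set \<Rightarrow> bool" where
  "C1_on \<equiv> Ck_on (Suc 0)"

lemma C1_onI:
  assumes "\<And>x. x \<in> S \<Longrightarrow> (f has_derivative f' x) (at x)"
    and "\<And>v. continuous_on S (\<lambda>x. f' x v)"
  shows "C1_on f S"
proof -
  have "frechet_derivative f (at x) = f' x" if "x \<in> S" for x
    using frechet_derivative_at[OF assms(1)[OF that]] by simp
  then show ?thesis
    using assms by (auto simp: differentiable_def cong: continuous_on_cong)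
qed

lemma C1_on_has_derivative:
  "C1_on f S \<Longrightarrow> x \<in> S \<Longrightarrow> (f has_derivative frechet_derivative f (at x)) (at x)"
  by (simp add: frechet_derivative_works)

lemma C1_on_continuous_derivative:
  "C1_on f S \<Longrightarrow> continuous_on S (\<lambda>x. frechet_derivative f (at x) v)"
  by simp

lemma C1_on_imp_continuous_on: "C1_on f S \<Longrightarrow> continuous_on S f"
  by (auto intro!: differentiable_imp_continuous_on simp: differentiable_on_def differentiable_at_withinI)

lemma C1_on_cong:
  assumes "open S" "C1_on f S" "\<And>x. x \<in> S \<Longrightarrow> g x = f x"
  shows "C1_on g S"
proof (rule C1_onI)
  show "(g has_derivative frechet_derivative f (at x)) (at x)" if "x \<in> S" for x
    using has_derivative_transform_within_open[OF C1_on_has_derivative[OF assms(2) that] assms(1) that]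
      assms(3) by simp
qed (use assms in simp)

lemma C1_on_Un:
  assumes "open S" "open T" "C1_on f S" "C1_on f T"
  shows "C1_on f (S \<union> T)"
  using assms by (auto intro: continuous_on_open_Un)

lemma C1_on_const: "C1_on (\<lambda>x. c) S"
  by (rule C1_onI[where f' = "\<lambda>_ _. 0"]) auto

lemma C1_on_add:
  assumes "C1_on f S" "C1_on g S"
  shows "C1_on (\<lambda>x. f x + g x) S"
  by (rule C1_onI[where f' = "\<lambda>x v. frechet_derivative f (at x) v + frechet_derivative g (at x) v"])
    (use assms in \<open>auto intro!: has_derivative_add C1_on_has_derivative continuous_on_add simp del: Ck_on.simps
       dest: C1_on_continuous_derivative\<close>)

lemma C1_on_sum: "finite I \<Longrightarrow> (\<And>i. i \<in> I \<Longrightarrow> C1_on (f i) S) \<Longrightarrow> C1_on (\<lambda>x. \<Sum>i\<in>I. f i x) S"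
  by (induction I rule: finite_induct) (auto intro!: C1_on_const C1_on_add simp del: Ck_on.simps)

lemma C1_on_mult:
  fixes f g :: "'a::euclidean_space \<Rightarrow> real"
  assumes f: "C1_on f S" and g: "C1_on g S"
  shows "C1_on (\<lambda>x. f x * g x) S"
proof (rule C1_onI)
  show "((\<lambda>x. f x * g x) has_derivative
      (\<lambda>v. f x * frechet_derivative g (at x) v + frechet_derivative f (at x) v * g x)) (at x)"
    if "x \<in> S" for x
    using assms that by (intro has_derivative_mult C1_on_has_derivative)
  show "continuous_on S (\<lambda>x. f x * frechet_derivative g (at x) v + frechet_derivative f (at x) v * g x)" for v
    using assms by (intro continuous_intros C1_on_imp_continuous_on C1_on_continuous_derivative)
qed

lemma C1_on_inverse:
  fixes f :: "'a::euclidean_space \<Rightarrow> real"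
  assumes f: "C1_on f S" and nz: "\<And>x. x \<in> S \<Longrightarrow> f x \<noteq> 0"
  shows "C1_on (\<lambda>x. inverse (f x)) S"
proof (rule C1_onI)
  show "((\<lambda>x. inverse (f x)) has_derivative
      (\<lambda>v. - (inverse (f x) * frechet_derivative f (at x) v * inverse (f x)))) (at x)"
    if "x \<in> S" for x
    using assms that by (intro Deriv.has_derivative_inverse C1_on_has_derivative)
  show "continuous_on S (\<lambda>x. - (inverse (f x) * frechet_derivative f (at x) v * inverse (f x)))" for v
    using assms by (intro continuous_intros C1_on_imp_continuous_on C1_on_continuous_derivative) auto
qed

text \<open>\<open>Ck_on\<close> asserts continuity of the derivative only along a fixed direction,
  whereas in the chain rule the direction fed to the derivative of \<open>g\<close> moves with
  \<open>x\<close>. Expanding it in the basis leaves fixed directions with continuous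
  coefficients.\<close>

lemma C1_on_compose:
  fixes g :: "real ^ 'n::finite \<Rightarrow> 'b::real_normed_vector"
  assumes f: "C1_on f S" and g: "C1_on g T" and "f ` S \<subseteq> T"
  shows "C1_on (\<lambda>x. g (f x)) S"
proof (rule C1_onI)
  fix x assume "x \<in> S"
  then have f': "(f has_derivative frechet_derivative f (at x)) (at x)"
    and g': "(g has_derivative frechet_derivative g (at (f x))) (at (f x))"
    using assms by (auto intro!: C1_on_has_derivative simp del: Ck_on.simps)
  have "frechet_derivative g (at (f x)) (frechet_derivative f (at x) v) =
     (\<Sum>i\<in>UNIV. frechet_derivative f (at x) v $ i *\<^sub>R frechet_derivative g (at (f x)) (axis i 1))" for v
    using linear_sum[OF has_derivative_linear[OF g'], of "\<lambda>i. frechet_derivative f (at x) v $ i *\<^sub>R axis i 1" UNIV]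
    by (simp add: linear_scale[OF has_derivative_linear[OF g']] basis_expansion[where 'a = real, unfolded scalar_mult_eq_scaleR])
  then show "((\<lambda>x. g (f x)) has_derivative
    (\<lambda>v. \<Sum>i\<in>UNIV. frechet_derivative f (at x) v $ i *\<^sub>R frechet_derivative g (at (f x)) (axis i 1))) (at x)"
    using has_derivative_compose[OF f' g'] by simp
next
  show "continuous_on S
    (\<lambda>x. \<Sum>i\<in>UNIV. frechet_derivative f (at x) v $ i *\<^sub>R frechet_derivative g (at (f x)) (axis i 1))" for v
    using assms
    by (intro continuous_intros C1_on_continuous_derivative C1_on_imp_continuous_on
        continuous_on_compose2[OF C1_on_continuous_derivative[OF g]])
qed

section \<open>Bump functions of class C1\<close>

lemma has_real_derivative_max_0_square:
  "((\<lambda>t. (max 0 t)\<^sup>2) has_real_derivative 2 * max 0 t) (at t)"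
proof -
  consider "t < 0" | "t > 0" | "t = 0" by linarith
  then show ?thesis
  proof cases
    case 1
    show ?thesis
      by (rule has_field_derivative_transform_within_open[where f = "\<lambda>_. 0" and S = "{..<0}"]) (use 1 in auto)
  next
    case 2
    show ?thesis
      by (rule has_field_derivative_transform_within_open[where f = "\<lambda>t. t\<^sup>2" and S = "{0<..}"])
        (use 2 in \<open>auto intro!: derivative_eq_intros\<close>)
  next
    case 3
    \<comment> \<open>At 0 the difference quotient of the squared positive part is \<open>h\<close>
      for positive \<open>h\<close> and 0 for negative \<open>h\<close>.\<close>
    have "((\<lambda>h::real. max 0 h * of_bool (h > 0)) \<longlongrightarrow> 0) (at 0)"
      by (rule tendsto_sandwich[where f = "\<lambda>_. 0" and h = "\<lambda>h. \<bar>h\<bar>"]) (auto intro!: tendsto_eq_intros always_eventually)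
    moreover have "\<forall>\<^sub>F h in at 0. max 0 h * of_bool (h > 0) = ((max 0 (0 + h))\<^sup>2 - (max 0 0)\<^sup>2) / (h::real)"
      by (auto simp: eventually_at_filter max_def power2_eq_square)
    ultimately show ?thesis
      using 3 by (simp add: DERIV_def Lim_transform_eventually)
  qed
qed

definition bump :: "'a::euclidean_space \<Rightarrow> real \<Rightarrow> 'a \<Rightarrow> real" where
  "bump z r y = (max 0 (r\<^sup>2 - (y - z) \<bullet> (y - z)))\<^sup>2"

lemma C1_on_bump: "C1_on (bump z r) S"
proof (rule C1_onI)
  fix x :: 'a
  let ?q = "\<lambda>y. r\<^sup>2 - (y - z) \<bullet> (y - z)"
  have 1: "(?q has_derivative (\<lambda>v. - 2 * ((x - z) \<bullet> v))) (at x)"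
    by (auto intro!: derivative_eq_intros simp: inner_commute)
  from has_derivative_compose[OF this
      has_real_derivative_max_0_square[THEN has_field_derivative_imp_has_derivative]]
  show "(bump z r has_derivative (\<lambda>v. 2 * max 0 (?q x) * (- 2 * ((x - z) \<bullet> v)))) (at x)"
    unfolding bump_def by simp
qed (intro continuous_intros)

lemma bump_nonneg: "0 \<le> bump z r y"
  by (simp add: bump_def)

lemma bump_pos_iff: "0 < r \<Longrightarrow> 0 < bump z r y \<longleftrightarrow> dist y z < r"
  by (auto simp: bump_def dist_norm power2_norm_eq_inner[symmetric] abs_square_less_1 max_def
      intro: power_strict_mono dest: power2_less_imp_less)

lemma bump_eq_0_iff: "0 < r \<Longrightarrow> bump z r y = 0 \<longleftrightarrow> r \<le> dist y z"
  using bump_pos_iff[of r z y] bump_nonneg[of z r y] by linarith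

section \<open>Integrals of derivatives of compactly supported functions\<close>

lemma integral_lborel_translation:
  fixes f :: "'a::euclidean_space \<Rightarrow> real"
  assumes "f \<in> borel_measurable borel"
  shows "(\<integral>x. f (c + x) \<partial>lborel) = (\<integral>x. f x \<partial>lborel)"
proof -
  have "(\<integral>x. f x \<partial>lborel) = (\<integral>x. f x \<partial>distr lborel borel ((+) c))"
    by (simp add: lborel_distr_plus)
  also have "\<dots> = (\<integral>x. f (c + x) \<partial>lborel)"
    using assms by (intro integral_distr) auto
  finally show ?thesis ..
qed

lemma absolutely_integrable_compact_support:
  fixes f :: "'a::euclidean_space \<Rightarrow> real"
  assumes "compact K" "K \<subseteq> U" "continuous_on K f" "\<And>x. x \<in> U - K \<Longrightarrow> f x = 0"
  shows "f absolutely_integrable_on U"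
proof -
  have "f absolutely_integrable_on K"
    using borel_integrable_compact[OF assms(1,3)]
    by (simp add: set_integrable_def integrable_completion borel_measurable_integrable)
  then show ?thesis
    by (rule absolutely_integrable_spike_set)
      (use assms in \<open>auto intro!: negligible_subset[OF negligible_empty]\<close>)
qed

lemma has_vector_derivative_along_line:
  assumes "(g has_derivative g') (at (x + t *\<^sub>R v))"
  shows "((\<lambda>s. g (x + s *\<^sub>R v)) has_vector_derivative g' v) (at t)"
proof -
  have "((\<lambda>s. x + s *\<^sub>R v) has_derivative (\<lambda>s. s *\<^sub>R v)) (at t)"
    by (auto intro!: derivative_eq_intros)
  from has_derivative_compose[OF this assms] show ?thesis
    by (simp add: has_vector_derivative_def linear_scale[OF has_derivative_linear[OF assms]])
qed

lemma mvt_along_line: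
  fixes g :: "'a::euclidean_space \<Rightarrow> real"
  assumes "0 < t" and "\<And>s. 0 \<le> s \<Longrightarrow> s \<le> t \<Longrightarrow> (g has_derivative g' (x + s *\<^sub>R v)) (at (x + s *\<^sub>R v))"
  shows "\<exists>s. 0 < s \<and> s < t \<and> g (x + t *\<^sub>R v) - g x = t * g' (x + s *\<^sub>R v) v"
  using MVT2[of 0 t "\<lambda>s. g (x + s *\<^sub>R v)" "\<lambda>s. g' (x + s *\<^sub>R v) v"] assms
  by (auto simp: has_real_derivative_iff_has_vector_derivative intro!: has_vector_derivative_along_line)

text \<open>Differentiating the translation-invariant integral \<open>\<integral> g (x + t v) dx\<close> at \<open>t = 0\<close>
  replaces an appeal to Fubini.\<close>

lemma integral_directional_derivative_UNIV:
  fixes g :: "'a::euclidean_space \<Rightarrow> real"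
  assumes g: "C1_on g UNIV" and K: "compact K" and supp: "\<And>x. x \<notin> K \<Longrightarrow> g x = 0"
  shows "(\<integral>x. frechet_derivative g (at x) v \<partial>lborel) = 0"
proof -
  let ?d = "\<lambda>x. frechet_derivative g (at x) v"
  have cg: "continuous_on UNIV g" and cd: "continuous_on UNIV ?d"
    using g by (auto intro: C1_on_imp_continuous_on C1_on_continuous_derivative simp del: Ck_on.simps)
  then have [measurable]: "g \<in> borel_measurable borel" "?d \<in> borel_measurable borel"
    by (auto intro: borel_measurable_continuous_onI)
  have d0: "?d x = 0" if "x \<notin> K" for x
  proof -
    have "(g has_derivative (\<lambda>_. 0)) (at x)"
      by (rule has_derivative_transform_within_open[where f = "\<lambda>_. 0" and s = "- K"])
        (use that supp K in \<open>auto intro: open_Compl compact_imp_closed\<close>)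
    then show ?thesis
      using frechet_derivative_at by (metis (mono_tags))
  qed
  obtain B where B: "\<bar>?d x\<bar> \<le> B" "0 \<le> B" for x
  proof -
    have "bounded (?d ` K)"
      using K cd continuous_on_subset by (blast intro: compact_imp_bounded compact_continuous_image)
    then obtain B where "\<forall>x\<in>K. \<bar>?d x\<bar> \<le> B" "0 < B"
      by (auto simp: bounded_pos)
    then have "\<bar>?d x\<bar> \<le> B" for x
      using d0[of x] by (cases "x \<in> K") auto
    with \<open>0 < B\<close> show ?thesis using that by force
  qed
  define t :: "nat \<Rightarrow> real" where "t n = 1 / (n + 1)" for n
  have t: "0 < t n" "t n \<le> 1" for n
    by (auto simp: t_def)
  have t0: "t \<longlonglongrightarrow> 0"
    unfolding t_def using LIMSEQ_inverse_real_of_nat by (simp add: inverse_eq_divide add.commute)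
  define q where "q n x = (g (t n *\<^sub>R v + x) - g x) / t n" for n x
  \<comment> \<open>By the mean value theorem \<open>q n x\<close> is a value of the derivative at a
    point within distance \<open>norm v\<close> of \<open>x\<close>, since \<open>t n\<close> is at
    most 1. All quotients therefore vanish off one compact set, which yields the dominating
    function.\<close>
  define K' where "K' = {x + y |x y. x \<in> K \<and> y \<in> cball 0 (norm v)}"
  have K': "compact K'"
    unfolding K'_def using K by (intro compact_sums) auto
  have mvt: "\<exists>s. 0 < s \<and> s < t n \<and> q n x = ?d (x + s *\<^sub>R v)" for n x
    using mvt_along_line[of "t n" g "\<lambda>y. frechet_derivative g (at y)" x v] t[of n] C1_on_has_derivative[OF g]
    by (auto simp: q_def add.commute field_simps simp del: Ck_on.simps)
  have bound: "\<bar>q n x\<bar> \<le> B * indicator K' x" for n x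
  proof (cases "x \<in> K'")
    case True
    then show ?thesis using mvt[of n x] B by (metis indicator_simps(1) mult.right_neutral)
  next
    case False
    obtain s where s: "0 < s" "s < t n" "q n x = ?d (x + s *\<^sub>R v)"
      using mvt by blast
    have "x + s *\<^sub>R v \<notin> K"
    proof
      assume "x + s *\<^sub>R v \<in> K"
      moreover have "norm (- s *\<^sub>R v) \<le> norm v"
        using s t[of n] by (simp add: mult_left_le_one_le)
      ultimately have "x + s *\<^sub>R v + (- s *\<^sub>R v) \<in> K'"
        unfolding K'_def by (metis (mono_tags, lifting) CollectI mem_cball_0)
      then show False using False by simp
    qed
    then show ?thesis using d0 s False by simp
  qed
  have "(\<lambda>x. indicator K x *\<^sub>R g x) = g"
    using supp by (auto simp: fun_eq_iff indicator_def of_bool_def)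
  then have intg: "integrable lborel g"
    using borel_integrable_compact[OF K continuous_on_subset[OF cg subset_UNIV]] by simp
  have "(\<lambda>n. \<integral>x. q n x \<partial>lborel) \<longlonglongrightarrow> (\<integral>x. ?d x \<partial>lborel)"
  proof (rule integral_dominated_convergence[where w = "\<lambda>x. B * indicator K' x"])
    show "integrable lborel (\<lambda>x. B * indicator K' x)"
      using K' by (intro integrable_mult_right integrable_real_indicator emeasure_bounded_finite)
        (auto intro: compact_imp_bounded borel_compact)
    show "AE x in lborel. (\<lambda>n. q n x) \<longlonglongrightarrow> ?d x"
    proof (rule AE_I2)
      fix x
      have "((\<lambda>s. g (x + s *\<^sub>R v)) has_real_derivative ?d x) (at 0)"
        using has_vector_derivative_along_line[of g "frechet_derivative g (at x)" x 0 v]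
          C1_on_has_derivative[OF g] by (simp add: has_real_derivative_iff_has_vector_derivative del: Ck_on.simps)
      then have "((\<lambda>h. (g (x + h *\<^sub>R v) - g x) / h) \<longlongrightarrow> ?d x) (at 0)"
        by (simp add: DERIV_def)
      moreover have "filterlim t (at 0) sequentially"
        using t0 t by (auto simp: filterlim_at intro!: always_eventually less_imp_neq[symmetric])
      ultimately show "(\<lambda>n. q n x) \<longlonglongrightarrow> ?d x"
        unfolding q_def by (subst add.commute) (rule filterlim_compose)
    qed
    show "AE x in lborel. norm (q n x) \<le> B * indicator K' x" for n
      using bound by simp
  qed (simp_all add: q_def)
  moreover have "(\<integral>x. q n x \<partial>lborel) = 0" for n
  proof -
    have "integrable lborel (\<lambda>x. g (t n *\<^sub>R v + x))"
      using intg integrable_distr_eq[of "(+) (t n *\<^sub>R v)" lborel borel g] by (simp add: lborel_distr_plus)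
    then show ?thesis
      unfolding q_def using intg by (simp add: integral_lborel_translation)
  qed
  ultimately show ?thesis
    by (simp add: LIMSEQ_const_iff)
qed

text \<open>Extension by zero reduces this to the whole space. The extension is C1 on
  \<open>U\<close> and, being zero, on the complement of \<open>K\<close>; these two open sets cover
  the space.\<close>

lemma integral_directional_derivative:
  fixes g :: "'a::euclidean_space \<Rightarrow> real"
  assumes U: "open U" and g: "C1_on g U" and K: "compact K" "K \<subseteq> U" and supp: "\<And>x. x \<in> U - K \<Longrightarrow> g x = 0"
  shows "((\<lambda>x. frechet_derivative g (at x) v) absolutely_integrable_on U)"
    and "integral U (\<lambda>x. frechet_derivative g (at x) v) = 0"
proof -
  define G where "G x = (if x \<in> U then g x else 0)" for x
  have "C1_on G (U \<union> - K)"
  proof (rule C1_on_Un)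
    show "C1_on G U" by (rule C1_on_cong[OF U g]) (simp add: G_def)
    show "C1_on G (- K)"
      by (rule C1_on_cong[OF _ C1_on_const[of 0]]) (use K supp in \<open>auto simp: G_def compact_imp_closed\<close>)
  qed (use U K in \<open>auto simp: compact_imp_closed\<close>)
  moreover have "U \<union> - K = UNIV" using K by auto
  ultimately have G: "C1_on G UNIV" by simp
  have eq: "frechet_derivative g (at x) = frechet_derivative G (at x)" if "x \<in> U" for x
    by (rule frechet_derivative_at[OF has_derivative_transform_within_open[OF C1_on_has_derivative[OF g that] U that]])
      (simp add: G_def)
  have G0: "frechet_derivative G (at x) v = 0" if "x \<notin> K" for x
  proof -
    have "(G has_derivative (\<lambda>_. 0)) (at x)"
      by (rule has_derivative_transform_within_open[where f = "\<lambda>_. 0" and s = "- K"])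
        (use that supp K in \<open>auto simp: G_def compact_imp_closed\<close>)
    then show ?thesis
      using frechet_derivative_at by (metis (mono_tags))
  qed
  have ai: "(\<lambda>x. frechet_derivative G (at x) v) absolutely_integrable_on V" if "K \<subseteq> V" for V
    by (rule absolutely_integrable_compact_support[OF K(1) that])
      (use G0 C1_on_continuous_derivative[OF G] in \<open>auto intro: continuous_on_subset\<close>)
  show "(\<lambda>x. frechet_derivative g (at x) v) absolutely_integrable_on U"
    using ai[OF K(2)] by (rule absolutely_integrable_spike[where S = "{}"]) (simp_all add: eq)
  have "integral U (\<lambda>x. frechet_derivative g (at x) v) = integral U (\<lambda>x. frechet_derivative G (at x) v)"
    by (rule integral_cong) (simp add: eq)
  also have "\<dots> = integral UNIV (\<lambda>x. frechet_derivative G (at x) v)"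
    by (rule integral_spike_set) (use G0 K in \<open>auto intro!: negligible_subset[OF negligible_empty]\<close>)
  also have "\<dots> = (\<integral>x. frechet_derivative G (at x) v \<partial>lborel)"
  proof -
    have "integrable lebesgue (\<lambda>x. frechet_derivative G (at x) v)"
      using ai[of UNIV] by (simp add: set_integrable_def)
    moreover have "(\<lambda>x. frechet_derivative G (at x) v) \<in> borel_measurable borel"
      using C1_on_continuous_derivative[OF G] by (rule borel_measurable_continuous_onI)
    ultimately show ?thesis
      by (simp add: integral_lborel integrable_completion)
  qed
  also have "\<dots> = 0"
    by (rule integral_directional_derivative_UNIV[OF G K(1)]) (use supp in \<open>auto simp: G_def\<close>)
  finally show "integral U (\<lambda>x. frechet_derivative g (at x) v) = 0" .
qed

section \<open>Symmetry of second derivatives\<close>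

lemma mvt_second_difference:
  fixes f :: "'a::euclidean_space \<Rightarrow> real"
  assumes f: "Ck_on 2 f S" and t: "0 < t"
    and S: "\<And>a b. 0 \<le> a \<Longrightarrow> a \<le> t \<Longrightarrow> 0 \<le> b \<Longrightarrow> b \<le> t \<Longrightarrow> x + a *\<^sub>R v + b *\<^sub>R w \<in> S"
  shows "\<exists>a b. 0 < a \<and> a < t \<and> 0 < b \<and> b < t \<and>
    f (x + t *\<^sub>R v + t *\<^sub>R w) - f (x + t *\<^sub>R v) - f (x + t *\<^sub>R w) + f x =
    t * t * frechet_derivative (\<lambda>y. frechet_derivative f (at y) v) (at (x + a *\<^sub>R v + b *\<^sub>R w)) w"
proof -
  have f1: "(f has_derivative frechet_derivative f (at y)) (at y)" if "y \<in> S" for y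
    using f that by (simp add: numeral_2_eq_2 frechet_derivative_works)
  have f2: "C1_on (\<lambda>y. frechet_derivative f (at y) v) S"
    using f by (simp add: numeral_2_eq_2)
  have diff: "((\<lambda>y. f (y + t *\<^sub>R w) - f y) has_derivative
      (\<lambda>u. frechet_derivative f (at (x + a *\<^sub>R v + t *\<^sub>R w)) u - frechet_derivative f (at (x + a *\<^sub>R v)) u))
      (at (x + a *\<^sub>R v))" if "0 \<le> a" "a \<le> t" for a
  proof (rule has_derivative_diff)
    have "((\<lambda>y. y + t *\<^sub>R w) has_derivative (\<lambda>u. u)) (at (x + a *\<^sub>R v))"
      by (auto intro!: derivative_eq_intros)
    from has_derivative_compose[OF this f1] show "((\<lambda>y. f (y + t *\<^sub>R w)) has_derivative
        frechet_derivative f (at (x + a *\<^sub>R v + t *\<^sub>R w))) (at (x + a *\<^sub>R v))"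
      using S[of a t] that t by simp
    show "(f has_derivative frechet_derivative f (at (x + a *\<^sub>R v))) (at (x + a *\<^sub>R v))"
      using S[of a 0] that t by (intro f1) simp
  qed
  \<comment> \<open>The mean value theorem is used twice: along \<open>v\<close> for the first
    difference in direction \<open>w\<close>, then along \<open>w\<close> for the derivative in
    direction \<open>v\<close>.\<close>
  obtain a where a: "0 < a" "a < t"
    "f (x + t *\<^sub>R v + t *\<^sub>R w) - f (x + t *\<^sub>R v) - (f (x + t *\<^sub>R w) - f x) =
      t * (frechet_derivative f (at (x + a *\<^sub>R v + t *\<^sub>R w)) v - frechet_derivative f (at (x + a *\<^sub>R v)) v)"
    using mvt_along_line[OF t, of "\<lambda>y. f (y + t *\<^sub>R w) - f y"
        "\<lambda>y u. frechet_derivative f (at (y + t *\<^sub>R w)) u - frechet_derivative f (at y) u" x v, OF diff]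
    by blast
  have "\<exists>b. 0 < b \<and> b < t \<and>
      frechet_derivative f (at (x + a *\<^sub>R v + t *\<^sub>R w)) v - frechet_derivative f (at (x + a *\<^sub>R v)) v =
      t * frechet_derivative (\<lambda>y. frechet_derivative f (at y) v) (at (x + a *\<^sub>R v + b *\<^sub>R w)) w"
    by (rule mvt_along_line[OF t, of "\<lambda>y. frechet_derivative f (at y) v"
          "\<lambda>y. frechet_derivative (\<lambda>y. frechet_derivative f (at y) v) (at y)"])
      (rule C1_on_has_derivative[OF f2 S], use a in auto)
  then obtain b where b: "0 < b" "b < t"
      "frechet_derivative f (at (x + a *\<^sub>R v + t *\<^sub>R w)) v - frechet_derivative f (at (x + a *\<^sub>R v)) v =
      t * frechet_derivative (\<lambda>y. frechet_derivative f (at y) v) (at (x + a *\<^sub>R v + b *\<^sub>R w)) w"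
    by blast
  have "f (x + t *\<^sub>R v + t *\<^sub>R w) - f (x + t *\<^sub>R v) - f (x + t *\<^sub>R w) + f x =
    t * t * frechet_derivative (\<lambda>y. frechet_derivative f (at y) v) (at (x + a *\<^sub>R v + b *\<^sub>R w)) w"
    using a(3) b(3) by simp
  with a b show ?thesis by blast
qed

text \<open>The second difference quotient \<open>D\<close> is symmetric in \<open>v\<close> and
  \<open>w\<close>. Each order of applying the mean value theorem exhibits it as a value of one
  mixed derivative near \<open>x\<close>, so by continuity it converges to both.\<close>

lemma frechet_derivative_commute:
  fixes f :: "'a::euclidean_space \<Rightarrow> real"
  assumes S: "open S" and f: "Ck_on 2 f S" and x: "x \<in> S"
  shows "frechet_derivative (\<lambda>y. frechet_derivative f (at y) v) (at x) w =
         frechet_derivative (\<lambda>y. frechet_derivative f (at y) w) (at x) v"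
proof -
  let ?F = "\<lambda>v w y. frechet_derivative (\<lambda>y. frechet_derivative f (at y) v) (at y) w"
  obtain e where e: "e > 0" "ball x e \<subseteq> S"
    using S x open_contains_ball by blast
  \<comment> \<open>Keeps the parallelogram spanned by \<open>t n *\<^sub>R v\<close> and
    \<open>t n *\<^sub>R w\<close> inside the ball; the summand 1 makes the denominator positive
    even if both vectors are 0.\<close>
  define c where "c = e / (norm v + norm w + 1)"
  have N: "0 < norm v + norm w + 1" by (simp add: add_nonneg_pos)
  then have c: "0 < c" using e by (simp add: c_def)
  define t where "t n = c * inverse (real (Suc (Suc n)))" for n
  have t: "0 < t n" "t n < c" for n
  proof -
    have "inverse (real (Suc (Suc n))) < 1" by (simp add: inverse_eq_divide)
    then show "t n < c" unfolding t_def using c mult_strict_left_mono by fastforce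
  qed (use c in \<open>simp add: t_def\<close>)
  have t0: "t \<longlonglongrightarrow> 0"
    unfolding t_def by (intro tendsto_mult_right_zero LIMSEQ_Suc[OF LIMSEQ_inverse_real_of_nat])
  have near: "norm (a *\<^sub>R v + b *\<^sub>R w) \<le> t n * (norm v + norm w)" "norm (a *\<^sub>R v + b *\<^sub>R w) < e"
    if "0 \<le> a" "a \<le> t n" "0 \<le> b" "b \<le> t n" for a b n
  proof -
    have "norm (a *\<^sub>R v + b *\<^sub>R w) \<le> a * norm v + b * norm w"
      using norm_triangle_ineq[of "a *\<^sub>R v" "b *\<^sub>R w"] that by simp
    also have "\<dots> \<le> t n * norm v + t n * norm w"
      using that by (intro add_mono mult_right_mono) auto
    finally show 1: "norm (a *\<^sub>R v + b *\<^sub>R w) \<le> t n * (norm v + norm w)"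
      by (simp add: algebra_simps)
    also have "\<dots> \<le> t n * (norm v + norm w + 1)"
      using t[of n] by (intro mult_left_mono) auto
    also have "\<dots> < c * (norm v + norm w + 1)"
      using t[of n] N by (intro mult_strict_right_mono) auto
    also have "\<dots> = e"
      using N by (simp add: c_def)
    finally show "norm (a *\<^sub>R v + b *\<^sub>R w) < e" .
  qed
  define D where "D n = (f (x + t n *\<^sub>R v + t n *\<^sub>R w) - f (x + t n *\<^sub>R v) - f (x + t n *\<^sub>R w) + f x) / (t n * t n)" for n
  \<comment> \<open>The bound variables \<open>v\<close> and \<open>w\<close> shadow the fixed ones:
    the claim is applied once as it stands and once with the two directions exchanged.\<close>
  have lim: "D \<longlonglongrightarrow> ?F v w x"
    if near: "\<And>a b n. 0 \<le> a \<Longrightarrow> a \<le> t n \<Longrightarrow> 0 \<le> b \<Longrightarrow> b \<le> t n \<Longrightarrow>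
        norm (a *\<^sub>R v + b *\<^sub>R w) \<le> t n * (norm v + norm w) \<and> norm (a *\<^sub>R v + b *\<^sub>R w) < e"
      and D: "\<And>n. D n = (f (x + t n *\<^sub>R v + t n *\<^sub>R w) - f (x + t n *\<^sub>R v) - f (x + t n *\<^sub>R w) + f x) / (t n * t n)"
    for v w
  proof -
    have inS: "x + a *\<^sub>R v + b *\<^sub>R w \<in> S" if "0 \<le> a" "a \<le> t n" "0 \<le> b" "b \<le> t n" for a b n
    proof -
      have "x + a *\<^sub>R v + b *\<^sub>R w \<in> ball x e"
        using near[OF that] norm_minus_cancel[of "a *\<^sub>R v + b *\<^sub>R w"] by (simp add: dist_norm add.assoc)
      then show ?thesis using e by auto
    qed
    have "\<exists>a b. 0 < a \<and> a < t n \<and> 0 < b \<and> b < t n \<and> D n = ?F v w (x + a *\<^sub>R v + b *\<^sub>R w)" for n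
    proof -
      have "\<exists>a b. 0 < a \<and> a < t n \<and> 0 < b \<and> b < t n \<and>
          f (x + t n *\<^sub>R v + t n *\<^sub>R w) - f (x + t n *\<^sub>R v) - f (x + t n *\<^sub>R w) + f x =
          t n * t n * ?F v w (x + a *\<^sub>R v + b *\<^sub>R w)"
        by (rule mvt_second_difference[OF f t(1)]) (rule inS)
      then obtain a b where ab: "0 < a" "a < t n" "0 < b" "b < t n"
        and eq: "f (x + t n *\<^sub>R v + t n *\<^sub>R w) - f (x + t n *\<^sub>R v) - f (x + t n *\<^sub>R w) + f x =
          t n * t n * ?F v w (x + a *\<^sub>R v + b *\<^sub>R w)"
        by blast
      have "D n = ?F v w (x + a *\<^sub>R v + b *\<^sub>R w)"
        unfolding D eq using t(1)[of n] by simp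
      with ab show ?thesis by blast
    qed
    then obtain a b where ab: "\<And>n. 0 < a n \<and> a n < t n \<and> 0 < b n \<and> b n < t n \<and>
        D n = ?F v w (x + a n *\<^sub>R v + b n *\<^sub>R w)"
      by metis
    have "(\<lambda>n. x + a n *\<^sub>R v + b n *\<^sub>R w) \<longlonglongrightarrow> x + 0 *\<^sub>R v + 0 *\<^sub>R w"
    proof (intro tendsto_intros)
      show "a \<longlonglongrightarrow> 0"
        by (rule tendsto_sandwich[OF _ _ tendsto_const t0]) (use ab in \<open>auto intro!: always_eventually less_imp_le\<close>)
      show "b \<longlonglongrightarrow> 0"
        by (rule tendsto_sandwich[OF _ _ tendsto_const t0]) (use ab in \<open>auto intro!: always_eventually less_imp_le\<close>)
    qed
    moreover have "continuous_on S (?F v w)"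
      using f by (simp add: numeral_2_eq_2)
    then have "isCont (?F v w) x"
      using S x by (simp add: continuous_on_eq_continuous_at)
    ultimately have "(\<lambda>n. ?F v w (x + a n *\<^sub>R v + b n *\<^sub>R w)) \<longlonglongrightarrow> ?F v w x"
      using isCont_tendsto_compose by fastforce
    moreover have "D = (\<lambda>n. ?F v w (x + a n *\<^sub>R v + b n *\<^sub>R w))"
      using ab by (intro ext) blast
    ultimately show ?thesis by (simp only:)
  qed
  have "D \<longlonglongrightarrow> ?F v w x"
    using near by (intro lim D_def) blast
  moreover have "D \<longlonglongrightarrow> ?F w v x"
  proof (rule lim)
    show "norm (a *\<^sub>R w + b *\<^sub>R v) \<le> t n * (norm w + norm v) \<and> norm (a *\<^sub>R w + b *\<^sub>R v) < e"
      if "0 \<le> a" "a \<le> t n" "0 \<le> b" "b \<le> t n" for a b n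
      using near[OF that(3,4,1,2)] by (simp add: add.commute)
  qed (simp add: D_def algebra_simps)
  ultimately show ?thesis
    by (rule LIMSEQ_unique)
qed

section \<open>Charts of a smooth manifold\<close>

abbreviation chart_image :: "('a, 'n::finite) chart \<Rightarrow> (real ^ 'n) set" where
  "chart_image c \<equiv> snd c ` fst c"

abbreviation overlap :: "('a, 'n::finite) chart \<Rightarrow> ('a, 'n) chart \<Rightarrow> (real ^ 'n) set" where
  "overlap c d \<equiv> snd c ` (fst c \<inter> fst d)"

abbreviation jacobian :: "('a, 'n::finite) chart \<Rightarrow> ('a, 'n) chart \<Rightarrow> real ^ 'n \<Rightarrow> real ^ 'n \<Rightarrow> real ^ 'n" where
  "jacobian c d x \<equiv> frechet_derivative (transition c d) (at x)"

locale smooth_mfd =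
  fixes M :: "('a, 'n::finite) manifold"
  assumes smooth: "smooth_manifold M"
begin

lemma chart_open: "c \<in> Atlas M \<Longrightarrow> openin (Top M) (fst c)"
  and chart_image_open: "c \<in> Atlas M \<Longrightarrow> open (chart_image c)"
  and chart_homeo: "c \<in> Atlas M \<Longrightarrow>
    homeomorphic_map (subtopology (Top M) (fst c)) (top_of_set (chart_image c)) (snd c)"
  using smooth by (auto simp: smooth_manifold_def is_chart_def)

lemma charts_at_iff: "c \<in> charts_at M p \<longleftrightarrow> c \<in> Atlas M \<and> p \<in> fst c"
  by (auto simp: charts_at_def)

lemma chart_subset_points: "c \<in> Atlas M \<Longrightarrow> fst c \<subseteq> points M"
  using chart_open openin_subset by blast

lemma chart_cover: "p \<in> points M \<Longrightarrow> \<exists>c\<in>Atlas M. p \<in> fst c"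
  using smooth by (auto simp: smooth_manifold_def)

lemma topspace_chart: "c \<in> Atlas M \<Longrightarrow> topspace (subtopology (Top M) (fst c)) = fst c"
  by (simp add: Int_absorb1 chart_subset_points)

lemma chart_inj: "c \<in> Atlas M \<Longrightarrow> inj_on (snd c) (fst c)"
  using homeomorphic_imp_injective_map[OF chart_homeo] topspace_chart by simp

lemma chart_inv_chart [simp]: "c \<in> Atlas M \<Longrightarrow> p \<in> fst c \<Longrightarrow> chart_inv c (snd c p) = p"
  by (simp add: chart_inv_def chart_inj)

lemma chart_inv_in: "x \<in> chart_image c \<Longrightarrow> chart_inv c x \<in> fst c"
  and chart_chart_inv [simp]: "x \<in> chart_image c \<Longrightarrow> snd c (chart_inv c x) = x"
  unfolding chart_inv_def by (rule inv_into_into) (auto intro: f_inv_into_f)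

lemma open_chart_image_of:
  assumes "c \<in> Atlas M" "openin (Top M) V" "V \<subseteq> fst c"
  shows "open (snd c ` V)"
proof -
  have "openin (subtopology (Top M) (fst c)) V"
    using assms chart_open openin_open_subtopology by blast
  then have "openin (top_of_set (chart_image c)) (snd c ` V)"
    using homeomorphic_map_openness_eq[OF chart_homeo[OF assms(1)]] by blast
  then show ?thesis
    using chart_image_open[OF assms(1)] openin_open_eq by blast
qed

lemma transition_smooth: "c \<in> Atlas M \<Longrightarrow> d \<in> Atlas M \<Longrightarrow> smooth_on (transition c d) (overlap c d)"
  using smooth by (auto simp: smooth_manifold_def)

lemma overlap_open: "c \<in> Atlas M \<Longrightarrow> d \<in> Atlas M \<Longrightarrow> open (overlap c d)"
  using transition_smooth by (auto simp: smooth_on_def)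

lemma transition_Ck: "c \<in> Atlas M \<Longrightarrow> d \<in> Atlas M \<Longrightarrow> Ck_on k (transition c d) (overlap c d)"
  using transition_smooth by (auto simp: smooth_on_def)

lemma transition_chart: "c \<in> Atlas M \<Longrightarrow> p \<in> fst c \<Longrightarrow> transition c d (snd c p) = snd d p"
  by (simp add: transition_def)

lemma has_derivative_transition:
  "c \<in> Atlas M \<Longrightarrow> d \<in> Atlas M \<Longrightarrow> p \<in> fst c \<Longrightarrow> p \<in> fst d \<Longrightarrow>
    (transition c d has_derivative jacobian c d (snd c p)) (at (snd c p))"
  by (rule C1_on_has_derivative[OF transition_Ck]) auto

lemma linear_jacobian:
  "c \<in> Atlas M \<Longrightarrow> d \<in> Atlas M \<Longrightarrow> p \<in> fst c \<Longrightarrow> p \<in> fst d \<Longrightarrow> linear (jacobian c d (snd c p))"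
  using has_derivative_transition has_derivative_linear by blast

text \<open>The cocycle rule. The composed transition agrees with the direct one on the image of the
  triple overlap, an open neighbourhood of the point, which is enough to compare derivatives
  there.\<close>

lemma jacobian_trans:
  assumes "c \<in> Atlas M" "d \<in> Atlas M" "e \<in> Atlas M" "p \<in> fst c" "p \<in> fst d" "p \<in> fst e"
  shows "jacobian d e (snd d p) (jacobian c d (snd c p) w) = jacobian c e (snd c p) w"
proof -
  let ?V = "fst c \<inter> fst d \<inter> fst e"
  have "open (snd c ` ?V)"
    by (intro open_chart_image_of openin_Int chart_open assms) auto
  have 1: "((\<lambda>x. transition d e (transition c d x)) has_derivative
      (\<lambda>w. jacobian d e (snd d p) (jacobian c d (snd c p) w))) (at (snd c p))"
    by (rule has_derivative_compose)
      (use assms has_derivative_transition[of c d p] has_derivative_transition[of d e p] in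
        \<open>simp_all add: transition_chart\<close>)
  have "(transition c e has_derivative
      (\<lambda>w. jacobian d e (snd d p) (jacobian c d (snd c p) w))) (at (snd c p))"
    by (rule has_derivative_transform_within_open[OF 1 \<open>open (snd c ` ?V)\<close>])
      (use assms in \<open>auto simp: transition_chart\<close>)
  then show ?thesis
    using frechet_derivative_at by metis
qed

lemma jacobian_refl:
  assumes "c \<in> Atlas M" "p \<in> fst c"
  shows "jacobian c c (snd c p) w = w"
proof -
  have "(transition c c has_derivative (\<lambda>w. w)) (at (snd c p))"
    by (rule has_derivative_transform_within_open[OF has_derivative_ident chart_image_open])
      (use assms in \<open>auto simp: transition_def\<close>)
  then show ?thesis
    using frechet_derivative_at by metis
qed

section \<open>Tangent vectors in coordinates\<close>

lemma coord_vec_apply: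
  "d \<in> Atlas M \<Longrightarrow> p \<in> fst d \<Longrightarrow> coord_vec M c p w d = jacobian c d (snd c p) w"
  by (simp add: coord_vec_def charts_at_def)

lemma coord_vec_same: "c \<in> Atlas M \<Longrightarrow> p \<in> fst c \<Longrightarrow> coord_vec M c p w c = w"
  by (simp add: coord_vec_apply jacobian_refl)

lemma coord_vec_in_tangent_space:
  "c \<in> Atlas M \<Longrightarrow> p \<in> fst c \<Longrightarrow> coord_vec M c p w \<in> tangent_space M p"
  unfolding tangent_space_def by (simp add: coord_vec_def charts_at_def jacobian_trans del: split_paired_All)

text \<open>The transformation law determines a tangent vector by its coordinates in one chart, so
  forms need only be evaluated on coordinate vectors of a chart of choice.\<close>

lemma tangent_space_eq_coord_vec:
  assumes "c \<in> Atlas M" "p \<in> fst c" and v: "v \<in> tangent_space M p"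
  shows "v = coord_vec M c p (v c)"
proof
  fix e
  have v1: "v e = jacobian c e (snd c p) (v c)" if "e \<in> charts_at M p"
  proof -
    have "\<forall>c\<in>charts_at M p. \<forall>d\<in>charts_at M p. v d = jacobian c d (snd c p) (v c)"
      using v unfolding tangent_space_def mem_Collect_eq by (rule conjunct1)
    moreover have "c \<in> charts_at M p"
      using assms by (simp add: charts_at_iff)
    ultimately have "\<forall>d\<in>charts_at M p. v d = jacobian c d (snd c p) (v c)"
      by (rule bspec)
    then show ?thesis
      using that by (rule bspec)
  qed
  have v2: "v e = 0" if "e \<notin> charts_at M p"
  proof -
    have "\<forall>c. c \<notin> charts_at M p \<longrightarrow> v c = 0"
      using v unfolding tangent_space_def mem_Collect_eq by (rule conjunct2)
    then show ?thesis
      using that by blast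
  qed
  show "v e = coord_vec M c p (v c) e"
    unfolding coord_vec_def using v1 v2 by presburger
qed

lemma coord_vec_change:
  assumes "c \<in> Atlas M" "d \<in> Atlas M" "p \<in> fst c" "p \<in> fst d"
  shows "coord_vec M c p w = coord_vec M d p (jacobian c d (snd c p) w)"
  unfolding coord_vec_apply[OF assms(2,4), symmetric]
  by (intro tangent_space_eq_coord_vec coord_vec_in_tangent_space assms)

lemma linear_coord_vec:
  assumes "c \<in> Atlas M" "p \<in> fst c"
  shows "linear (\<lambda>w. coord_vec M c p w e)"
proof (cases "e \<in> charts_at M p")
  case True
  then show ?thesis
    using linear_jacobian[of c e p] assms by (simp add: coord_vec_def charts_at_def)
qed (simp add: coord_vec_def linear_zero)

lemma coord_vec_combination:
  "c \<in> Atlas M \<Longrightarrow> p \<in> fst c \<Longrightarrow>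
    coord_vec M c p (a *\<^sub>R u + b *\<^sub>R w) = (\<lambda>e. a *\<^sub>R coord_vec M c p u e + b *\<^sub>R coord_vec M c p w e)"
  using linear_add[OF linear_coord_vec] linear_scale[OF linear_coord_vec] by (simp add: fun_eq_iff)

lemma coord_vec_in_frames:
  assumes "c \<in> Atlas M" "p \<in> fst c"
  shows "coord_vec M c p \<in> frames M p"
proof -
  have "bij_betw (coord_vec M c p) UNIV (tangent_space M p)"
  proof (rule bij_betw_byWitness[where f' = "\<lambda>v. v c"])
    show "\<forall>v\<in>tangent_space M p. coord_vec M c p (v c) = v"
      using tangent_space_eq_coord_vec[OF assms] by metis
  qed (use coord_vec_in_tangent_space[OF assms] assms in \<open>auto simp: coord_vec_same\<close>)
  then show ?thesis
    using assms by (simp add: frames_def linear_coord_vec)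
qed

section \<open>Functions of class C1 on the manifold\<close>

definition C1_fun :: "('a \<Rightarrow> real) \<Rightarrow> bool" where
  "C1_fun h \<longleftrightarrow> (\<forall>c\<in>Atlas M. C1_on (\<lambda>x. h (chart_inv c x)) (chart_image c))"

definition chart_bump :: "('a, 'n) chart \<Rightarrow> real ^ 'n \<Rightarrow> real \<Rightarrow> 'a \<Rightarrow> real" where
  "chart_bump c z r p = (if p \<in> fst c then bump z r (snd c p) else 0)"

text \<open>The closed ball pulls back to a compact set \<open>?K\<close>, which is closed because
  the manifold is Hausdorff. In another chart \<open>d\<close> the function is a bump composed with
  a transition map on the overlap, and zero off \<open>?K\<close>; these two open sets cover the
  chart.\<close>

lemma C1_fun_chart_bump:
  assumes c: "c \<in> Atlas M" and r: "0 < r" "cball z r \<subseteq> chart_image c"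
  shows "C1_fun (chart_bump c z r)"
  unfolding C1_fun_def
proof
  fix d assume d: "d \<in> Atlas M"
  let ?K = "chart_inv c ` cball z r"
  have K1: "?K \<subseteq> fst c"
    using r(2) by (intro image_subsetI chart_inv_in) (rule subsetD)
  have "snd c ` ?K = (\<lambda>x. x) ` cball z r"
    unfolding image_image by (rule image_cong[OF refl], rule chart_chart_inv) (rule subsetD[OF r(2)])
  then have K2: "snd c ` ?K = cball z r"
    by (simp only: image_ident)
  note K = K1 K2
  have "compactin (subtopology (Top M) (fst c)) ?K"
    using homeomorphic_map_compactness_eq[OF chart_homeo[OF c], of ?K] K r(2)
      order_trans[OF K1 chart_subset_points[OF c]]
    by (simp add: topspace_chart[OF c] compactin_subtopology)
  then have "compactin (Top M) ?K"
    by (simp add: compactin_subtopology)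
  then have "closedin (Top M) ?K"
    using smooth unfolding smooth_manifold_def by (blast intro: compactin_imp_closedin)
  then have op: "openin (Top M) (fst d - ?K)"
    using chart_open[OF d] by (simp add: openin_diff)
  have "C1_on (\<lambda>x. chart_bump c z r (chart_inv d x)) (overlap d c \<union> snd d ` (fst d - ?K))"
  proof (rule C1_on_Un[OF overlap_open[OF d c] open_chart_image_of[OF d op]])
    show "C1_on (\<lambda>x. chart_bump c z r (chart_inv d x)) (overlap d c)"
      by (rule C1_on_cong[OF overlap_open[OF d c] C1_on_compose[OF transition_Ck[OF d c] C1_on_bump subset_UNIV]])
        (use d in \<open>auto simp: chart_bump_def transition_chart\<close>)
    show "C1_on (\<lambda>x. chart_bump c z r (chart_inv d x)) (snd d ` (fst d - ?K))"
    proof (rule C1_on_cong[OF open_chart_image_of[OF d op] C1_on_const])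
      fix x assume "x \<in> snd d ` (fst d - ?K)"
      then obtain q where q: "x = snd d q" "q \<in> fst d" "q \<notin> ?K" by auto
      have "snd c q \<notin> ball z r" if "q \<in> fst c"
        using q that c by (metis ball_subset_cball chart_inv_chart image_eqI subsetD)
      then show "chart_bump c z r (chart_inv d x) = 0"
        using q d r by (auto simp add: chart_bump_def bump_eq_0_iff dist_commute)
    qed auto
  qed auto
  moreover have "overlap d c \<union> snd d ` (fst d - ?K) = chart_image d"
    unfolding image_Un[symmetric] by (rule arg_cong[where f = "image (snd d)"]) (use K1 in blast)
  ultimately show "C1_on (\<lambda>x. chart_bump c z r (chart_inv d x)) (chart_image d)"
    by simp
qed

end

section \<open>Differential forms in charts\<close>

lemma Ck_on_cong:
  assumes "open S" "\<And>x. x \<in> S \<Longrightarrow> f x = g x" "Ck_on k f S"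
  shows "Ck_on k g S"
  using assms(2,3)
proof (induction k arbitrary: f g)
  case 0
  then show ?case by (auto cong: continuous_on_cong)
next
  case (Suc k)
  have g: "(g has_derivative frechet_derivative f (at x)) (at x)" if "x \<in> S" for x
  proof (rule has_derivative_transform_within_open[OF _ assms(1) that])
    show "(f has_derivative frechet_derivative f (at x)) (at x)"
      using Suc.prems(2) that by (simp add: frechet_derivative_works)
  qed (rule Suc.prems(1))
  have "Ck_on k (\<lambda>x. frechet_derivative g (at x) v) S" for v
    by (rule Suc.IH[where f = "\<lambda>x. frechet_derivative f (at x) v"])
      (use Suc.prems frechet_derivative_at[OF g] in auto)
  then show ?case
    using g by (auto simp: differentiable_def)
qed

lemma frechet_derivative_component:
  fixes f :: "'a::euclidean_space \<Rightarrow> real ^ 'n::finite"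
  assumes "f differentiable (at x)"
  shows "((\<lambda>x. f x $ i) has_derivative (\<lambda>v. frechet_derivative f (at x) v $ i)) (at x)"
    and "frechet_derivative (\<lambda>x. f x $ i) (at x) v = frechet_derivative f (at x) v $ i"
proof -
  show 1: "((\<lambda>x. f x $ i) has_derivative (\<lambda>v. frechet_derivative f (at x) v $ i)) (at x)"
    using bounded_linear.has_derivative[OF bounded_linear_vec_nth] assms
    by (simp add: frechet_derivative_works)
  show "frechet_derivative (\<lambda>x. f x $ i) (at x) v = frechet_derivative f (at x) v $ i"
    using frechet_derivative_at[OF 1] by metis
qed

lemma Ck_on_component:
  fixes f :: "'a::euclidean_space \<Rightarrow> real ^ 'n::finite"
  assumes "open S" "Ck_on k f S"
  shows "Ck_on k (\<lambda>x. f x $ i) S"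
  using assms(2)
proof (induction k arbitrary: f)
  case 0
  then show ?case by (auto intro: continuous_intros)
next
  case (Suc k)
  have "Ck_on k (\<lambda>x. frechet_derivative (\<lambda>x. f x $ i) (at x) v) S" for v
    by (rule Ck_on_cong[OF assms(1) _ Suc.IH[of "\<lambda>x. frechet_derivative f (at x) v"]])
      (use Suc.prems in \<open>simp_all add: frechet_derivative_component\<close>)
  then show ?case
    using Suc.prems frechet_derivative_component(1) unfolding Ck_on.simps differentiable_def by blast
qed

lemma frechet_derivative_commute_vec:
  fixes f :: "'a::euclidean_space \<Rightarrow> real ^ 'n::finite"
  assumes S: "open S" and f: "Ck_on 2 f S" and x: "x \<in> S"
  shows "frechet_derivative (\<lambda>y. frechet_derivative f (at y) v) (at x) w =
         frechet_derivative (\<lambda>y. frechet_derivative f (at y) w) (at x) v"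
proof -
  have d1: "f differentiable (at y)" if "y \<in> S" for y
    using f that by (simp add: numeral_2_eq_2)
  have d2: "(\<lambda>y. frechet_derivative f (at y) v) differentiable (at x)" for v
    using f x by (simp add: numeral_2_eq_2)
  have 1: "frechet_derivative (\<lambda>y. frechet_derivative (\<lambda>x. f x $ i) (at y) v) (at x) w =
      frechet_derivative (\<lambda>y. frechet_derivative f (at y) v) (at x) w $ i" for v w i
  proof -
    have "((\<lambda>y. frechet_derivative (\<lambda>x. f x $ i) (at y) v) has_derivative
      (\<lambda>w. frechet_derivative (\<lambda>y. frechet_derivative f (at y) v) (at x) w $ i)) (at x)"
      by (rule has_derivative_transform_within_open[OF frechet_derivative_component(1)[OF d2] S x])
        (simp add: frechet_derivative_component(2) d1)
    then show ?thesis
      using frechet_derivative_at by metis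
  qed
  show ?thesis
    unfolding vec_eq_iff
  proof
    fix i
    show "frechet_derivative (\<lambda>y. frechet_derivative f (at y) v) (at x) w $ i =
        frechet_derivative (\<lambda>y. frechet_derivative f (at y) w) (at x) v $ i"
      using frechet_derivative_commute[OF S Ck_on_component[OF S f, of i] x, of v w]
      unfolding 1 .
  qed
qed

lemma linear_axis_expand:
  fixes f :: "real ^ 'n::finite \<Rightarrow> real"
  assumes "linear f"
  shows "f u = (\<Sum>k\<in>UNIV. u $ k * f (axis k 1))"
proof -
  have "f u = f (\<Sum>k\<in>UNIV. u $ k *\<^sub>R axis k 1)"
    by (simp add: basis_expansion[where 'a = real, unfolded scalar_mult_eq_scaleR])
  also have "\<dots> = (\<Sum>k\<in>UNIV. u $ k * f (axis k 1))"
    by (simp only: linear_sum[OF assms] linear_scale[OF assms] real_scaleR_def)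
  finally show ?thesis .
qed

text \<open>A product rule that asks for differentiability of \<open>\<Phi>\<close> at fixed
  arguments only. Splitting \<open>A y\<close> into \<open>A x\<close> and \<open>A y - A x\<close>
  and expanding the latter in the basis gives ordinary products; the coordinates of
  \<open>A y - A x\<close> vanish at \<open>x\<close>, so only their derivatives contribute.\<close>

lemma has_derivative_linear_family:
  fixes \<Phi> :: "'a::real_normed_vector \<Rightarrow> real ^ 'n::finite \<Rightarrow> real"
  assumes S: "open S" "x \<in> S" and lin: "\<And>y. y \<in> S \<Longrightarrow> linear (\<Phi> y)"
    and \<Phi>: "\<And>u. ((\<lambda>y. \<Phi> y u) has_derivative \<Phi>' u) (at x)"
    and A: "(A has_derivative A') (at x)"
  shows "((\<lambda>y. \<Phi> y (A y)) has_derivative (\<lambda>w. \<Phi>' (A x) w + \<Phi> x (A' w))) (at x)"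
proof -
  have "((\<lambda>y. (A y - A x) $ k) has_derivative (\<lambda>w. A' w $ k)) (at x)" for k
    using bounded_linear.has_derivative[OF bounded_linear_vec_nth has_derivative_diff[OF A has_derivative_const]]
    by simp
  then have "((\<lambda>y. (\<Sum>k\<in>UNIV. (A y - A x) $ k * \<Phi> y (axis k 1)) + \<Phi> y (A x)) has_derivative
      (\<lambda>w. (\<Sum>k\<in>UNIV. (A x - A x) $ k * \<Phi>' (axis k 1) w + A' w $ k * \<Phi> x (axis k 1)) + \<Phi>' (A x) w)) (at x)"
    by (intro has_derivative_add has_derivative_sum has_derivative_mult \<Phi>)
  moreover have "(\<Sum>k\<in>UNIV. (A x - A x) $ k * \<Phi>' (axis k 1) w + A' w $ k * \<Phi> x (axis k 1)) = \<Phi> x (A' w)" for w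
    using linear_axis_expand[OF lin[OF S(2)], of "A' w"] by simp
  ultimately have "((\<lambda>y. (\<Sum>k\<in>UNIV. (A y - A x) $ k * \<Phi> y (axis k 1)) + \<Phi> y (A x)) has_derivative
      (\<lambda>w. \<Phi>' (A x) w + \<Phi> x (A' w))) (at x)"
    by (simp add: add.commute)
  then show ?thesis
  proof (rule has_derivative_transform_within_open[OF _ S])
    fix y assume "y \<in> S"
    then show "(\<Sum>k\<in>UNIV. (A y - A x) $ k * \<Phi> y (axis k 1)) + \<Phi> y (A x) = \<Phi> y (A y)"
      using linear_axis_expand[OF lin, of y "A y - A x"] linear_diff[OF lin, of y "A y" "A x"] by simp
  qed
qed

lemma alternating_multilinear_combination:
  "alternating_multilinear M k p f \<Longrightarrow> vs \<in> arg_lists M k p \<Longrightarrow> i < k \<Longrightarrow>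
    u \<in> tangent_space M p \<Longrightarrow> v \<in> tangent_space M p \<Longrightarrow>
    f (vs[i := \<lambda>c. a *\<^sub>R u c + b *\<^sub>R v c]) = a * f (vs[i := u]) + b * f (vs[i := v])"
  unfolding alternating_multilinear_def by blast

lemma alternating_multilinear_eq_0:
  "alternating_multilinear M k p f \<Longrightarrow> vs \<in> arg_lists M k p \<Longrightarrow> vs ! i = vs ! j \<Longrightarrow>
    i < k \<Longrightarrow> j < k \<Longrightarrow> i \<noteq> j \<Longrightarrow> f vs = 0"
  unfolding alternating_multilinear_def by blast

section \<open>Components of forms under a change of chart\<close>

context smooth_mfd
begin

lemma transition_in_chart_image:
  assumes "c \<in> Atlas M" "y \<in> overlap c d"
  shows "transition c d y \<in> chart_image d"
proof -
  obtain q where q: "y = snd c q" "q \<in> fst c" "q \<in> fst d"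
    using assms(2) by blast
  show ?thesis
    unfolding q(1) transition_chart[OF assms(1) q(2)] using q(3) by (rule imageI)
qed

lemma jacobian_has_derivative:
  assumes "c \<in> Atlas M" "d \<in> Atlas M" "p \<in> fst c" "p \<in> fst d"
  shows "((\<lambda>y. jacobian c d y w) has_derivative
    frechet_derivative (\<lambda>y. jacobian c d y w) (at (snd c p))) (at (snd c p))"
  using transition_Ck[OF assms(1,2), of 2] assms(3,4)
  by (simp add: numeral_2_eq_2 frechet_derivative_works)

lemma jacobian_derivative_commute:
  assumes "c \<in> Atlas M" "d \<in> Atlas M" "p \<in> fst c" "p \<in> fst d"
  shows "frechet_derivative (\<lambda>y. jacobian c d y v) (at (snd c p)) w =
    frechet_derivative (\<lambda>y. jacobian c d y w) (at (snd c p)) v"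
  by (rule frechet_derivative_commute_vec[OF overlap_open[OF assms(1,2)] transition_Ck[OF assms(1,2)]])
    (use assms in simp)

lemma local_form_alternating:
  assumes "diff_form M k \<omega>" "c \<in> Atlas M" "x \<in> chart_image c" "length ws = k" "i < k" "j < k" "i \<noteq> j"
    "ws ! i = ws ! j"
  shows "local_form M \<omega> c ws x = 0"
proof -
  let ?p = "chart_inv c x"
  have p1: "?p \<in> fst c"
    by (rule chart_inv_in[OF assms(3)])
  have p2: "?p \<in> points M"
    by (rule subsetD[OF chart_subset_points[OF assms(2)] p1])
  note p = p1 p2
  have "alternating_multilinear M k ?p (\<omega> ?p)"
    using assms(1) p by (simp add: diff_form_def)
  moreover have "map (coord_vec M c ?p) ws \<in> arg_lists M k ?p"
    using assms(4) coord_vec_in_tangent_space[OF assms(2) p1] by (simp add: arg_lists_def image_subset_iff)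
  moreover have "map (coord_vec M c ?p) ws ! i = map (coord_vec M c ?p) ws ! j"
    using assms by simp
  ultimately show ?thesis
    using assms(5-7) unfolding local_form_def by (rule alternating_multilinear_eq_0)
qed

lemma linear_local_form:
  assumes "diff_form M k \<omega>" "c \<in> Atlas M" "x \<in> chart_image c" "length ws = k" "i < k"
  shows "linear (\<lambda>u. local_form M \<omega> c (ws[i := u]) x)"
proof -
  let ?p = "chart_inv c x"
  let ?e = "coord_vec M c ?p"
  have p1: "?p \<in> fst c"
    by (rule chart_inv_in[OF assms(3)])
  have p2: "?p \<in> points M"
    by (rule subsetD[OF chart_subset_points[OF assms(2)] p1])
  note p = p1 p2
  have alt: "alternating_multilinear M k ?p (\<omega> ?p)"
    using assms(1) p by (simp add: diff_form_def)
  have args: "map ?e ws \<in> arg_lists M k ?p"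
    using assms(4) coord_vec_in_tangent_space[OF assms(2) p1] by (simp add: arg_lists_def image_subset_iff)
  have comb: "local_form M \<omega> c (ws[i := a *\<^sub>R u + b *\<^sub>R v]) x =
      a * local_form M \<omega> c (ws[i := u]) x + b * local_form M \<omega> c (ws[i := v]) x" for a b u v
  proof -
    have "?e u \<in> tangent_space M ?p" "?e v \<in> tangent_space M ?p"
      by (rule coord_vec_in_tangent_space[OF assms(2) p1])+
    then have "\<omega> ?p ((map ?e ws)[i := \<lambda>c. a *\<^sub>R ?e u c + b *\<^sub>R ?e v c]) =
        a * \<omega> ?p ((map ?e ws)[i := ?e u]) + b * \<omega> ?p ((map ?e ws)[i := ?e v])"
      using alt args assms(5) by (intro alternating_multilinear_combination)
    then show ?thesis
      unfolding local_form_def map_update coord_vec_combination[OF assms(2) p(1)] .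
  qed
  show ?thesis
    by (rule linearI) (use comb[of 1 _ 1] comb[of _ _ 0] in simp_all)
qed

lemma local_form_transition:
  assumes "c \<in> Atlas M" "d \<in> Atlas M" "x \<in> overlap c d"
  shows "local_form M \<omega> c ws x = local_form M \<omega> d (map (jacobian c d x) ws) (transition c d x)"
proof -
  obtain p where p: "p \<in> fst c" "p \<in> fst d" "x = snd c p"
    using assms(3) by blast
  have "coord_vec M c p = coord_vec M d p \<circ> jacobian c d (snd c p)"
    using coord_vec_change[OF assms(1,2) p(1,2)] by (simp add: fun_eq_iff)
  then show ?thesis
    using assms p by (simp add: local_form_def transition_chart)
qed

lemma local_form_Ck:
  "diff_form M k \<omega> \<Longrightarrow> c \<in> Atlas M \<Longrightarrow> length ws = k \<Longrightarrow> Ck_on n (local_form M \<omega> c ws) (chart_image c)"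
  unfolding diff_form_def smooth_on_def by blast

lemma local_form_has_derivative:
  "diff_form M k \<omega> \<Longrightarrow> c \<in> Atlas M \<Longrightarrow> length ws = k \<Longrightarrow> x \<in> chart_image c \<Longrightarrow>
    (local_form M \<omega> c ws has_derivative frechet_derivative (local_form M \<omega> c ws) (at x)) (at x)"
  by (rule C1_on_has_derivative[OF local_form_Ck])

lemma linear_local_1_form:
  "diff_form M 1 \<omega> \<Longrightarrow> c \<in> Atlas M \<Longrightarrow> x \<in> chart_image c \<Longrightarrow> linear (\<lambda>u. local_form M \<omega> c [u] x)"
  using linear_local_form[where k = 1 and ws = "[0]" and i = 0] by simp

lemma linear_local_3_form:
  assumes "diff_form M 3 \<omega>" "c \<in> Atlas M" "x \<in> chart_image c"
  shows "linear (\<lambda>u. local_form M \<omega> c [u, v, w] x)"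
    and "linear (\<lambda>u. local_form M \<omega> c [v, u, w] x)"
    and "linear (\<lambda>u. local_form M \<omega> c [v, w, u] x)"
  using linear_local_form[OF assms, of "[0, v, w]" 0] linear_local_form[OF assms, of "[v, 0, w]" 1]
    linear_local_form[OF assms, of "[v, w, 0]" 2]
  by simp_all

lemma local_3_form_swap:
  assumes "diff_form M 3 \<omega>" "c \<in> Atlas M" "x \<in> chart_image c"
  shows "local_form M \<omega> c [v, u, w] x = - local_form M \<omega> c [u, v, w] x"
    and "local_form M \<omega> c [u, w, v] x = - local_form M \<omega> c [u, v, w] x"
proof -
  let ?f = "\<lambda>u v w. local_form M \<omega> c [u, v, w] x"
  have z: "?f u u w = 0" "?f u w w = 0" for u w
    using local_form_alternating[OF assms, of "[u, u, w]" 0 1]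
      local_form_alternating[OF assms, of "[u, w, w]" 1 2] by simp_all
  note l = linear_add[OF linear_local_3_form(1)[OF assms]] linear_add[OF linear_local_3_form(2)[OF assms]]
    linear_add[OF linear_local_3_form(3)[OF assms]]
  have "?f (u + v) (u + v) w = 0" by (rule z)
  then show "?f v u w = - ?f u v w"
    unfolding l by (simp add: z)
  have "?f u (v + w) (v + w) = 0" by (rule z)
  then show "?f u w v = - ?f u v w"
    unfolding l by (simp add: z)
qed

text \<open>The second summand comes from the varying Jacobian. It contains a second derivative of
  the transition map, is therefore symmetric in \<open>v\<close> and \<open>w\<close>, and
  disappears on antisymmetrisation; this makes the exterior derivative independent of the
  chart.\<close>

lemma local_1_form_derivative:
  assumes \<alpha>: "diff_form M 1 \<alpha>" and cd: "c \<in> Atlas M" "d \<in> Atlas M" and p: "p \<in> fst c" "p \<in> fst d"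
  defines "J \<equiv> jacobian c d (snd c p)"
  shows "frechet_derivative (local_form M \<alpha> c [v]) (at (snd c p)) w =
    frechet_derivative (local_form M \<alpha> d [J v]) (at (snd d p)) (J w) +
    local_form M \<alpha> d [frechet_derivative (\<lambda>y. jacobian c d y v) (at (snd c p)) w] (snd d p)"
proof -
  let ?x = "snd c p"
  let ?S = "overlap c d"
  have x: "?x \<in> ?S" using p by blast
  have tr: "transition c d y \<in> chart_image d" if "y \<in> ?S" for y
    by (rule transition_in_chart_image[OF cd(1) that])
  have base: "((\<lambda>y. local_form M \<alpha> d [u] (transition c d y)) has_derivative
      (\<lambda>w. frechet_derivative (local_form M \<alpha> d [u]) (at (snd d p)) (J w))) (at ?x)" for u
    unfolding J_def
    by (rule has_derivative_compose[OF has_derivative_transition[OF cd p]])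
      (use local_form_has_derivative[OF \<alpha> cd(2), of "[u]" "snd d p"] cd p in \<open>simp add: transition_chart\<close>)
  have "((\<lambda>y. local_form M \<alpha> d [jacobian c d y v] (transition c d y)) has_derivative
      (\<lambda>w. frechet_derivative (local_form M \<alpha> d [J v]) (at (snd d p)) (J w) +
    local_form M \<alpha> d [frechet_derivative (\<lambda>y. jacobian c d y v) (at ?x) w] (transition c d ?x))) (at ?x)"
    unfolding J_def
    by (rule has_derivative_linear_family[OF overlap_open[OF cd] x
          linear_local_1_form[OF \<alpha> cd(2) tr] base[unfolded J_def] jacobian_has_derivative[OF cd p]])
  then have "(local_form M \<alpha> c [v] has_derivative
      (\<lambda>w. frechet_derivative (local_form M \<alpha> d [J v]) (at (snd d p)) (J w) +
    local_form M \<alpha> d [frechet_derivative (\<lambda>y. jacobian c d y v) (at ?x) w] (transition c d ?x))) (at ?x)"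
    by (rule has_derivative_transform_within_open[OF _ overlap_open[OF cd] x])
      (simp add: local_form_transition[OF cd])
  from fun_cong[OF frechet_derivative_at[OF this], of w] show ?thesis
    unfolding transition_chart[OF cd(1) p(1)] by (rule sym)
qed

lemma local_3_form_derivative:
  assumes \<phi>: "diff_form M 3 \<phi>" and cd: "c \<in> Atlas M" "d \<in> Atlas M" and p: "p \<in> fst c" "p \<in> fst d"
  defines "J \<equiv> jacobian c d (snd c p)"
    and "H \<equiv> \<lambda>v w. frechet_derivative (\<lambda>y. jacobian c d y v) (at (snd c p)) w"
  shows "frechet_derivative (local_form M \<phi> c [t, u, v]) (at (snd c p)) w =
    frechet_derivative (local_form M \<phi> d [J t, J u, J v]) (at (snd d p)) (J w) +
    local_form M \<phi> d [J t, J u, H v w] (snd d p) + local_form M \<phi> d [J t, H u w, J v] (snd d p) +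
    local_form M \<phi> d [H t w, J u, J v] (snd d p)"
proof -
  let ?x = "snd c p"
  let ?S = "overlap c d"
  have x: "?x \<in> ?S" using p by blast
  have tr: "transition c d y \<in> chart_image d" if "y \<in> ?S" for y
    by (rule transition_in_chart_image[OF cd(1) that])
  have trx: "transition c d ?x = snd d p"
    by (rule transition_chart[OF cd(1) p(1)])
  let ?F = "\<lambda>t u v y. local_form M \<phi> d [t, u, v] (transition c d y)"
  let ?D = "\<lambda>t u v. frechet_derivative (local_form M \<phi> d [t, u, v]) (at (snd d p))"
  have J': "((\<lambda>y. jacobian c d y v) has_derivative H v) (at ?x)" for v
    unfolding H_def by (rule jacobian_has_derivative[OF cd p])
  have 0: "(?F t u v has_derivative (\<lambda>w. ?D t u v (J w))) (at ?x)" for t u v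
    unfolding J_def
    by (rule has_derivative_compose[OF has_derivative_transition[OF cd p]])
      (use local_form_has_derivative[OF \<phi> cd(2), of "[t, u, v]" "snd d p"] cd p in \<open>simp add: trx\<close>)
  \<comment> \<open>The constant arguments are replaced by moving ones one slot at a time, starting
    with the last; each replacement adds one second-derivative term.\<close>
  have 1: "((\<lambda>y. ?F t u (jacobian c d y v) y) has_derivative
      (\<lambda>w. ?D t u (J v) (J w) + ?F t u (H v w) ?x)) (at ?x)" for t u
    unfolding J_def
    by (rule has_derivative_linear_family[OF overlap_open[OF cd] x
          linear_local_3_form(3)[OF \<phi> cd(2) tr] 0[unfolded J_def] J'])
  have 2: "((\<lambda>y. ?F t (jacobian c d y u) (jacobian c d y v) y) has_derivative
      (\<lambda>w. (?D t (J u) (J v) (J w) + ?F t (J u) (H v w) ?x) + ?F t (H u w) (J v) ?x)) (at ?x)" for t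
    unfolding J_def
    by (rule has_derivative_linear_family[OF overlap_open[OF cd] x
          linear_local_3_form(2)[OF \<phi> cd(2) tr] 1[unfolded J_def] J'])
  have "((\<lambda>y. ?F (jacobian c d y t) (jacobian c d y u) (jacobian c d y v) y) has_derivative
      (\<lambda>w. ((?D (J t) (J u) (J v) (J w) + ?F (J t) (J u) (H v w) ?x) + ?F (J t) (H u w) (J v) ?x) +
        ?F (H t w) (J u) (J v) ?x)) (at ?x)"
    unfolding J_def
    by (rule has_derivative_linear_family[OF overlap_open[OF cd] x
          linear_local_3_form(1)[OF \<phi> cd(2) tr] 2[unfolded J_def] J'])
  then have "(local_form M \<phi> c [t, u, v] has_derivative
      (\<lambda>w. ((?D (J t) (J u) (J v) (J w) + ?F (J t) (J u) (H v w) ?x) + ?F (J t) (H u w) (J v) ?x) +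
        ?F (H t w) (J u) (J v) ?x)) (at ?x)"
    by (rule has_derivative_transform_within_open[OF _ overlap_open[OF cd] x])
      (simp add: local_form_transition[OF cd])
  from fun_cong[OF frechet_derivative_at[OF this], of w] show ?thesis
    unfolding trx by (rule sym)
qed

section \<open>Exterior derivatives of 1-forms and 3-forms in an arbitrary chart\<close>

definition d1 :: "('a, 'n) form \<Rightarrow> ('a, 'n) chart \<Rightarrow> real ^ 'n \<Rightarrow> real ^ 'n \<Rightarrow> real ^ 'n \<Rightarrow> real" where
  "d1 \<alpha> c x u v = frechet_derivative (local_form M \<alpha> c [v]) (at x) u
    - frechet_derivative (local_form M \<alpha> c [u]) (at x) v"

definition d3 :: "('a, 'n) form \<Rightarrow> ('a, 'n) chart \<Rightarrow> real ^ 'n \<Rightarrow>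
    real ^ 'n \<Rightarrow> real ^ 'n \<Rightarrow> real ^ 'n \<Rightarrow> real ^ 'n \<Rightarrow> real" where
  "d3 \<phi> c x t u v w = frechet_derivative (local_form M \<phi> c [u, v, w]) (at x) t
    - frechet_derivative (local_form M \<phi> c [t, v, w]) (at x) u
    + frechet_derivative (local_form M \<phi> c [t, u, w]) (at x) v
    - frechet_derivative (local_form M \<phi> c [t, u, v]) (at x) w"

lemma d1_transition:
  assumes "diff_form M 1 \<alpha>" "c \<in> Atlas M" "d \<in> Atlas M" "p \<in> fst c" "p \<in> fst d"
  shows "d1 \<alpha> c (snd c p) u v =
    d1 \<alpha> d (snd d p) (jacobian c d (snd c p) u) (jacobian c d (snd c p) v)"
  using jacobian_derivative_commute[OF assms(2-5), of u v]
  by (simp add: d1_def local_1_form_derivative[OF assms])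

text \<open>The change of chart produces twelve second-derivative terms, two for each pair among the
  four arguments. Once the arguments of the symmetric \<open>H\<close> are put in a common order,
  three of these pairs cancel directly and the other three after exchanging slots of the
  form.\<close>

lemma d3_transition:
  assumes "diff_form M 3 \<phi>" "c \<in> Atlas M" "d \<in> Atlas M" "p \<in> fst c" "p \<in> fst d"
  defines "J \<equiv> jacobian c d (snd c p)"
  shows "d3 \<phi> c (snd c p) t u v w = d3 \<phi> d (snd d p) (J t) (J u) (J v) (J w)"
proof -
  define H where "H v w = frechet_derivative (\<lambda>y. jacobian c d y v) (at (snd c p)) w" for v w
  have H: "H v w = H w v" for v w
    unfolding H_def by (rule jacobian_derivative_commute[OF assms(2-5)])
  have d: "snd d p \<in> chart_image d" using assms by blast
  note sw = local_3_form_swap[OF assms(1,3) d]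
  show ?thesis
    unfolding d3_def local_3_form_derivative[OF assms(1-5)] J_def[symmetric] H_def[symmetric]
    unfolding H[of u t] H[of v t] H[of w t] H[of v u] H[of w u] H[of w v]
    using sw(1)[where v = "J u" and u = "H t v" and w = "J w"] sw(1)[where v = "J u" and u = "H t w" and w = "J v"]
      sw(2)[where u = "J u" and w = "J v" and v = "H t w"] sw(2)[where u = "J t" and w = "J v" and v = "H u w"]
    by simp
qed

text \<open>Replaces the chart selected by \<open>SOME\<close> in \<open>ext_deriv\<close> by any
  chart around the point.\<close>

lemma ext_deriv_1_form:
  assumes \<alpha>: "diff_form M 1 \<alpha>" and c: "c \<in> Atlas M" "p \<in> fst c"
  shows "ext_deriv M \<alpha> p [coord_vec M c p u, coord_vec M c p v] = d1 \<alpha> c (snd c p) u v"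
proof -
  define d where "d = (SOME d. d \<in> charts_at M p)"
  have "d \<in> charts_at M p"
    unfolding d_def using c charts_at_iff by (intro someI) blast
  then have d: "d \<in> Atlas M" "p \<in> fst d"
    by (simp_all add: charts_at_iff)
  have "ext_deriv M \<alpha> p [coord_vec M c p u, coord_vec M c p v] =
      d1 \<alpha> d (snd d p) (jacobian c d (snd c p) u) (jacobian c d (snd c p) v)"
    by (simp add: ext_deriv_def ext_deriv_in_def d_def[symmetric] d1_def coord_vec_apply[OF d])
  then show ?thesis
    using d1_transition[OF \<alpha> c(1) d(1) c(2) d(2)] by simp
qed

lemma ext_deriv_3_form:
  assumes \<phi>: "diff_form M 3 \<phi>" and c: "c \<in> Atlas M" "p \<in> fst c"
  shows "ext_deriv M \<phi> p [coord_vec M c p t, coord_vec M c p u, coord_vec M c p v, coord_vec M c p w] =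
    d3 \<phi> c (snd c p) t u v w"
proof -
  define d where "d = (SOME d. d \<in> charts_at M p)"
  have "d \<in> charts_at M p"
    unfolding d_def using c charts_at_iff by (intro someI) blast
  then have d: "d \<in> Atlas M" "p \<in> fst d"
    by (simp_all add: charts_at_iff)
  have "ext_deriv M \<phi> p [coord_vec M c p t, coord_vec M c p u, coord_vec M c p v, coord_vec M c p w] =
      d3 \<phi> d (snd d p) (jacobian c d (snd c p) t) (jacobian c d (snd c p) u)
        (jacobian c d (snd c p) v) (jacobian c d (snd c p) w)"
    by (simp add: ext_deriv_def ext_deriv_in_def d_def[symmetric] d3_def coord_vec_apply[OF d] lessThan_Suc
      numeral_3_eq_3 numeral_2_eq_2)
  then show ?thesis
    using d3_transition[OF \<phi> c(1) d(1) c(2) d(2)] by simp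
qed

end

section \<open>Stokes theorem in a chart\<close>

abbreviation pd :: "'n::finite \<Rightarrow> (real ^ 'n \<Rightarrow> real) \<Rightarrow> real ^ 'n \<Rightarrow> real" where
  "pd i g x \<equiv> frechet_derivative g (at x) (axis i 1)"

lemma integral_alt_sum:
  assumes "\<And>\<sigma>. (g \<sigma>) absolutely_integrable_on U"
  shows "(\<lambda>x. alt_sum (\<lambda>\<sigma>. g \<sigma> x)) absolutely_integrable_on U"
    and "integral U (\<lambda>x. alt_sum (\<lambda>\<sigma>. g \<sigma> x)) = alt_sum (\<lambda>\<sigma>. integral U (g \<sigma>))"
  unfolding alt_sum_def using assms
  by (auto simp: integral_sum set_lebesgue_integral_eq_integral(1) intro!: absolutely_integrable_sum)

lemma pd_mult4:
  assumes "C1_on R U" "C1_on a U" "C1_on p U" "C1_on f U" "x \<in> U"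
  shows "pd i (\<lambda>x. R x * a x * p x * f x) x =
    pd i R x * a x * p x * f x + R x * (pd i a x * p x * f x) +
    R x * a x * pd i p x * f x + R x * a x * p x * pd i f x"
proof -
  note D = C1_on_has_derivative[OF _ assms(5)]
  have "((\<lambda>x. R x * a x * p x * f x) has_derivative
    (\<lambda>v. R x * a x * p x * frechet_derivative f (at x) v +
      (R x * a x * frechet_derivative p (at x) v +
        (R x * frechet_derivative a (at x) v + frechet_derivative R (at x) v * a x) * p x) * f x)) (at x)"
    by (intro has_derivative_mult D assms)
  from fun_cong[OF frechet_derivative_at[OF this], of "axis i 1", symmetric] show ?thesis
    by (simp add: algebra_simps)
qed

text \<open>In coefficients, d(R \<alpha> \<and> \<beta> \<and> \<phi>) = dR \<and> \<alpha> \<and>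
  \<beta> \<and> \<phi> + R \<beta> \<and> \<beta> \<and> \<phi> has integral 0. Antisymmetrisation
  multiplies the first term by 2! * 3! = 12 and the second by 2! * 2! * 3! = 24, so \<open>E\<close>
  enters with the factor 2.\<close>

lemma local_stokes:
  fixes a :: "7 \<Rightarrow> real ^ 7 \<Rightarrow> real" and f :: "7 \<Rightarrow> 7 \<Rightarrow> 7 \<Rightarrow> real ^ 7 \<Rightarrow> real"
  assumes U: "open U" and K: "compact K" "K \<subseteq> U"
    and R: "C1_on R U" "\<And>x. x \<in> U - K \<Longrightarrow> R x = 0"
    and a: "\<And>k. Ck_on 2 (a k) U" and f: "\<And>i j k. C1_on (f i j k) U"
    and closed: "\<And>i j k l x. x \<in> U \<Longrightarrow>
      pd i (f j k l) x - pd j (f i k l) x + pd k (f i j l) x - pd l (f i j k) x = 0"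
    and b: "\<And>k l x. x \<in> U \<Longrightarrow> b k l x = pd k (a l) x - pd l (a k) x"
  defines "E \<equiv> \<lambda>x. alt_sum (\<lambda>\<sigma>. pd (\<sigma> 1) R x * a (\<sigma> 2) x * b (\<sigma> 3) (\<sigma> 4) x * f (\<sigma> 5) (\<sigma> 6) (\<sigma> 7) x)"
    and "P \<equiv> \<lambda>x. alt_sum (\<lambda>\<sigma>. b (\<sigma> 1) (\<sigma> 2) x * b (\<sigma> 3) (\<sigma> 4) x * f (\<sigma> 5) (\<sigma> 6) (\<sigma> 7) x)"
  shows "(\<lambda>x. 2 * E x + R x * P x) absolutely_integrable_on U"
    and "integral U (\<lambda>x. 2 * E x + R x * P x) = 0"
proof -
  \<comment> \<open>\<open>g\<close> carries the one-sided derivatives \<open>p\<close> in place of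
    \<open>b\<close>. Under \<open>alt_sum\<close> each \<open>b\<close> is worth two
    \<open>p\<close>, so \<open>E\<close> is twice the sum of \<open>e\<close> and \<open>P\<close>
    four times the sum of \<open>q\<close>; both lead to the factor 4 in \<open>eq\<close>.\<close>
  define p where "p k l = pd k (a l)" for k l
  define g where "g \<sigma> x = R x * a (\<sigma> 2) x * p (\<sigma> 3) (\<sigma> 4) x * f (\<sigma> 5) (\<sigma> 6) (\<sigma> 7) x" for \<sigma> :: "7 \<Rightarrow> 7" and x
  have a1: "C1_on (a k) U" for k
    using a[of k] by (auto simp: numeral_2_eq_2 differentiable_imp_continuous_on
        differentiable_on_def differentiable_at_withinI intro!: differentiable_imp_continuous_on)
  have p: "C1_on (p k l) U" for k l
    using a[of l] by (simp add: p_def numeral_2_eq_2)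
  have g: "C1_on (g \<sigma>) U" for \<sigma>
    unfolding g_def by (intro C1_on_mult R a1 p f)
  have ai: "(\<lambda>x. pd (\<sigma> 1) (g \<sigma>) x) absolutely_integrable_on U"
    and int0: "integral U (\<lambda>x. pd (\<sigma> 1) (g \<sigma>) x) = 0" for \<sigma>
    by (rule integral_directional_derivative[OF U g K]; simp add: g_def R(2))+
  have eq: "2 * E x + R x * P x = 4 * alt_sum (\<lambda>\<sigma>. pd (\<sigma> 1) (g \<sigma>) x)" if x: "x \<in> U" for x
  proof -
    define e where "e \<sigma> = pd (\<sigma> 1) R x * a (\<sigma> 2) x * p (\<sigma> 3) (\<sigma> 4) x * f (\<sigma> 5) (\<sigma> 6) (\<sigma> 7) x" for \<sigma> :: "7 \<Rightarrow> 7"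
    define q where "q \<sigma> = p (\<sigma> 1) (\<sigma> 2) x * p (\<sigma> 3) (\<sigma> 4) x * f (\<sigma> 5) (\<sigma> 6) (\<sigma> 7) x" for \<sigma> :: "7 \<Rightarrow> 7"
    define s where "s \<sigma> = R x * a (\<sigma> 2) x * pd (\<sigma> 1) (p (\<sigma> 3) (\<sigma> 4)) x * f (\<sigma> 5) (\<sigma> 6) (\<sigma> 7) x" for \<sigma> :: "7 \<Rightarrow> 7"
    define t where "t i j k l \<sigma> = R x * a (\<sigma> 2) x * p (\<sigma> 3) (\<sigma> 4) x * pd (\<sigma> i) (f (\<sigma> j) (\<sigma> k) (\<sigma> l)) x"
      for i j k l and \<sigma> :: "7 \<Rightarrow> 7"
    have "alt_sum (\<lambda>\<sigma>. e \<sigma> - e (\<sigma> \<circ> swap 3 4)) = 2 * alt_sum e"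
      unfolding alt_sum_diff by (simp add: alt_sum_transpose)
    moreover have "E x = alt_sum (\<lambda>\<sigma>. e \<sigma> - e (\<sigma> \<circ> swap 3 4))"
      unfolding E_def by (simp add: b[OF x] e_def p_def swap_id_eq algebra_simps)
    ultimately have Ee: "E x = 2 * alt_sum e" by simp
    let ?q' = "\<lambda>\<sigma>. q \<sigma> - q (\<sigma> \<circ> swap 3 4)"
    have "alt_sum (\<lambda>\<sigma>. ?q' \<sigma> - ?q' (\<sigma> \<circ> swap 1 2)) = 2 * alt_sum ?q'"
      unfolding alt_sum_diff[of ?q'] using alt_sum_transpose[of 1 2 ?q'] by simp
    also have "alt_sum ?q' = 2 * alt_sum q"
      unfolding alt_sum_diff by (simp add: alt_sum_transpose)
    finally have "alt_sum (\<lambda>\<sigma>. ?q' \<sigma> - ?q' (\<sigma> \<circ> swap 1 2)) = 2 * (2 * alt_sum q)" .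
    moreover have "P x = alt_sum (\<lambda>\<sigma>. ?q' \<sigma> - ?q' (\<sigma> \<circ> swap 1 2))"
      unfolding P_def by (simp add: b[OF x] q_def p_def swap_id_eq algebra_simps)
    ultimately have Pq: "P x = 2 * (2 * alt_sum q)" by (rule trans[rotated])
    \<comment> \<open>This is d\<beta> = 0: the term differentiating \<open>p\<close> contains a
      second derivative symmetric in slots 1 and 3, which antisymmetrisation kills.\<close>
    have "s (\<sigma> \<circ> swap 1 3) = s \<sigma>" for \<sigma>
      using frechet_derivative_commute[OF U a x] by (simp add: s_def p_def swap_id_eq)
    then have s0: "alt_sum s = 0"
      using alt_sum_transpose[of 1 3 s] by simp
    \<comment> \<open>The four terms of d\<phi> differ only by a relabelling of slots 1, 5, 6, 7.
      Their signed sum is therefore four times the alternating sum of the first, so that one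
      vanishes.\<close>
    have t1: "alt_sum (t 5 1 6 7) = - alt_sum (t 1 5 6 7)"
      using alt_sum_transpose[of 1 5 "t 1 5 6 7"] by (simp add: t_def[abs_def] swap_id_eq)
    have t2: "alt_sum (t 6 1 5 7) = - alt_sum (t 5 1 6 7)"
      using alt_sum_transpose[of 5 6 "t 5 1 6 7"] by (simp add: t_def[abs_def] swap_id_eq)
    have t3: "alt_sum (t 7 1 5 6) = - alt_sum (t 6 1 5 7)"
      using alt_sum_transpose[of 6 7 "t 6 1 5 7"] by (simp add: t_def[abs_def] swap_id_eq)
    have "t 1 5 6 7 \<sigma> - t 5 1 6 7 \<sigma> + t 6 1 5 7 \<sigma> - t 7 1 5 6 \<sigma> = 0" for \<sigma>
      using closed[OF x, where i = "\<sigma> 1" and j = "\<sigma> 5" and k = "\<sigma> 6" and l = "\<sigma> 7"]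
      by (simp add: t_def flip: right_diff_distrib distrib_left)
    then have "alt_sum (\<lambda>\<sigma>. t 1 5 6 7 \<sigma> - t 5 1 6 7 \<sigma> + t 6 1 5 7 \<sigma> - t 7 1 5 6 \<sigma>) = 0"
      by (simp add: alt_sum_def)
    then have t0: "alt_sum (t 1 5 6 7) = 0"
      unfolding alt_sum_add alt_sum_diff using t1 t2 t3 by simp
    have "alt_sum (\<lambda>\<sigma>. pd (\<sigma> 1) (g \<sigma>) x) = alt_sum (\<lambda>\<sigma>. e \<sigma> + R x * q \<sigma> + s \<sigma> + t 1 5 6 7 \<sigma>)"
      unfolding g_def pd_mult4[OF R(1) a1 p f x] e_def q_def s_def t_def by (simp add: p_def)
    also have "\<dots> = alt_sum e + R x * alt_sum q"
      unfolding alt_sum_add alt_sum_cmult using s0 t0 by simp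
    finally show ?thesis
      unfolding Ee Pq by simp
  qed
  have "(\<lambda>x. 4 * alt_sum (\<lambda>\<sigma>. pd (\<sigma> 1) (g \<sigma>) x)) absolutely_integrable_on U"
    by (intro set_integrable_mult_right integral_alt_sum(1) ai)
  then show "(\<lambda>x. 2 * E x + R x * P x) absolutely_integrable_on U"
    by (rule absolutely_integrable_spike[where S = "{}"]) (simp_all add: eq)
  have "integral U (\<lambda>x. 2 * E x + R x * P x) = integral U (\<lambda>x. 4 * alt_sum (\<lambda>\<sigma>. pd (\<sigma> 1) (g \<sigma>) x))"
    by (rule integral_cong) (rule eq)
  also have "\<dots> = 0"
    using integral_alt_sum(2)[where g = "\<lambda>\<sigma> x. pd (\<sigma> 1) (g \<sigma>) x", OF ai] by (simp add: int0 alt_sum_def)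
  finally show "integral U (\<lambda>x. 2 * E x + R x * P x) = 0" .
qed

section \<open>Partitions of unity and change of charts\<close>

lemma multilin_1_1_2_3:
  fixes g a :: "real ^ 7 \<Rightarrow> real"
  assumes "linear g" "linear a" "\<And>v. linear (\<lambda>u. b u v)" "\<And>v. linear (\<lambda>u. b v u)"
    "\<And>v w. linear (\<lambda>u. f u v w)" "\<And>v w. linear (\<lambda>u. f v u w)" "\<And>v w. linear (\<lambda>u. f v w u)"
  shows "multilin (\<lambda>v. g (v 1) * a (v 2) * b (v 3) (v 4) * f (v 5) (v 6) (v 7))"
  unfolding multilin_def
proof (intro allI)
  fix v :: "7 \<Rightarrow> real ^ 7" and i :: 7
  show "linear (\<lambda>u. g ((v(i := u)) 1) * a ((v(i := u)) 2) * b ((v(i := u)) 3) ((v(i := u)) 4) *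
      f ((v(i := u)) 5) ((v(i := u)) 6) ((v(i := u)) 7))"
    using exhaust_7[of i] assms by (elim disjE) (simp_all add: linear_iff algebra_simps)
qed

lemma multilin_2_2_3:
  fixes b :: "real ^ 7 \<Rightarrow> real ^ 7 \<Rightarrow> real"
  assumes "\<And>v. linear (\<lambda>u. b u v)" "\<And>v. linear (\<lambda>u. b v u)"
    "\<And>v w. linear (\<lambda>u. f u v w)" "\<And>v w. linear (\<lambda>u. f v u w)" "\<And>v w. linear (\<lambda>u. f v w u)"
  shows "multilin (\<lambda>v. b (v 1) (v 2) * b (v 3) (v 4) * f (v 5) (v 6) (v 7))"
  unfolding multilin_def
proof (intro allI)
  fix v :: "7 \<Rightarrow> real ^ 7" and i :: 7
  show "linear (\<lambda>u. b ((v(i := u)) 1) ((v(i := u)) 2) * b ((v(i := u)) 3) ((v(i := u)) 4) *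
      f ((v(i := u)) 5) ((v(i := u)) 6) ((v(i := u)) 7))"
    using exhaust_7[of i] assms by (elim disjE) (simp_all add: linear_iff algebra_simps)
qed

lemma linear_phi0:
  shows "linear (\<lambda>u. phi0 u v w)" "linear (\<lambda>u. phi0 v u w)" "linear (\<lambda>u. phi0 v w u)"
  unfolding linear_iff phi0_def dx3_def det_3 vector_3 vector_add_component vector_scaleR_component
  by (simp_all add: algebra_simps)

text \<open>\<open>A\<close> stands for the passage from chart coordinates to a frame in which the
  3-form is \<open>phi0\<close>. The squared norm is nonnegative for every \<open>A\<close>, so the
  sign of a nonzero value is that of the determinant.\<close>

lemma alt_sum_pullback_phi0:
  fixes A :: "real ^ 7 \<Rightarrow> real ^ 7"
  assumes "linear A"
  shows "alt_sum (\<lambda>\<sigma>. phi0 (A x) (A (axis (\<sigma> 1) 1)) (A (axis (\<sigma> 2) 1)) *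
      phi0 (A x) (A (axis (\<sigma> 3) 1)) (A (axis (\<sigma> 4) 1)) *
      phi0 (A (axis (\<sigma> 5) 1)) (A (axis (\<sigma> 6) 1)) (A (axis (\<sigma> 7) 1))) =
    det (matrix A) * (144 * (A x \<bullet> A x))"
  using alt_sum_linear_image[OF multilin_2_2_3[of "phi0 (A x)" phi0] assms] linear_phi0
  by (simp add: alt_sum_phi0_sq_phi0)

section \<open>Finite partitions of unity\<close>

context smooth_mfd
begin

lemma openin_chart_inv_image:
  assumes c: "c \<in> Atlas M" and V: "open V" "V \<subseteq> chart_image c"
  shows "openin (Top M) (chart_inv c ` V)"
proof -
  let ?N = "chart_inv c ` V"
  have N: "?N \<subseteq> fst c"
    using V(2) by (intro image_subsetI chart_inv_in) (rule subsetD)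
  have "snd c ` ?N = (\<lambda>x. x) ` V"
    unfolding image_image by (rule image_cong[OF refl], rule chart_chart_inv) (rule subsetD[OF V(2)])
  then have "snd c ` ?N = V"
    by (simp only: image_ident)
  moreover have "openin (top_of_set (chart_image c)) V"
    using V chart_image_open[OF c] by (simp add: openin_open_eq)
  ultimately have "openin (subtopology (Top M) (fst c)) ?N"
    using homeomorphic_map_openness_eq[OF chart_homeo[OF c], of ?N] N topspace_chart[OF c]
      order_trans[OF N chart_subset_points[OF c]] by simp
  then show ?thesis
    by (rule openin_trans_full) (rule chart_open[OF c])
qed

lemma C1_fun_sum: "finite I \<Longrightarrow> (\<And>i. i \<in> I \<Longrightarrow> C1_fun (h i)) \<Longrightarrow> C1_fun (\<lambda>p. \<Sum>i\<in>I. h i p)"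
  unfolding C1_fun_def by (intro ballI C1_on_sum) (assumption, blast)

lemma C1_fun_mult: "C1_fun g \<Longrightarrow> C1_fun h \<Longrightarrow> C1_fun (\<lambda>p. g p * h p)"
  unfolding C1_fun_def by (intro ballI C1_on_mult) blast+

lemma C1_fun_inverse:
  assumes "C1_fun h" "\<And>p. p \<in> points M \<Longrightarrow> h p \<noteq> 0"
  shows "C1_fun (\<lambda>p. inverse (h p))"
  unfolding C1_fun_def
proof
  fix c assume c: "c \<in> Atlas M"
  show "C1_on (\<lambda>x. inverse (h (chart_inv c x))) (chart_image c)"
  proof (rule C1_on_inverse)
    show "C1_on (\<lambda>x. h (chart_inv c x)) (chart_image c)"
      using assms(1) c unfolding C1_fun_def by (rule bspec)
    show "h (chart_inv c x) \<noteq> 0" if "x \<in> chart_image c" for x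
      by (intro assms(2) subsetD[OF chart_subset_points[OF c]] chart_inv_in that)
  qed
qed

text \<open>Compactness gives finitely many open coordinate balls covering the manifold. Their bumps
  are positive on these balls, so the sum can be divided out. The parameter \<open>G\<close> hands a
  further property of the closed balls on to the supports; it will be constancy of the orientation
  sign.\<close>

lemma partition_of_unity:
  assumes compact: "compact_space (Top M)"
    and good: "\<And>p. p \<in> points M \<Longrightarrow> \<exists>c r. c \<in> Atlas M \<and> p \<in> fst c \<and> 0 < r \<and>
      cball (snd c p) r \<subseteq> chart_image c \<and> G c (cball (snd c p) r)"
  obtains I :: "'a set" and c K \<rho> where "finite I"
    "\<And>i. i \<in> I \<Longrightarrow> c i \<in> Atlas M" "\<And>i. i \<in> I \<Longrightarrow> compact (K i)"
    "\<And>i. i \<in> I \<Longrightarrow> K i \<subseteq> chart_image (c i)" "\<And>i. i \<in> I \<Longrightarrow> G (c i) (K i)"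
    "\<And>i. i \<in> I \<Longrightarrow> C1_fun (\<rho> i)" "\<And>i p. p \<in> points M \<Longrightarrow> 0 \<le> \<rho> i p"
    "\<And>i p. p \<notin> fst (c i) \<Longrightarrow> \<rho> i p = 0"
    "\<And>i x. i \<in> I \<Longrightarrow> x \<in> chart_image (c i) - K i \<Longrightarrow> \<rho> i (chart_inv (c i) x) = 0"
    "\<And>p. p \<in> points M \<Longrightarrow> (\<Sum>i\<in>I. \<rho> i p) = 1"
proof -
  from good obtain c r where cr: "\<And>p. p \<in> points M \<Longrightarrow> c p \<in> Atlas M \<and> p \<in> fst (c p) \<and> 0 < r p \<and>
      cball (snd (c p) p) (r p) \<subseteq> chart_image (c p) \<and> G (c p) (cball (snd (c p) p) (r p))"
    by metis
  define N where "N p = chart_inv (c p) ` ball (snd (c p) p) (r p)" for p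
  have N_open: "openin (Top M) (N p)" if "p \<in> points M" for p
    unfolding N_def
    using cr[OF that] by (intro openin_chart_inv_image open_ball order_trans[OF ball_subset_cball]) (simp_all only:)
  have N_self: "p \<in> N p" if "p \<in> points M" for p
    unfolding N_def using cr[OF that] by (intro image_eqI[where x = "snd (c p) p"]) simp_all
  have "\<exists>\<F>. finite \<F> \<and> \<F> \<subseteq> N ` points M \<and> points M \<subseteq> \<Union>\<F>"
    by (rule compactinD[OF compact[unfolded compact_space_def]]) (use N_open N_self in blast)+
  then obtain I where I: "I \<subseteq> points M" "finite I" "points M \<subseteq> (\<Union>i\<in>I. N i)"
    by (metis finite_subset_image)
  define h where "h i = chart_bump (c i) (snd (c i) i) (r i)" for i
  have h_C1: "C1_fun (h i)" if "i \<in> I" for i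
    unfolding h_def by (rule C1_fun_chart_bump) (use cr[OF subsetD[OF I(1) that]] in blast)+
  have h_nonneg: "0 \<le> h i p" for i p
    by (simp add: h_def chart_bump_def bump_nonneg)
  define S where "S p = (\<Sum>i\<in>I. h i p)" for p
  have S_pos: "0 < S p" if p: "p \<in> points M" for p
  proof -
    obtain i where i: "i \<in> I" "p \<in> N i"
      using I(3) p by blast
    then obtain y where y: "p = chart_inv (c i) y" "dist (snd (c i) i) y < r i"
      unfolding N_def by auto
    note ci = cr[OF subsetD[OF I(1) i(1)]]
    have "y \<in> chart_image (c i)"
      using ci y(2) by (meson mem_cball less_imp_le subsetD)
    then have "0 < h i p"
      using ci y unfolding h_def chart_bump_def
      by (simp add: chart_inv_in bump_pos_iff dist_commute)
    then show ?thesis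
      unfolding S_def using i(1) I(2) h_nonneg by (intro sum_pos2[of I i]) auto
  qed
  define \<rho> where "\<rho> i p = h i p * inverse (S p)" for i p
  show ?thesis
  proof (rule that[where I = I and c = c and \<rho> = \<rho> and K = "\<lambda>i. cball (snd (c i) i) (r i)"])
    show "C1_fun (\<rho> i)" if "i \<in> I" for i
      unfolding \<rho>_def S_def
      by (intro C1_fun_mult h_C1 C1_fun_inverse C1_fun_sum that I(2))
        (use S_pos in \<open>simp_all add: S_def less_imp_neq[symmetric]\<close>)
    show "0 \<le> \<rho> i p" if "p \<in> points M" for i p
      unfolding \<rho>_def using h_nonneg[of i p] S_pos[OF that] by simp
    show "\<rho> i p = 0" if "p \<notin> fst (c i)" for i p
      using that by (simp add: \<rho>_def h_def chart_bump_def)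
    show "\<rho> i (chart_inv (c i) x) = 0"
      if i: "i \<in> I" and x: "x \<in> chart_image (c i) - cball (snd (c i) i) (r i)" for i x
    proof -
      have "bump (snd (c i) i) (r i) (snd (c i) (chart_inv (c i) x)) = 0"
        using x cr[OF subsetD[OF I(1) i]] by (simp add: bump_eq_0_iff dist_commute)
      then show ?thesis
        by (simp add: \<rho>_def h_def chart_bump_def)
    qed
    show "(\<Sum>i\<in>I. \<rho> i p) = 1" if "p \<in> points M" for p
    proof -
      have "(\<Sum>i\<in>I. \<rho> i p) = S p * inverse (S p)"
        unfolding \<rho>_def S_def by (rule sum_distrib_right[symmetric])
      then show ?thesis
        using S_pos[OF that] by simp
    qed
  qed (use I(2) cr[OF subsetD[OF I(1)]] in simp_all)
qed

text \<open>A zero of a nonnegative function is a minimum. The derivative thus vanishes at every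
  zero, also at those on the boundary of the zero set.\<close>

lemma C1_fun_derivative_eq_0:
  assumes h: "C1_fun h" "\<And>p. p \<in> points M \<Longrightarrow> 0 \<le> h p"
    and c: "c \<in> Atlas M" "x \<in> chart_image c" and 0: "h (chart_inv c x) = 0"
  shows "frechet_derivative (\<lambda>x. h (chart_inv c x)) (at x) v = 0"
proof -
  let ?g = "\<lambda>x. h (chart_inv c x)"
  have "C1_on ?g (chart_image c)"
    using h(1) c(1) unfolding C1_fun_def by (rule bspec)
  then have "(?g has_derivative frechet_derivative ?g (at x)) (at x)"
    using c(2) by (rule C1_on_has_derivative)
  moreover have "?g x \<le> ?g y" if "y \<in> chart_image c" for y
    unfolding 0 by (intro h(2) subsetD[OF chart_subset_points[OF c(1)]] chart_inv_in that)
  ultimately have "frechet_derivative ?g (at x) = (\<lambda>v. 0)"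
    using differential_zero_maxmin[OF c(2) chart_image_open[OF c(1)]] by blast
  then show ?thesis by simp
qed

end

section \<open>Transport of integrals between charts\<close>

lemma
  fixes f :: "'a::euclidean_space \<Rightarrow> real"
  assumes "V \<subseteq> U" "\<And>x. x \<in> U - V \<Longrightarrow> f x = 0"
  shows absolutely_integrable_on_support: "f absolutely_integrable_on U \<longleftrightarrow> f absolutely_integrable_on V"
    and integral_support: "integral U f = integral V f"
proof -
  have "negligible {x \<in> U - V. f x \<noteq> 0}" "negligible {x \<in> V - U. f x \<noteq> 0}"
    using assms by (auto intro!: negligible_subset[OF negligible_empty])
  then show "f absolutely_integrable_on U \<longleftrightarrow> f absolutely_integrable_on V" "integral U f = integral V f"
    by (auto intro: absolutely_integrable_spike_set integral_spike_set)
qed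

context
  fixes M :: "('a, 'n::{finite,wellorder}) manifold"
  assumes M: "smooth_manifold M"
begin

interpretation smooth_mfd M
  by standard (rule M)

text \<open>\<open>G\<close> is a density given by its coefficient in each of the two charts. Since
  it vanishes off the overlap, both integrals reduce to the overlap, where the rule
  \<open>change\<close> is exactly the change of variables formula.\<close>

lemma integral_chart_change:
  assumes cd: "c \<in> Atlas M" "d \<in> Atlas M"
    and change: "\<And>p. p \<in> fst c \<Longrightarrow> p \<in> fst d \<Longrightarrow>
      G c (snd c p) = \<bar>det (matrix (jacobian c d (snd c p)))\<bar> * G d (snd d p)"
    and zero: "\<And>x. x \<in> chart_image c - overlap c d \<Longrightarrow> G c x = 0"
      "\<And>x. x \<in> chart_image d - overlap d c \<Longrightarrow> G d x = 0"
    and int: "G c absolutely_integrable_on chart_image c"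
  shows "G d absolutely_integrable_on chart_image d \<and> integral (chart_image c) (G c) = integral (chart_image d) (G d)"
proof -
  let ?\<tau> = "transition c d"
  let ?S = "overlap c d"
  have img: "?\<tau> ` ?S = overlap d c"
    unfolding image_image by (auto simp: transition_chart[OF cd(1)] image_iff intro: bexI)
  have inj: "inj_on ?\<tau> ?S"
  proof (rule inj_onI)
    fix x y assume "x \<in> ?S" "y \<in> ?S" and eq: "?\<tau> x = ?\<tau> y"
    then obtain p q where p: "x = snd c p" "p \<in> fst c" "p \<in> fst d" and q: "y = snd c q" "q \<in> fst c" "q \<in> fst d"
      by blast
    then have "p = q"
      using eq inj_onD[OF chart_inj[OF cd(2)]] by (simp add: transition_chart[OF cd(1)])
    then show "x = y" using p q by simp
  qed
  have der: "(?\<tau> has_derivative jacobian c d x) (at x within ?S)" if x: "x \<in> ?S" for x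
  proof -
    obtain p where p: "x = snd c p" "p \<in> fst c" "p \<in> fst d"
      using x by blast
    show ?thesis
      unfolding p(1) by (rule has_derivative_at_withinI[OF has_derivative_transition[OF cd p(2,3)]])
  qed
  have Gc: "G c x = \<bar>det (matrix (jacobian c d x))\<bar> * G d (?\<tau> x)" if x: "x \<in> ?S" for x
  proof -
    obtain p where p: "x = snd c p" "p \<in> fst c" "p \<in> fst d"
      using x by blast
    show ?thesis
      unfolding p(1) change[OF p(2,3)] transition_chart[OF cd(1) p(2)] ..
  qed
  have sub: "overlap c d \<subseteq> chart_image c" "overlap d c \<subseteq> chart_image d"
    by blast+
  have supp_c: "G c absolutely_integrable_on chart_image c \<longleftrightarrow> G c absolutely_integrable_on ?S"
      "integral (chart_image c) (G c) = integral ?S (G c)"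
    by (rule absolutely_integrable_on_support[OF sub(1)] integral_support[OF sub(1)], erule zero(1))+
  have supp_d: "G d absolutely_integrable_on chart_image d \<longleftrightarrow> G d absolutely_integrable_on overlap d c"
      "integral (chart_image d) (G d) = integral (overlap d c) (G d)"
    by (rule absolutely_integrable_on_support[OF sub(2)] integral_support[OF sub(2)], erule zero(2))+
  have S: "?S \<in> sets lebesgue"
    using overlap_open[OF cd] by simp
  \<comment> \<open>The change of variables theorem concerns vector-valued integrands; the scalar
    one is written as a vector in dimension one.\<close>
  have "(\<lambda>x. \<bar>det (matrix (jacobian c d x))\<bar> *\<^sub>R vec (G d (?\<tau> x)) :: real ^ 1) absolutely_integrable_on ?S \<and>
      integral ?S (\<lambda>x. \<bar>det (matrix (jacobian c d x))\<bar> *\<^sub>R vec (G d (?\<tau> x))) = (vec b :: real ^ 1) \<longleftrightarrow>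
    (\<lambda>x. vec (G d x) :: real ^ 1) absolutely_integrable_on (?\<tau> ` ?S) \<and>
      integral (?\<tau> ` ?S) (\<lambda>x. vec (G d x)) = (vec b :: real ^ 1)" for b
    by (rule has_absolute_integral_change_of_variables[OF S der inj])
  then have cov: "(\<lambda>x. \<bar>det (matrix (jacobian c d x))\<bar> * G d (?\<tau> x)) absolutely_integrable_on ?S \<and>
      integral ?S (\<lambda>x. \<bar>det (matrix (jacobian c d x))\<bar> * G d (?\<tau> x)) = b \<longleftrightarrow>
    G d absolutely_integrable_on overlap d c \<and> integral (overlap d c) (G d) = b" for b
    unfolding img by (simp add: absolutely_integrable_on_1_iff integral_on_1_eq)
  have "G c absolutely_integrable_on ?S"
    using int unfolding supp_c(1) .
  then have "(\<lambda>x. \<bar>det (matrix (jacobian c d x))\<bar> * G d (?\<tau> x)) absolutely_integrable_on ?S"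
    by (rule absolutely_integrable_spike[where S = "{}"]) (simp_all add: Gc)
  moreover have "integral ?S (\<lambda>x. \<bar>det (matrix (jacobian c d x))\<bar> * G d (?\<tau> x)) = integral ?S (G c)"
    by (rule integral_cong) (rule Gc[symmetric])
  ultimately have "G d absolutely_integrable_on overlap d c \<and> integral (overlap d c) (G d) = integral ?S (G c)"
    using cov[of "integral ?S (G c)"] by (simp only: simp_thms)
  then show ?thesis
    unfolding supp_c(2) supp_d by simp
qed

end

section \<open>Rochesterian fields on a closed manifold\<close>

lemma integral_nonneg_eq_0_imp_0:
  fixes g :: "'a::euclidean_space \<Rightarrow> real"
  assumes "open U" "continuous_on U g" "\<And>x. x \<in> U \<Longrightarrow> 0 \<le> g x" "g integrable_on U" "integral U g = 0" "x \<in> U"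
  shows "g x = 0"
proof -
  obtain a b where ab: "x \<in> box a b" "cbox a b \<subseteq> U"
    using assms(1,6) by (meson open_contains_cbox)
  have cont: "continuous_on (cbox a b) g"
    using assms(2) ab(2) by (rule continuous_on_subset)
  have "integral (cbox a b) g \<le> integral U g"
    using ab(2) assms(3,4) integrable_continuous[OF cont] by (intro integral_subset_le) auto
  moreover have "0 \<le> integral (cbox a b) g"
    using ab(2) assms(3) integrable_continuous[OF cont] by (intro integral_nonneg) auto
  ultimately have "(g has_integral 0) (cbox a b)"
    using assms(5) integrable_continuous[OF cont] by (simp add: has_integral_integral)
  moreover have "0 \<le> g y" if "y \<in> cbox a b" for y
    using assms(3) ab(2) that by blast
  ultimately show ?thesis
    using has_integral_0_cbox_imp_0[OF cont, of x] ab(1) box_subset_cbox by blast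
qed

text \<open>\<open>inv L\<close> is meaningful only on the range of \<open>L\<close>, the tangent
  space. As \<open>L'\<close> takes its values there, the composition is a genuine automorphism of
  Euclidean space; its linearity comes from that of both frames in every chart component.\<close>

lemma frames_matrix:
  fixes M :: "('a, 'n::finite) manifold"
  assumes L: "L \<in> frames M p" and L': "L' \<in> frames M p"
  shows "L (inv L (L' u)) = L' u" "linear (inv L \<circ> L')" "det (matrix (inv L \<circ> L')) \<noteq> 0"
proof -
  have bij: "bij_betw L UNIV (tangent_space M p)" "bij_betw L' UNIV (tangent_space M p)"
    and lin: "\<And>c. linear (\<lambda>w. L w c)" "\<And>c. linear (\<lambda>w. L' w c)"
    using L L' by (simp_all add: frames_def del: split_paired_All)
  have inj: "inj L" "inj L'"
    using bij by (simp_all add: bij_betw_def)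
  show LL: "L (inv L (L' u)) = L' u" for u
  proof (rule f_inv_into_f)
    show "L' u \<in> range L"
      using bij unfolding bij_betw_def by blast
  qed
  show lin': "linear (inv L \<circ> L')"
  proof (rule linearI)
    fix u v and a :: real
    have "L (inv L (L' u) + inv L (L' v)) = L' (u + v)"
      by (rule ext) (simp add: linear_add[OF lin(1)] linear_add[OF lin(2)] LL)
    from inv_f_eq[OF inj(1) this] show "(inv L \<circ> L') (u + v) = (inv L \<circ> L') u + (inv L \<circ> L') v"
      by simp
    have "L (a *\<^sub>R inv L (L' u)) = L' (a *\<^sub>R u)"
      by (rule ext) (simp add: linear_scale[OF lin(1)] linear_scale[OF lin(2)] LL)
    from inv_f_eq[OF inj(1) this] show "(inv L \<circ> L') (a *\<^sub>R u) = a *\<^sub>R (inv L \<circ> L') u"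
      by simp
  qed
  have "inj (inv L \<circ> L')"
    by (rule injI) (metis LL comp_apply inj(2) injD)
  then show "det (matrix (inv L \<circ> L')) \<noteq> 0"
    using det_nz_iff_inj[OF lin'] by simp
qed

lemma form_eqD:
  "form_eq M k \<omega> \<eta> \<Longrightarrow> p \<in> points M \<Longrightarrow> vs \<in> arg_lists M k p \<Longrightarrow> \<omega> p vs = \<eta> p vs"
  by (simp add: form_eq_def)

section \<open>Coordinate expressions for a Rochesterian field\<close>

locale rochesterian = smooth_mfd M for M :: "('a, 7) manifold" +
  fixes \<phi> :: "('a, 7) form" and X :: "('a, 7) vfield" and \<alpha> :: "('a, 7) form"
  assumes compact: "compact_space (Top M)" and G2: "closed_G2_structure M \<phi>"
    and X: "vector_field M X" and \<alpha>: "diff_form M 1 \<alpha>"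
    and contraction_exact: "form_eq M 2 (contraction X \<phi>) (ext_deriv M \<alpha>)"
begin

lemma \<phi>: "diff_form M 3 \<phi>"
  using G2 by (simp add: closed_G2_structure_def G2_structure_def)

lemma X_tangent: "p \<in> points M \<Longrightarrow> X p \<in> tangent_space M p"
  using X by (simp add: vector_field_def)

definition acoef :: "('a, 7) chart \<Rightarrow> 7 \<Rightarrow> real ^ 7 \<Rightarrow> real" where
  "acoef c k = local_form M \<alpha> c [axis k 1]"

definition fcoef :: "('a, 7) chart \<Rightarrow> 7 \<Rightarrow> 7 \<Rightarrow> 7 \<Rightarrow> real ^ 7 \<Rightarrow> real" where
  "fcoef c i j k = local_form M \<phi> c [axis i 1, axis j 1, axis k 1]"

definition beta :: "('a, 7) chart \<Rightarrow> real ^ 7 \<Rightarrow> real ^ 7 \<Rightarrow> real ^ 7 \<Rightarrow> real" where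
  "beta c x u v = local_form M \<phi> c [X (chart_inv c x) c, u, v] x"

definition bcoef :: "('a, 7) chart \<Rightarrow> 7 \<Rightarrow> 7 \<Rightarrow> real ^ 7 \<Rightarrow> real" where
  "bcoef c k l x = beta c x (axis k 1) (axis l 1)"

text \<open>The coefficients of \<open>12 dh \<and> \<alpha> \<and> \<beta> \<and> \<phi>\<close> and \<open>24 \<beta> \<and> \<beta> \<and> \<phi>\<close> in the chart \<open>c\<close>,
  where \<open>\<beta> = X \<lrcorner> \<phi> = d\<alpha>\<close>.\<close>

definition boundary :: "('a \<Rightarrow> real) \<Rightarrow> ('a, 7) chart \<Rightarrow> real ^ 7 \<Rightarrow> real" where
  "boundary h c x = alt_sum (\<lambda>\<sigma>. pd (\<sigma> 1) (\<lambda>y. h (chart_inv c y)) x * acoef c (\<sigma> 2) x *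
     bcoef c (\<sigma> 3) (\<sigma> 4) x * fcoef c (\<sigma> 5) (\<sigma> 6) (\<sigma> 7) x)"

definition energy :: "('a, 7) chart \<Rightarrow> real ^ 7 \<Rightarrow> real" where
  "energy c x = alt_sum (\<lambda>\<sigma>. bcoef c (\<sigma> 1) (\<sigma> 2) x * bcoef c (\<sigma> 3) (\<sigma> 4) x *
     fcoef c (\<sigma> 5) (\<sigma> 6) (\<sigma> 7) x)"

text \<open>\<open>beta\<close> is built from \<open>X\<close> and \<open>\<phi>\<close>, so that it
  can be compared pointwise with \<open>phi0\<close>. Its identification with d\<alpha>, needed for
  Stokes, is where \<open>contraction_exact\<close> enters.\<close>

lemma beta_eq_d1:
  assumes c: "c \<in> Atlas M" and x: "x \<in> chart_image c"
  shows "beta c x u v = d1 \<alpha> c x u v"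
proof -
  let ?p = "chart_inv c x"
  have p: "?p \<in> fst c" by (rule chart_inv_in[OF x])
  have pM: "?p \<in> points M" by (rule subsetD[OF chart_subset_points[OF c] p])
  have "[coord_vec M c ?p u, coord_vec M c ?p v] \<in> arg_lists M 2 ?p"
    using coord_vec_in_tangent_space[OF c p] by (simp add: arg_lists_def)
  then have "contraction X \<phi> ?p [coord_vec M c ?p u, coord_vec M c ?p v] =
      ext_deriv M \<alpha> ?p [coord_vec M c ?p u, coord_vec M c ?p v]"
    by (rule form_eqD[OF contraction_exact pM])
  then have "\<phi> ?p [coord_vec M c ?p (X ?p c), coord_vec M c ?p u, coord_vec M c ?p v] = d1 \<alpha> c x u v"
    unfolding ext_deriv_1_form[OF \<alpha> c p] contraction_def chart_chart_inv[OF x]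
      tangent_space_eq_coord_vec[OF c p X_tangent[OF pM], symmetric] .
  then show ?thesis
    by (simp add: beta_def local_form_def)
qed

lemma d3_eq_0:
  assumes c: "c \<in> Atlas M" and x: "x \<in> chart_image c"
  shows "d3 \<phi> c x t u v w = 0"
proof -
  let ?p = "chart_inv c x"
  let ?vs = "[coord_vec M c ?p t, coord_vec M c ?p u, coord_vec M c ?p v, coord_vec M c ?p w]"
  have p: "?p \<in> fst c" by (rule chart_inv_in[OF x])
  have pM: "?p \<in> points M" by (rule subsetD[OF chart_subset_points[OF c] p])
  have vs: "?vs \<in> arg_lists M 4 ?p"
    using coord_vec_in_tangent_space[OF c p] by (simp add: arg_lists_def)
  have "form_eq M 4 (ext_deriv M \<phi>) zero_form"
    using G2 by (simp add: closed_G2_structure_def)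
  from form_eqD[OF this pM vs] have "ext_deriv M \<phi> ?p ?vs = zero_form ?p ?vs" .
  then show ?thesis
    unfolding ext_deriv_3_form[OF \<phi> c p] chart_chart_inv[OF x] by (simp add: zero_form_def)
qed

lemma acoef_Ck: "c \<in> Atlas M \<Longrightarrow> Ck_on n (acoef c k) (chart_image c)"
  unfolding acoef_def by (rule local_form_Ck[OF \<alpha>]) simp_all

lemma fcoef_Ck: "c \<in> Atlas M \<Longrightarrow> Ck_on n (fcoef c i j k) (chart_image c)"
  unfolding fcoef_def by (rule local_form_Ck[OF \<phi>]) simp_all

lemma bcoef_eq:
  "c \<in> Atlas M \<Longrightarrow> x \<in> chart_image c \<Longrightarrow> bcoef c k l x = pd k (acoef c l) x - pd l (acoef c k) x"
  unfolding bcoef_def acoef_def by (simp only: beta_eq_d1 d1_def)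

lemma continuous_on_bcoef:
  assumes c: "c \<in> Atlas M"
  shows "continuous_on (chart_image c) (bcoef c k l)"
proof -
  have "continuous_on (chart_image c) (\<lambda>x. pd k (acoef c l) x - pd l (acoef c k) x)"
    by (intro continuous_on_diff C1_on_continuous_derivative acoef_Ck c)
  then show ?thesis
    by (rule continuous_on_eq) (simp only: bcoef_eq[OF c])
qed

lemma continuous_on_alt_sum:
  "(\<And>\<sigma>. continuous_on S (g \<sigma>)) \<Longrightarrow> continuous_on S (\<lambda>x. alt_sum (\<lambda>\<sigma>. g \<sigma> x))"
  unfolding alt_sum_def by (intro continuous_on_sum continuous_on_mult continuous_on_const) blast

lemma C1_funD: "C1_fun h \<Longrightarrow> c \<in> Atlas M \<Longrightarrow> C1_on (\<lambda>x. h (chart_inv c x)) (chart_image c)"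
  unfolding C1_fun_def by (rule bspec)

lemma continuous_on_energy: "c \<in> Atlas M \<Longrightarrow> continuous_on (chart_image c) (energy c)"
  unfolding energy_def[abs_def]
  by (intro continuous_on_alt_sum continuous_on_mult continuous_on_bcoef C1_on_imp_continuous_on[OF fcoef_Ck])

lemma continuous_on_boundary:
  "C1_fun h \<Longrightarrow> c \<in> Atlas M \<Longrightarrow> continuous_on (chart_image c) (boundary h c)"
  unfolding boundary_def[abs_def]
  by (intro continuous_on_alt_sum continuous_on_mult continuous_on_bcoef
      C1_on_continuous_derivative C1_on_imp_continuous_on[OF fcoef_Ck] C1_on_imp_continuous_on[OF acoef_Ck] C1_funD)

lemma boundary_eq_0:
  assumes "C1_fun h" "\<And>p. p \<in> points M \<Longrightarrow> 0 \<le> h p" "c \<in> Atlas M" "x \<in> chart_image c" "h (chart_inv c x) = 0"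
  shows "boundary h c x = 0"
proof -
  have "frechet_derivative (\<lambda>x. h (chart_inv c x)) (at x) v = 0" for v
    using assms by (rule C1_fun_derivative_eq_0)
  then show ?thesis
    by (simp add: boundary_def alt_sum_def)
qed

text \<open>A coefficient of a 7-form changes by the determinant itself, not by its absolute value;
  the missing sign has to come from the orientation.\<close>

lemma boundary_transition:
  assumes h: "C1_fun h" and cd: "c \<in> Atlas M" "d \<in> Atlas M" and p: "p \<in> fst c" "p \<in> fst d"
  shows "boundary h c (snd c p) = det (matrix (jacobian c d (snd c p))) * boundary h d (snd d p)"
proof -
  let ?x = "snd c p" and ?y = "snd d p"
  let ?J = "jacobian c d ?x"
  have x: "?x \<in> overlap c d" and y: "?y \<in> chart_image d"
    using p by blast+
  have pM: "p \<in> points M" by (rule subsetD[OF chart_subset_points[OF cd(1)] p(1)])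
  have tr: "transition c d ?x = ?y"
    by (rule transition_chart[OF cd(1) p(1)])
  let ?hc = "\<lambda>x. h (chart_inv c x)" and ?hd = "\<lambda>x. h (chart_inv d x)"
  have hd: "(?hd has_derivative frechet_derivative ?hd (at ?y)) (at ?y)"
    by (rule C1_on_has_derivative[OF C1_funD[OF h cd(2)] y])
  have "((\<lambda>x. ?hd (transition c d x)) has_derivative (\<lambda>w. frechet_derivative ?hd (at ?y) (?J w))) (at ?x)"
    by (rule has_derivative_compose[OF has_derivative_transition[OF cd p]]) (simp only: tr hd)
  then have "(?hc has_derivative (\<lambda>w. frechet_derivative ?hd (at ?y) (?J w))) (at ?x)"
  proof (rule has_derivative_transform_within_open[OF _ overlap_open[OF cd] x])
    fix x' assume "x' \<in> overlap c d"
    then obtain q where q: "x' = snd c q" "q \<in> fst c" "q \<in> fst d" by blast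
    show "?hd (transition c d x') = ?hc x'"
      unfolding q(1) transition_chart[OF cd(1) q(2)] chart_inv_chart[OF cd(1) q(2)] chart_inv_chart[OF cd(2) q(3)] ..
  qed
  note hc = fun_cong[OF frechet_derivative_at[OF this], symmetric]
  have Xd: "X p d = ?J (X p c)"
    using coord_vec_apply[OF cd(2) p(2), of c "X p c"]
    unfolding tangent_space_eq_coord_vec[OF cd(1) p(1) X_tangent[OF pM], symmetric] .
  let ?T = "\<lambda>v. frechet_derivative ?hd (at ?y) (v 1) * local_form M \<alpha> d [v 2] ?y * beta d ?y (v 3) (v 4) *
      local_form M \<phi> d [v 5, v 6, v 7] ?y"
  have "multilin ?T"
    unfolding beta_def
    by (intro multilin_1_1_2_3[where b = "\<lambda>u v. local_form M \<phi> d [X (chart_inv d ?y) d, u, v] ?y"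
          and f = "\<lambda>u v w. local_form M \<phi> d [u, v, w] ?y"]
        has_derivative_linear[OF hd] linear_local_1_form[OF \<alpha> cd(2) y] linear_local_3_form[OF \<phi> cd(2) y])
  from alt_sum_linear_image[OF this linear_jacobian[OF cd p]] show ?thesis
    unfolding boundary_def acoef_def bcoef_def fcoef_def beta_def hc
      local_form_transition[OF cd x] tr chart_inv_chart[OF cd(1) p(1)] chart_inv_chart[OF cd(2) p(2)] Xd
    by simp
qed

lemma chart_stokes:
  assumes c: "c \<in> Atlas M" and K: "compact K" "K \<subseteq> chart_image c" and h: "C1_fun h"
    and supp: "\<And>x. x \<in> chart_image c - K \<Longrightarrow> h (chart_inv c x) = 0"
  shows "(\<lambda>x. 2 * boundary h c x + h (chart_inv c x) * energy c x) absolutely_integrable_on chart_image c"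
    and "integral (chart_image c) (\<lambda>x. 2 * boundary h c x + h (chart_inv c x) * energy c x) = 0"
proof -
  have closed: "pd i (fcoef c j k l) x - pd j (fcoef c i k l) x + pd k (fcoef c i j l) x - pd l (fcoef c i j k) x = 0"
    if "x \<in> chart_image c" for i j k l x
    using d3_eq_0[OF c that, of "axis i 1" "axis j 1" "axis k 1" "axis l 1"]
    unfolding d3_def fcoef_def .
  note * = local_stokes[OF chart_image_open[OF c] K C1_funD[OF h c] supp acoef_Ck[OF c] fcoef_Ck[OF c] closed bcoef_eq[OF c]]
  show "(\<lambda>x. 2 * boundary h c x + h (chart_inv c x) * energy c x) absolutely_integrable_on chart_image c"
    unfolding boundary_def energy_def by (rule *(1))
  show "integral (chart_image c) (\<lambda>x. 2 * boundary h c x + h (chart_inv c x) * energy c x) = 0"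
    unfolding boundary_def energy_def by (rule *(2))
qed

text \<open>\<open>s c p\<close> tells whether the chart \<open>c\<close> preserves or reverses
  orientation at \<open>p\<close>. With \<open>A\<close> leading from chart coordinates to a
  positively oriented frame adapted to \<open>\<phi>\<close>, \<open>energy\<close> is 144 times the
  determinant of \<open>A\<close> times the squared norm of \<open>A (X p c)\<close>, and the sign
  of that determinant is \<open>s c p\<close>. The product of \<open>s\<close> and
  \<open>energy\<close> is thus nonnegative, and positive wherever \<open>X\<close> is
  nonzero.\<close>

lemma orientation_sign:
  obtains s :: "('a, 7) chart \<Rightarrow> 'a \<Rightarrow> real" where
    "\<And>c p. c \<in> Atlas M \<Longrightarrow> p \<in> fst c \<Longrightarrow> 0 \<le> s c p * energy c (snd c p)"
    "\<And>c p. c \<in> Atlas M \<Longrightarrow> p \<in> fst c \<Longrightarrow> X p \<noteq> (\<lambda>c. 0) \<Longrightarrow> 0 < s c p * energy c (snd c p)"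
    "\<And>c d p. c \<in> Atlas M \<Longrightarrow> d \<in> Atlas M \<Longrightarrow> p \<in> fst c \<Longrightarrow> p \<in> fst d \<Longrightarrow>
      s c p = sgn (det (matrix (jacobian c d (snd c p)))) * s d p"
    "\<And>c p. c \<in> Atlas M \<Longrightarrow> p \<in> fst c \<Longrightarrow>
      \<exists>W. openin (Top M) W \<and> p \<in> W \<and> W \<subseteq> fst c \<and> (\<forall>q\<in>W. s c q = s c p)"
proof -
  obtain ori where ori: "orientation M ori"
    and phi: "\<And>p. p \<in> points M \<Longrightarrow> \<exists>L\<in>ori p. \<forall>u v w. \<phi> p [L u, L v, L w] = phi0 u v w"
    using G2 unfolding closed_G2_structure_def G2_structure_def by blast
  \<comment> \<open>The value - 1 is right for every other frame: its determinant relative to a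
    frame in \<open>ori p\<close> is nonzero, hence negative.\<close>
  define s :: "('a, 7) chart \<Rightarrow> 'a \<Rightarrow> real" where "s c p = (if coord_vec M c p \<in> ori p then 1 else - 1)" for c p
  have frame: "\<exists>L. L \<in> frames M p \<and> (\<forall>u v w. \<phi> p [L u, L v, L w] = phi0 u v w) \<and>
      (\<forall>c\<in>Atlas M. p \<in> fst c \<longrightarrow> s c p = sgn (det (matrix (inv L \<circ> coord_vec M c p))))"
    if p: "p \<in> points M" for p
  proof -
    have ori_p: "ori p \<subseteq> frames M p \<and>
        (\<forall>L\<in>ori p. \<forall>L'\<in>frames M p. L' \<in> ori p \<longleftrightarrow> 0 < det (matrix (inv L \<circ> L')))"
      using ori p unfolding orientation_def by blast
    obtain L where L: "L \<in> ori p" "\<forall>u v w. \<phi> p [L u, L v, L w] = phi0 u v w"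
      using phi[OF p] by blast
    have LF: "L \<in> frames M p"
      using ori_p L(1) by blast
    have "s c p = sgn (det (matrix (inv L \<circ> coord_vec M c p)))" if c: "c \<in> Atlas M" "p \<in> fst c" for c
    proof -
      have F: "coord_vec M c p \<in> frames M p"
        by (rule coord_vec_in_frames[OF c])
      then have "coord_vec M c p \<in> ori p \<longleftrightarrow> 0 < det (matrix (inv L \<circ> coord_vec M c p))"
        using ori_p L(1) by blast
      then show ?thesis
        using frames_matrix(3)[OF LF F] by (simp add: s_def sgn_if)
    qed
    then show ?thesis
      using LF L(2) by blast
  qed
  have energy: "\<exists>(y :: real ^ 7) D. s c p * energy c (snd c p) = D * (y \<bullet> y) \<and> 0 < D \<and> (X p \<noteq> (\<lambda>c. 0) \<longrightarrow> y \<noteq> 0)"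
    if c: "c \<in> Atlas M" "p \<in> fst c" for c p
  proof -
    have pM: "p \<in> points M" by (rule subsetD[OF chart_subset_points[OF c(1)] c(2)])
    from frame[OF pM] obtain L where L1: "L \<in> frames M p" and L2: "\<forall>u v w. \<phi> p [L u, L v, L w] = phi0 u v w"
      and L3: "\<forall>c\<in>Atlas M. p \<in> fst c \<longrightarrow> s c p = sgn (det (matrix (inv L \<circ> coord_vec M c p)))"
      by (elim exE conjE)
    have s: "s c p = sgn (det (matrix (inv L \<circ> coord_vec M c p)))"
      by (rule mp[OF bspec[OF L3 c(1)] c(2)])
    note L = L1 L2[rule_format]
    define A where "A = inv L \<circ> coord_vec M c p"
    note A = frames_matrix[OF L(1) coord_vec_in_frames[OF c], folded A_def]
    have LA: "coord_vec M c p u = L (A u)" for u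
      unfolding A_def o_apply by (rule A(1)[symmetric])
    have loc: "local_form M \<phi> c [u, v, w] (snd c p) = phi0 (A u) (A v) (A w)" for u v w
      unfolding local_form_def chart_inv_chart[OF c] list.map LA L(2) ..
    have "energy c (snd c p) = det (matrix A) * (144 * (A (X p c) \<bullet> A (X p c)))"
      unfolding energy_def bcoef_def beta_def fcoef_def loc chart_inv_chart[OF c]
      by (rule alt_sum_pullback_phi0[OF A(2)])
    then have "s c p * energy c (snd c p) = (144 * \<bar>det (matrix A)\<bar>) * (A (X p c) \<bullet> A (X p c))"
      unfolding s A_def[symmetric] by (simp add: abs_sgn mult.commute mult.left_commute)
    moreover have "0 < 144 * \<bar>det (matrix A)\<bar>"
      using A(3) by simp
    moreover have "A (X p c) \<noteq> 0" if "X p \<noteq> (\<lambda>c. 0)"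
    proof
      assume "A (X p c) = 0"
      then have Xpc: "X p c = 0"
        using A(3) det_nz_iff_inj[OF A(2)] linear_injective_0[OF A(2)] by blast
      have "X p = coord_vec M c p 0"
        using tangent_space_eq_coord_vec[OF c X_tangent[OF pM]] unfolding Xpc .
      also have "\<dots> = (\<lambda>c. 0)"
        using linear_0[OF linear_coord_vec[OF c]] by (rule ext)
      finally show False using that by blast
    qed
    ultimately show ?thesis
      by (intro exI[of _ "A (X p c)"] exI[of _ "144 * \<bar>det (matrix A)\<bar>"] conjI impI)
  qed
  show ?thesis
  proof (rule that[of s])
    fix c p assume c: "c \<in> Atlas M" "p \<in> fst c"
    obtain y :: "real ^ 7" and D where y: "s c p * energy c (snd c p) = D * (y \<bullet> y)" "0 < D" "X p \<noteq> (\<lambda>c. 0) \<longrightarrow> y \<noteq> 0"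
      using energy[OF c] by blast
    show "0 \<le> s c p * energy c (snd c p)"
      unfolding y(1) using y(2) by simp
    show "0 < s c p * energy c (snd c p)" if "X p \<noteq> (\<lambda>c. 0)"
      unfolding y(1) using y(2,3) that by simp
    have "\<exists>W. openin (Top M) W \<and> p \<in> W \<and> W \<subseteq> fst c \<and>
        (\<forall>q\<in>W. coord_vec M c q \<in> ori q \<longleftrightarrow> coord_vec M c p \<in> ori p)"
      using ori c unfolding orientation_def by blast
    then show "\<exists>W. openin (Top M) W \<and> p \<in> W \<and> W \<subseteq> fst c \<and> (\<forall>q\<in>W. s c q = s c p)"
      unfolding s_def by metis
  next
    fix c d p assume c: "c \<in> Atlas M" "p \<in> fst c" and d: "d \<in> Atlas M" "p \<in> fst d"
    have pM: "p \<in> points M" by (rule subsetD[OF chart_subset_points[OF c(1)] c(2)])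
    from frame[OF pM] obtain L where L: "L \<in> frames M p"
      and L': "\<forall>c\<in>Atlas M. p \<in> fst c \<longrightarrow> s c p = sgn (det (matrix (inv L \<circ> coord_vec M c p)))"
      by (elim exE conjE)
    note s = mp[OF bspec[OF L' c(1)] c(2)] mp[OF bspec[OF L' d(1)] d(2)]
    have "inv L \<circ> coord_vec M c p = (inv L \<circ> coord_vec M d p) \<circ> jacobian c d (snd c p)"
      by (rule ext) (simp only: o_apply, rule arg_cong[where f = "inv L"], rule coord_vec_change[OF c(1) d(1) c(2) d(2)])
    then have "matrix (inv L \<circ> coord_vec M c p) =
        matrix (inv L \<circ> coord_vec M d p) ** matrix (jacobian c d (snd c p))"
      using matrix_compose[OF linear_jacobian[OF c(1) d(1) c(2) d(2)] frames_matrix(2)[OF L coord_vec_in_frames[OF d]]]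
      by simp
    then show "s c p = sgn (det (matrix (jacobian c d (snd c p)))) * s d p"
      unfolding s by (simp add: det_mul sgn_mult mult.commute)
  qed
qed

text \<open>The sign \<open>s\<close> turns coefficients of 7-forms into densities, whose integrals
  can be compared between charts. \<open>B\<close> and \<open>P\<close> are the signed versions of
  the two terms in \<open>chart_stokes\<close>. If \<open>X\<close> were nonzero at
  \<open>p\<close>, then \<open>P\<close> would be positive there for some member of the
  partition.\<close>

lemma X_eq_0:
  assumes "p \<in> points M"
  shows "X p = (\<lambda>c. 0)"
proof (rule ccontr)
  assume Xp: "X p \<noteq> (\<lambda>c. 0)"
  obtain s :: "('a, 7) chart \<Rightarrow> 'a \<Rightarrow> real" where
    s_nonneg: "\<And>c p. c \<in> Atlas M \<Longrightarrow> p \<in> fst c \<Longrightarrow> 0 \<le> s c p * energy c (snd c p)"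
    and s_pos: "\<And>c p. c \<in> Atlas M \<Longrightarrow> p \<in> fst c \<Longrightarrow> X p \<noteq> (\<lambda>c. 0) \<Longrightarrow> 0 < s c p * energy c (snd c p)"
    and s_change: "\<And>c d p. c \<in> Atlas M \<Longrightarrow> d \<in> Atlas M \<Longrightarrow> p \<in> fst c \<Longrightarrow> p \<in> fst d \<Longrightarrow>
      s c p = sgn (det (matrix (jacobian c d (snd c p)))) * s d p"
    and s_const: "\<And>c p. c \<in> Atlas M \<Longrightarrow> p \<in> fst c \<Longrightarrow>
      \<exists>W. openin (Top M) W \<and> p \<in> W \<and> W \<subseteq> fst c \<and> (\<forall>q\<in>W. s c q = s c p)"
    using orientation_sign by blast
  define sc where "sc c x = s c (chart_inv c x)" for c x
  \<comment> \<open>Around each point a closed coordinate ball fits into the neighbourhood on which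
    the sign is constant; this is the property \<open>G\<close> handed to
    \<open>partition_of_unity\<close>.\<close>
  have good: "\<exists>c r. c \<in> Atlas M \<and> p \<in> fst c \<and> 0 < r \<and>
      cball (snd c p) r \<subseteq> chart_image c \<and> (\<exists>\<epsilon>. \<forall>x\<in>cball (snd c p) r. sc c x = \<epsilon>)" if "p \<in> points M" for p
  proof -
    obtain c where c: "c \<in> Atlas M" "p \<in> fst c"
      using chart_cover[OF \<open>p \<in> points M\<close>] by blast
    obtain W where W: "openin (Top M) W" "p \<in> W" "W \<subseteq> fst c" "\<And>q. q \<in> W \<Longrightarrow> s c q = s c p"
      using s_const[OF c] by blast
    obtain r where r: "0 < r" "cball (snd c p) r \<subseteq> snd c ` W"
      using open_chart_image_of[OF c(1) W(1,3)] W(2) open_contains_cball by blast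
    have "sc c x = s c p" if x: "x \<in> cball (snd c p) r" for x
    proof -
      obtain q where q: "x = snd c q" "q \<in> W"
        using r(2) x by blast
      have "q \<in> fst c" using W(3) q(2) by (rule subsetD)
      then show ?thesis
        unfolding sc_def q(1) chart_inv_chart[OF c(1) \<open>q \<in> fst c\<close>] using W(4)[OF q(2)] by simp
    qed
    moreover have "cball (snd c p) r \<subseteq> chart_image c"
      using r(2) W(3) by (rule order_trans[OF _ image_mono])
    ultimately show ?thesis
      using c r(1) by blast
  qed
  obtain I :: "'a set" and c K \<rho> where I: "finite I"
    and c: "\<And>i. i \<in> I \<Longrightarrow> c i \<in> Atlas M" and K: "\<And>i. i \<in> I \<Longrightarrow> compact (K i)"
    "\<And>i. i \<in> I \<Longrightarrow> K i \<subseteq> chart_image (c i)" and const: "\<And>i. i \<in> I \<Longrightarrow> \<exists>\<epsilon>. \<forall>x\<in>K i. sc (c i) x = \<epsilon>"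
    and \<rho>: "\<And>i. i \<in> I \<Longrightarrow> C1_fun (\<rho> i)" and \<rho>_nonneg: "\<And>i p. p \<in> points M \<Longrightarrow> 0 \<le> \<rho> i p"
    and \<rho>_chart: "\<And>i p. p \<notin> fst (c i) \<Longrightarrow> \<rho> i p = 0"
    and \<rho>_supp: "\<And>i x. i \<in> I \<Longrightarrow> x \<in> chart_image (c i) - K i \<Longrightarrow> \<rho> i (chart_inv (c i) x) = 0"
    and \<rho>_sum: "\<And>p. p \<in> points M \<Longrightarrow> (\<Sum>i\<in>I. \<rho> i p) = 1"
  proof (rule partition_of_unity[OF compact, of "\<lambda>c B. \<exists>\<epsilon>. \<forall>x\<in>B. sc c x = \<epsilon>", OF good], goal_cases)
    case (2 I c K \<rho>)
    show ?case by (rule that) (fact 2)+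
  qed
  from const obtain \<epsilon> where \<epsilon>: "\<And>i x. i \<in> I \<Longrightarrow> x \<in> K i \<Longrightarrow> sc (c i) x = \<epsilon> i"
    by metis
  let ?U = "\<lambda>i. chart_image (c i)"
  let ?R = "\<lambda>i d x. \<rho> i (chart_inv d x)"
  have inM: "chart_inv d x \<in> points M" if "d \<in> Atlas M" "x \<in> chart_image d" for d x
    by (rule subsetD[OF chart_subset_points[OF that(1)] chart_inv_in[OF that(2)]])
  have boundary_0: "boundary (\<rho> i) d x = 0"
    if "i \<in> I" "d \<in> Atlas M" "x \<in> chart_image d" "?R i d x = 0" for i d x
    by (rule boundary_eq_0[OF \<rho>[OF that(1)] \<rho>_nonneg that(2-4)])
  have cont_R: "continuous_on (chart_image d) (?R i d)" if "i \<in> I" "d \<in> Atlas M" for i d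
    by (rule C1_on_imp_continuous_on[OF C1_funD[OF \<rho>[OF that(1)] that(2)]])
  text \<open>On the support of \<open>\<rho> i\<close> the orientation sign is constant, so it may be moved in and out of
    integrals over the chart \<open>c i\<close>.\<close>
  have sign_out: "sc (c i) x * g x = \<epsilon> i * g x"
    if "i \<in> I" "\<And>x. x \<in> ?U i - K i \<Longrightarrow> g x = 0" "x \<in> ?U i" for i g x
    using that \<epsilon>[of i x] by (cases "x \<in> K i") simp_all
  have signed_int: "(\<lambda>x. sc (c i) x * g x) absolutely_integrable_on ?U i"
    if i: "i \<in> I" and g: "continuous_on (?U i) g" "\<And>x. x \<in> ?U i - K i \<Longrightarrow> g x = 0" for i g
  proof -
    have "(\<lambda>x. \<epsilon> i * g x) absolutely_integrable_on ?U i"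
      by (rule absolutely_integrable_compact_support[OF K(1,2)[OF i]])
        (use g continuous_on_subset[OF g(1) K(2)[OF i]] in \<open>auto intro: continuous_on_mult continuous_on_const\<close>)
    then show ?thesis
      by (rule absolutely_integrable_spike[OF _ negligible_empty]) (rule sign_out[OF i], erule g(2), simp)
  qed
  define B where "B i d x = sc d x * boundary (\<rho> i) d x" for i d x
  define P where "P i d x = sc d x * (?R i d x * energy d x)" for i d x
  have B_int: "B i (c i) absolutely_integrable_on ?U i" if i: "i \<in> I" for i
    unfolding B_def
    by (rule signed_int[OF i continuous_on_boundary[OF \<rho>[OF i] c[OF i]]])
      (use boundary_0[OF i c[OF i]] \<rho>_supp[OF i] in simp)
  have P_int: "P i (c i) absolutely_integrable_on ?U i" if i: "i \<in> I" for i
    unfolding P_def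
    by (rule signed_int[OF i continuous_on_mult[OF cont_R[OF i c[OF i]] continuous_on_energy[OF c[OF i]]]])
      (use \<rho>_supp[OF i] in simp)
  have stokes: "2 * integral (?U i) (B i (c i)) + integral (?U i) (P i (c i)) = 0" if i: "i \<in> I" for i
  proof -
    have st: "integral (?U i) (\<lambda>x. 2 * boundary (\<rho> i) (c i) x + ?R i (c i) x * energy (c i) x) = 0"
      by (rule chart_stokes(2)[OF c[OF i] K[OF i] \<rho>[OF i]]) (erule \<rho>_supp[OF i])
    have "2 * integral (?U i) (B i (c i)) + integral (?U i) (P i (c i)) =
        integral (?U i) (\<lambda>x. 2 * B i (c i) x + P i (c i) x)"
      using B_int[OF i, THEN set_lebesgue_integral_eq_integral(1)] P_int[OF i, THEN set_lebesgue_integral_eq_integral(1)]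
      by (simp add: integral_add integrable_on_mult_right)
    also have "\<dots> = integral (?U i) (\<lambda>x. \<epsilon> i * (2 * boundary (\<rho> i) (c i) x + ?R i (c i) x * energy (c i) x))"
    proof (rule integral_cong)
      fix x assume x: "x \<in> ?U i"
      have "2 * B i (c i) x + P i (c i) x =
          sc (c i) x * (2 * boundary (\<rho> i) (c i) x + ?R i (c i) x * energy (c i) x)"
        by (simp add: B_def P_def algebra_simps)
      also have "\<dots> = \<epsilon> i * (2 * boundary (\<rho> i) (c i) x + ?R i (c i) x * energy (c i) x)"
        by (rule sign_out[OF i _ x]) (use boundary_0[OF i c[OF i]] \<rho>_supp[OF i] in simp)
      finally show "2 * B i (c i) x + P i (c i) x = \<dots>" .
    qed
    also have "\<dots> = 0"
      by (simp add: st)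
    finally show ?thesis .
  qed
  \<comment> \<open>The boundary term of \<open>\<rho> i\<close> is cut up by the same partition a
    second time. The piece for \<open>i\<close>, \<open>j\<close> lives on the overlap of
    \<open>c i\<close> and \<open>c j\<close>, so it can be moved to \<open>c j\<close>, where all
    \<open>i\<close> are finally summed in one chart.\<close>
  define G where "G i j d x = ?R j d x * B i d x" for i j d x
  have G_int: "G i j (c i) absolutely_integrable_on ?U i" if ij: "i \<in> I" "j \<in> I" for i j
  proof -
    have "(\<lambda>x. sc (c i) x * (?R j (c i) x * boundary (\<rho> i) (c i) x)) absolutely_integrable_on ?U i"
      by (rule signed_int[OF ij(1) continuous_on_mult[OF cont_R[OF ij(2) c[OF ij(1)]]
            continuous_on_boundary[OF \<rho>[OF ij(1)] c[OF ij(1)]]]])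
        (use boundary_0[OF ij(1) c[OF ij(1)]] \<rho>_supp[OF ij(1)] in simp)
    then show ?thesis
      unfolding G_def B_def by (simp add: mult.left_commute)
  qed
  have G_change: "G i j (c j) absolutely_integrable_on ?U j \<and>
      integral (?U i) (G i j (c i)) = integral (?U j) (G i j (c j))" if ij: "i \<in> I" "j \<in> I" for i j
  proof (rule integral_chart_change[where G = "G i j", OF smooth c[OF ij(1)] c[OF ij(2)]])
    show "G i j (c i) absolutely_integrable_on ?U i"
      by (rule G_int[OF ij])
  next
    fix p assume p: "p \<in> fst (c i)" "p \<in> fst (c j)"
    let ?D = "det (matrix (jacobian (c i) (c j) (snd (c i) p)))"
    note ci = chart_inv_chart[OF c[OF ij(1)] p(1)] and cj = chart_inv_chart[OF c[OF ij(2)] p(2)]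
    \<comment> \<open>The sign of the determinant from \<open>s_change\<close> and the determinant
      from \<open>boundary_transition\<close> combine to its absolute value.\<close>
    have "G i j (c i) (snd (c i) p) = \<rho> j p * ((sgn ?D * s (c j) p) * (?D * boundary (\<rho> i) (c j) (snd (c j) p)))"
      unfolding G_def B_def sc_def ci boundary_transition[OF \<rho>[OF ij(1)] c[OF ij(1)] c[OF ij(2)] p]
        s_change[OF c[OF ij(1)] c[OF ij(2)] p] ..
    also have "\<dots> = \<bar>?D\<bar> * G i j (c j) (snd (c j) p)"
      unfolding G_def B_def sc_def cj by (simp add: abs_sgn mult.commute mult.left_commute)
    finally show "G i j (c i) (snd (c i) p) = \<bar>?D\<bar> * G i j (c j) (snd (c j) p)" .
  next
    fix x assume x: "x \<in> ?U i - overlap (c i) (c j)"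
    have "chart_inv (c i) x \<notin> fst (c j)"
    proof
      assume "chart_inv (c i) x \<in> fst (c j)"
      then have "x \<in> overlap (c i) (c j)"
        using x chart_inv_in[of x "c i"] chart_chart_inv[of x "c i"] by (metis DiffD1 IntI imageI)
      then show False using x by blast
    qed
    then show "G i j (c i) x = 0"
      by (simp add: G_def \<rho>_chart)
  next
    fix x assume x: "x \<in> ?U j - overlap (c j) (c i)"
    have "chart_inv (c j) x \<notin> fst (c i)"
    proof
      assume "chart_inv (c j) x \<in> fst (c i)"
      then have "x \<in> overlap (c j) (c i)"
        using x chart_inv_in[of x "c j"] chart_chart_inv[of x "c j"] by (metis DiffD1 IntI imageI)
      then show False using x by blast
    qed
    \<comment> \<open>Outside the domain of \<open>c i\<close> the function \<open>\<rho> i\<close>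
      attains its minimum 0, so its derivative and with it the boundary term vanish there
      too.\<close>
    then have "?R i (c j) x = 0"
      by (rule \<rho>_chart)
    with x show "G i j (c j) x = 0"
      using boundary_0[OF ij(1) c[OF ij(2)]] by (simp add: G_def B_def)
  qed
  \<comment> \<open>\<open>boundary\<close> is linear in the differential of its function, and the
    functions \<open>\<rho> i\<close> sum to the constant 1, whose differential is 0.\<close>
  have boundary_sum: "(\<Sum>i\<in>I. boundary (\<rho> i) d x) = 0" if d: "d \<in> Atlas M" and x: "x \<in> chart_image d" for d x
  proof -
    have "((\<lambda>y. \<Sum>i\<in>I. ?R i d y) has_derivative (\<lambda>v. \<Sum>i\<in>I. frechet_derivative (?R i d) (at x) v)) (at x)"
      by (rule has_derivative_sum) (rule C1_on_has_derivative[OF C1_funD[OF \<rho> d] x])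
    then have "((\<lambda>y. 1) has_derivative (\<lambda>v. \<Sum>i\<in>I. frechet_derivative (?R i d) (at x) v)) (at x)"
      by (rule has_derivative_transform_within_open[OF _ chart_image_open[OF d] x]) (rule \<rho>_sum[OF inM[OF d]])
    then have "(\<lambda>v. \<Sum>i\<in>I. frechet_derivative (?R i d) (at x) v) = (\<lambda>v. 0)"
      by (rule has_derivative_unique) (rule has_derivative_const)
    then have 0: "(\<Sum>i\<in>I. frechet_derivative (?R i d) (at x) v) = 0" for v
      by (rule fun_cong)
    have "(\<Sum>i\<in>I. boundary (\<rho> i) d x) = alt_sum (\<lambda>\<sigma>. (\<Sum>i\<in>I. pd (\<sigma> 1) (?R i d) x) * acoef d (\<sigma> 2) x *
        bcoef d (\<sigma> 3) (\<sigma> 4) x * fcoef d (\<sigma> 5) (\<sigma> 6) (\<sigma> 7) x)"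
      unfolding boundary_def alt_sum_sum[symmetric] sum_distrib_right ..
    then show ?thesis
      unfolding 0 by (simp add: alt_sum_def)
  qed
  have "(\<Sum>i\<in>I. integral (?U i) (B i (c i))) = (\<Sum>i\<in>I. \<Sum>j\<in>I. integral (?U j) (G i j (c j)))"
  proof (rule sum.cong[OF refl])
    fix i assume i: "i \<in> I"
    \<comment> \<open>The factor 1 is inserted as the sum of all \<open>\<rho> j\<close>; each piece
      is then carried to the chart \<open>c j\<close>.\<close>
    have "integral (?U i) (B i (c i)) = integral (?U i) (\<lambda>x. \<Sum>j\<in>I. G i j (c i) x)"
      by (rule integral_cong) (simp only: G_def sum_distrib_right[symmetric] \<rho>_sum[OF inM[OF c[OF i]]] mult_1)
    also have "\<dots> = (\<Sum>j\<in>I. integral (?U i) (G i j (c i)))"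
      by (rule integral_sum[OF I]) (rule set_lebesgue_integral_eq_integral(1)[OF G_int[OF i]])
    also have "\<dots> = (\<Sum>j\<in>I. integral (?U j) (G i j (c j)))"
      by (rule sum.cong[OF refl]) (rule conjunct2[OF G_change[OF i]])
    finally show "integral (?U i) (B i (c i)) = (\<Sum>j\<in>I. integral (?U j) (G i j (c j)))" .
  qed
  also have "\<dots> = (\<Sum>j\<in>I. \<Sum>i\<in>I. integral (?U j) (G i j (c j)))"
    by (rule sum.swap)
  also have "\<dots> = (\<Sum>j\<in>I. 0)"
  proof (rule sum.cong[OF refl])
    fix j assume j: "j \<in> I"
    have "(\<Sum>i\<in>I. integral (?U j) (G i j (c j))) = integral (?U j) (\<lambda>x. \<Sum>i\<in>I. G i j (c j) x)"
      by (rule integral_sum[OF I, symmetric])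
        (rule set_lebesgue_integral_eq_integral(1)[OF conjunct1[OF G_change[OF _ j]]])
    also have "\<dots> = integral (?U j) (\<lambda>x. 0)"
    proof (rule integral_cong)
      fix x assume "x \<in> ?U j"
      then show "(\<Sum>i\<in>I. G i j (c j) x) = 0"
        using boundary_sum[OF c[OF j]] unfolding G_def B_def sum_distrib_left[symmetric] by simp
    qed
    finally show "(\<Sum>i\<in>I. integral (?U j) (G i j (c j))) = 0"
      by simp
  qed
  finally have "(\<Sum>i\<in>I. integral (?U i) (B i (c i))) = 0"
    by simp
  moreover have "(\<Sum>i\<in>I. integral (?U i) (P i (c i))) = (\<Sum>i\<in>I. - 2 * integral (?U i) (B i (c i)))"
    using stokes by (intro sum.cong) (simp_all add: algebra_simps eq_neg_iff_add_eq_0)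
  ultimately have P_sum: "(\<Sum>i\<in>I. integral (?U i) (P i (c i))) = 0"
    unfolding sum_distrib_left[symmetric] by simp
  have P_nonneg: "0 \<le> P i (c i) x" if i: "i \<in> I" and x: "x \<in> ?U i" for i x
  proof -
    have "0 \<le> sc (c i) x * energy (c i) x"
      using s_nonneg[OF c[OF i] chart_inv_in[OF x]] unfolding sc_def chart_chart_inv[OF x] .
    then have "0 \<le> ?R i (c i) x * (sc (c i) x * energy (c i) x)"
      by (rule mult_nonneg_nonneg[OF \<rho>_nonneg[OF inM[OF c[OF i] x]]])
    then show ?thesis
      unfolding P_def by (simp only: mult.left_commute)
  qed
  have P_integrable: "P i (c i) integrable_on ?U i" if "i \<in> I" for i
    by (rule set_lebesgue_integral_eq_integral(1)[OF P_int[OF that]])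
  have P_int_0: "integral (?U i) (P i (c i)) = 0" if "i \<in> I" for i
  proof -
    have "0 \<le> integral (?U j) (P j (c j))" if "j \<in> I" for j
      by (rule integral_nonneg[OF P_integrable[OF that] P_nonneg[OF that]])
    then have "\<forall>i\<in>I. integral (?U i) (P i (c i)) = 0"
      using P_sum sum_nonneg_eq_0_iff[OF I, of "\<lambda>i. integral (?U i) (P i (c i))"] by blast
    then show ?thesis
      using that by (rule bspec)
  qed
  have P_0: "P i (c i) x = 0" if i: "i \<in> I" and x: "x \<in> ?U i" for i x
  proof (rule integral_nonneg_eq_0_imp_0[OF chart_image_open[OF c[OF i]] _ _ P_integrable[OF i] P_int_0[OF i] x])
    show "0 \<le> P i (c i) y" if "y \<in> ?U i" for y
      by (rule P_nonneg[OF i that])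
    \<comment> \<open>The sign need not be continuous on all of the chart, but \<open>P\<close>
      agrees there with a continuous function in which the sign is replaced by its constant value on
      the support.\<close>
    have "continuous_on (?U i) (\<lambda>x. \<epsilon> i * (?R i (c i) x * energy (c i) x))"
      by (intro continuous_on_mult continuous_on_const cont_R continuous_on_energy c i)
    then show "continuous_on (?U i) (P i (c i))"
    proof (rule continuous_on_eq)
      fix y assume "y \<in> ?U i"
      then show "\<epsilon> i * (?R i (c i) y * energy (c i) y) = P i (c i) y"
        unfolding P_def by (intro sign_out[OF i, symmetric]) (simp_all only: \<rho>_supp[OF i] mult_zero_left)
    qed
  qed
  have "(\<Sum>i\<in>I. \<rho> i p) \<noteq> 0"
    using \<rho>_sum[OF assms] by simp
  then obtain i where i: "i \<in> I" "\<rho> i p \<noteq> 0"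
    by (meson sum.neutral)
  then have p: "p \<in> fst (c i)"
    using \<rho>_chart by blast
  have "P i (c i) (snd (c i) p) = 0"
    by (rule P_0[OF i(1)]) (use p in blast)
  then have "s (c i) p * energy (c i) (snd (c i) p) = 0"
    using i(2) unfolding P_def sc_def chart_inv_chart[OF c[OF i(1)] p] by simp
  then show False
    using s_pos[OF c[OF i(1)] p Xp] by linarith
qed

end

theorem corollary1p2:
  fixes M :: "('a, 7) manifold" and \<phi> :: "('a, 7) form"
  assumes "closed_manifold M" and "closed_G2_structure M \<phi>"
  shows "(\<nexists>X. Rochesterian_vfield M \<phi> X \<and> nonzero_vfield M X) \<and>
         (\<nexists>\<alpha>. Rochesterian_form M \<phi> \<alpha> \<and> nonzero_mod_closed M \<alpha>)"
proof -
  have X0: "X p = (\<lambda>c. 0)"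
    if "vector_field M X" "diff_form M 1 \<alpha>" "form_eq M 2 (contraction X \<phi>) (ext_deriv M \<alpha>)" "p \<in> points M" for X \<alpha> p
  proof -
    interpret rochesterian M \<phi> X \<alpha>
      using assms that(1-3) by unfold_locales (simp_all add: closed_manifold_def)
    show ?thesis using that(4) by (rule X_eq_0)
  qed
  have "\<not> nonzero_vfield M X" if "Rochesterian_vfield M \<phi> X" for X
    using that X0 unfolding Rochesterian_vfield_def nonzero_vfield_def by blast
  moreover have "\<not> nonzero_mod_closed M \<alpha>" if "Rochesterian_form M \<phi> \<alpha>" for \<alpha>
  proof -
    obtain X where \<alpha>: "diff_form M 1 \<alpha>" and X: "vector_field M X"
      and eq: "form_eq M 2 (ext_deriv M \<alpha>) (contraction X \<phi>)"
      using \<open>Rochesterian_form M \<phi> \<alpha>\<close> unfolding Rochesterian_form_def by blast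
    have eq': "form_eq M 2 (contraction X \<phi>) (ext_deriv M \<alpha>)"
      using eq by (simp add: form_eq_def)
    have "ext_deriv M \<alpha> p vs = 0" if p: "p \<in> points M" and vs: "vs \<in> arg_lists M 2 p" for p vs
    proof -
      let ?z = "\<lambda>c. 0 :: real ^ 7"
      have alt: "alternating_multilinear M 3 p (\<phi> p)"
        using assms(2) p by (simp add: closed_G2_structure_def G2_structure_def diff_form_def)
      have Xp: "X p = ?z"
        by (rule X0[OF X \<alpha> eq' p])
      have z: "?z \<in> tangent_space M p"
        using X p unfolding Xp[symmetric] vector_field_def by blast
      then have "?z # vs \<in> arg_lists M 3 p"
        using vs by (simp add: arg_lists_def)
      \<comment> \<open>With both coefficients 0, linearity in the first slot shows that
        \<open>\<phi> p\<close> vanishes on a list headed by the zero vector.\<close>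
      from alternating_multilinear_combination[OF alt this _ z z, of 0 0 0] have "\<phi> p (?z # vs) = 0"
        by simp
      then have "contraction X \<phi> p vs = 0"
        by (simp add: contraction_def Xp)
      then show ?thesis
        using form_eqD[OF eq p vs] by simp
    qed
    then show ?thesis
      by (simp add: nonzero_mod_closed_def form_eq_def zero_form_def)
  qed
  ultimately show ?thesis by blast
qed

end
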